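(* Let $S(\mathbf n)$, $\mathbf n=(n_1,n_2)$, be the number of stable matchings for $n_1$ men and $n_2$ women with independent uniformly random preferences. If $n_2>n_1\to\infty$, then \[ \mathbb E[S(\mathbf n)]\sim\frac{n_1\exp\Bigl(-\frac{e^{s(\mathbf n)}-1-s(\mathbf n)}{e^{s(\mathbf n)}-1}\Bigr)}{(n_2-n_1)\,s(\mathbf n)},\qquad s(\mathbf n):=\log\frac{n_2}{n_2-n_1}. \] Consequently: (i) if $n_2\gg n_2-n_1>0$, i.e. $n_2/n_1\to1$ and $s(\mathbf n)\to\infty$, then \[ \mathbb E[S(\mathbf n)]\sim e^{-1}\frac{n_1}{(n_2-n_1)\log n_1}; \] (ii) if $n_2/n_1\to\infty$, then $\mathbb E[S(\mathbf n)]\to1$; (iii) if $\lim n_2/n_1=c>1$ is finite, then \[ \lim\mathbb E[S(\mathbf n)]=e^{-1}\frac{\lambda(c)}{\log\lambda(c)},\qquad \lambda(c)=\Bigl(\frac{c}{c-1}\Bigr)^{c-1}. \]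
   Context: There are $n_1$ men (the set $[n_1]$) and $n_2$ women (the set $[n_2]$), $n_1<n_2$. Each man strictly ranks all $n_2$ women and each woman strictly ranks all $n_1$ men; the $n_1+n_2$ rankings are independent, each a uniformly random permutation. A matching is an injection $\mathcal M:[n_1]\to[n_2]$. It is stable if there is no pair $(m,w)$, $m\in[n_1]$, $w\in[n_2]$, not matched to each other in $\mathcal M$, such that $m$ prefers $w$ to his partner $\mathcal M(m)$ and, if $w$ is matched in $\mathcal M$, $w$ prefers $m$ to her partner in $\mathcal M$ (an unmatched $w$ imposes no further condition). $S(\mathbf n)$ is the number of stable matchings. $A\sim B$ means $A/B\to1$, and $A\gg B$ means $B/A\to0$; all limits are along sequences of pairs $(n_1,n_2)$ with $n_2>n_1\to\infty$.
   Formalization: Part (i) as printed is false (n_2 = n_1 + floor(sqrt n_1) is off by a factor 2); under its hypothesis it is replaced by E[S] ~ e^{-1} n_1/((n_2-n_1) s(n)), plus: the printed formula with log n_1 holds if and only if s(n) ~ log n_1. *)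

theory Defs
  imports "HOL-Probability.Probability" "HOL-Library.Landau_Symbols"
begin

text \<open>
  Men are \<open>{1..n1}\<close> and women are \<open>{1..n2}\<close>. A strict ranking is encoded by its rank function:
  \<open>P m\<close> is a permutation of \<open>{1..n2}\<close>, where \<open>P m w\<close> is the position of woman \<open>w\<close> on the list of
  man \<open>m\<close>, and \<open>Q w m\<close> is the position of man \<open>m\<close> on the list of woman \<open>w\<close>. Position 1 is the
  most preferred one.
\<close>

type_synonym ranking = "nat \<Rightarrow> nat"

definition prefers :: "ranking \<Rightarrow> nat \<Rightarrow> nat \<Rightarrow> bool" where
  "prefers r a b \<longleftrightarrow> r a < r b"

text \<open>
  Extensional functions are used so that a matching is determined by its values on \<open>{1..n1}\<close>,
  which is what makes counting matchings meaningful.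
\<close>

definition matchings :: "nat \<Rightarrow> nat \<Rightarrow> (nat \<Rightarrow> nat) set" where
  "matchings n1 n2 = {M \<in> {1..n1} \<rightarrow>\<^sub>E {1..n2}. inj_on M {1..n1}}"

text \<open>The last conjunct is vacuously true if \<open>w\<close> is unmatched.\<close>

definition blocking_pair ::
  "nat \<Rightarrow> nat \<Rightarrow> (nat \<Rightarrow> ranking) \<Rightarrow> (nat \<Rightarrow> ranking) \<Rightarrow> (nat \<Rightarrow> nat) \<Rightarrow> nat \<Rightarrow> nat \<Rightarrow> bool" where
  "blocking_pair n1 n2 P Q M m w \<longleftrightarrow>
     m \<in> {1..n1} \<and> w \<in> {1..n2} \<and> M m \<noteq> w \<and>
     prefers (P m) w (M m) \<and>
     (\<forall>m'\<in>{1..n1}. M m' = w \<longrightarrow> prefers (Q w) m m')"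

definition stable_matchings ::
  "nat \<Rightarrow> nat \<Rightarrow> (nat \<Rightarrow> ranking) \<Rightarrow> (nat \<Rightarrow> ranking) \<Rightarrow> (nat \<Rightarrow> nat) set" where
  "stable_matchings n1 n2 P Q =
     {M \<in> matchings n1 n2. \<not> (\<exists>m w. blocking_pair n1 n2 P Q M m w)}"

definition random_ranking :: "nat \<Rightarrow> ranking pmf" where
  "random_ranking n = pmf_of_set {p. p permutes {1..n}}"

text \<open>
  Independence of all \<open>n1 + n2\<close> rankings is expressed by the product distribution. The value
  \<open>id\<close> is only the default of \<^const>\<open>Pi_pmf\<close> outside the index set and plays no role.
\<close>

definition random_preferences ::
  "nat \<Rightarrow> nat \<Rightarrow> ((nat \<Rightarrow> ranking) \<times> (nat \<Rightarrow> ranking)) pmf" where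
  "random_preferences n1 n2 =
     pair_pmf (Pi_pmf {1..n1} id (\<lambda>_. random_ranking n2))
              (Pi_pmf {1..n2} id (\<lambda>_. random_ranking n1))"

definition expected_stable :: "nat \<Rightarrow> nat \<Rightarrow> real" where
  "expected_stable n1 n2 =
     measure_pmf.expectation (random_preferences n1 n2)
       (\<lambda>(P, Q). real (card (stable_matchings n1 n2 P Q)))"

definition s_param :: "nat \<Rightarrow> nat \<Rightarrow> real" where
  "s_param n1 n2 = ln (real n2 / (real n2 - real n1))"

definition lam :: "real \<Rightarrow> real" where
  "lam c = (c / (c - 1)) powr (c - 1)"

end

theory Submission
  imports Defs "HOL-Real_Asymp.Real_Asymp"
begin

text \<open>
  Write \<open>n = n1\<close>, \<open>d = n2 - n1\<close>. Conditioning on the women's rankings, man \<open>i\<close> is not part of a blocking pair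
  with probability \<open>1 / (1 + d + l\<^sub>i)\<close>, where \<open>l\<^sub>i\<close> counts the other men's partners who prefer \<open>i\<close>. For
  a woman matched to \<open>j\<close>, the set of men she prefers to \<open>j\<close> is a mixture over a uniform \<open>y\<^sub>j\<close> of Bernoulli(\<open>y\<^sub>j\<close>)
  sets, so given \<open>y\<close> the \<open>l\<^sub>i\<close> are independent and \<open>E[S] = n2!/d! \<integral> \<Prod>\<^sub>i I\<^sub>i(y) dy\<close> over the unit cube, with
  \<open>I\<^sub>i(y) = \<integral> (1 - x)^d \<Prod>\<^bsub>j\<noteq>i\<^esub> (1 - x y\<^sub>j) dx\<close>. With \<open>A = d + \<Sum> y\<^sub>j\<close> and \<open>T = \<Sum> y\<^sub>j\<^sup>2\<close>, Laplace's method gives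
  \<open>A^n \<Prod>\<^sub>i I\<^sub>i \<approx> exp (1 - d/A - n (d + T)/A\<^sup>2)\<close>, and the left-hand side never exceeds \<open>e\<^sup>2\<close>.

  Since \<open>(n-1)! A^(-n) = \<integral> u^(n-1) e^(-u A) du\<close>, the weight \<open>A^(-n)\<close> on the cube is the marginal of a measure in
  \<open>(u, y)\<close>. Under it the \<open>y\<^sub>j\<close> are independent truncated exponentials of rate \<open>u\<close> given \<open>u\<close>, \<open>u A\<close> is Gamma(\<open>n\<close>)
  given \<open>y\<close>, and \<open>u\<close> is, up to the slowly varying factor \<open>(1 - e^(-u))/u\<close>, minus the logarithm of a
  Beta(\<open>d, n\<close>) variable, which concentrates at \<open>s = ln (n2/d)\<close>. Chebyshev's inequality applied to \<open>u\<close>, \<open>u A\<close> and \<open>T\<close>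
  then evaluates the integral uniformly in \<open>d\<close>.
\<close>

section \<open>Reduction to an integral over the unit cube\<close>

text \<open>The number d of surplus women may lie anywhere from 1 to far above n, so s ranges over
  the whole half-line and no expansion for small or for large s covers every case. Hence u is
  compared with s through its relative error, and its spread is measured by v = 1/d - 1/(n+d), which
  stays small against s^2 even when s is tiny. The factor A^(-n) couples all coordinates; u is
  introduced to decouple them. The joint measure is not normalised: its total mass is about (e^s -
  1)/s and supplies the algebraic part of the formula, while the average of A^n \<Prod> I_i supplies
  the exponential. With \<kappa> = s d/n = s/(e^s - 1), typical points have d/A near \<kappa> and n
  (d + T)/A^2 near 2 - 2 \<kappa>, so the exponent is near \<kappa> - 1 = -(e^s - 1 - s)/(e^s - 1).
  The bound e^2 is crude, but atypical points carry a vanishing fraction of the mass, so any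
  constant would do there.\<close>

lemma prob_first_permutation:
  fixes A :: "nat set"
  assumes fin: "finite A" and a: "a \<in> A" and Z: "Z \<subseteq> A" "a \<notin> Z"
  shows "measure_pmf.prob (pmf_of_set {p. p permutes A}) {p. \<forall>b\<in>Z. p a < p b} = 1 / (1 + real (card Z))"
proof -
  let ?U = "{p. p permutes A}"
  \<comment> \<open>Exactly one element of \<open>insert a Z\<close> is ranked best, so the events
    \<open>E c\<close> partition the permutations; exchanging the ranks of \<open>a\<close> and
    \<open>c\<close> shows that they all have the same size.\<close>
  define E where "E c = {p. p permutes A \<and> (\<forall>b\<in>insert a Z - {c}. p c < p b)}" for c
  have finU: "finite ?U" using fin by (rule finite_permutations)
  have finE: "finite (E c)" for c
    by (rule finite_subset[OF _ finU]) (auto simp: E_def)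
  have finZ: "finite Z" using Z fin finite_subset by blast
  have ne: "?U \<noteq> {}" using permutes_id by blast
  have card_eq: "card (E c) = card (E a)" if c: "c \<in> insert a Z" for c
  proof -
    have cA: "c \<in> A" using c a Z by auto
    have tr: "p \<circ> Transposition.transpose a c permutes A" if "p permutes A" for p
      by (rule permutes_compose[OF permutes_swap_id[OF a cA] that])
    have "bij_betw (\<lambda>p. p \<circ> Transposition.transpose a c) (E a) (E c)"
      by (rule bij_betw_byWitness[where f' = "\<lambda>p. p \<circ> Transposition.transpose a c"])
         (use c Z in \<open>auto simp: E_def tr comp_assoc Transposition.transpose_def split: if_splits\<close>)
    then show ?thesis by (simp add: bij_betw_same_card)
  qed
  have union: "(\<Union>c\<in>insert a Z. E c) = ?U"
  proof
    show "?U \<subseteq> (\<Union>c\<in>insert a Z. E c)"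
    proof
      fix p assume "p \<in> ?U"
      then have p: "p permutes A" by simp
      have "Min (p ` insert a Z) \<in> p ` insert a Z"
        using finZ by (intro Min_in) auto
      then obtain c where c: "c \<in> insert a Z" "p c = Min (p ` insert a Z)" by (metis imageE)
      have "\<forall>b\<in>insert a Z - {c}. p c < p b"
      proof
        fix b assume that: "b \<in> insert a Z - {c}"
        have "p c \<le> p b" unfolding c(2) using finZ that by (intro Min_le) auto
        moreover have "p c \<noteq> p b" using that permutes_inj[OF p] by (auto dest: injD)
        ultimately show "p c < p b" by simp
      qed
      then have "p \<in> E c" using p by (simp add: E_def)
      then show "p \<in> (\<Union>c\<in>insert a Z. E c)" using c(1) by blast
    qed
  qed (auto simp: E_def)
  have "card ?U = (\<Sum>c\<in>insert a Z. card (E c))"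
    unfolding union[symmetric]
  proof (rule card_UN_disjoint)
    show "\<forall>i\<in>insert a Z. \<forall>j\<in>insert a Z. i \<noteq> j \<longrightarrow> E i \<inter> E j = {}"
    proof (intro ballI impI)
      fix i j assume ij: "i \<in> insert a Z" "j \<in> insert a Z" "i \<noteq> j"
      have False if "p \<in> E i" "p \<in> E j" for p
      proof -
        have "p i < p j" "p j < p i" using that ij unfolding E_def by blast+
        then show False by simp
      qed
      then show "E i \<inter> E j = {}" by blast
    qed
  qed (use finZ finE in auto)
  also have "\<dots> = (\<Sum>c\<in>insert a Z. card (E a))"
    by (rule sum.cong[OF refl card_eq])
  finally have cU: "real (card ?U) = (1 + real (card Z)) * real (card (E a))"
    using finZ Z(2) by (simp add: algebra_simps)
  have "?U \<inter> {p. \<forall>b\<in>Z. p a < p b} = E a" using Z by (auto simp: E_def)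
  then have "measure_pmf.prob (pmf_of_set ?U) {p. \<forall>b\<in>Z. p a < p b} = card (E a) / card ?U"
    using measure_pmf_of_set[OF ne finU] by simp
  moreover have "card (E a) \<noteq> 0"
  proof
    assume "card (E a) = 0"
    with cU have "card ?U = 0" by simp
    with finU ne show False by simp
  qed
  ultimately show ?thesis unfolding cU by simp
qed

section \<open>The uniform law on the unit interval\<close>

definition unit_lebesgue :: "real measure" where
  "unit_lebesgue = restrict_space lborel {0..1}"

lemma space_unit_lebesgue [simp]: "space unit_lebesgue = {0..1}"
  by (simp add: unit_lebesgue_def space_restrict_space)

lemma prob_space_unit_lebesgue: "prob_space unit_lebesgue"
  unfolding unit_lebesgue_def
  by (rule prob_spaceI) (simp add: space_restrict_space emeasure_restrict_space)

lemma measurable_unit_lebesgue [measurable (raw)]: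
  "f \<in> borel_measurable borel \<Longrightarrow> f \<in> borel_measurable unit_lebesgue"
  unfolding unit_lebesgue_def by (intro measurable_restrict_space1) simp

lemma integrable_unit_lebesgue:
  fixes f :: "real \<Rightarrow> real"
  assumes "continuous_on {0..1} f"
  shows "integrable unit_lebesgue f"
  unfolding unit_lebesgue_def
  using borel_integrable_compact[OF _ assms]
  by (subst integrable_restrict_space) auto

lemma integral_unit_lebesgue:
  fixes f :: "real \<Rightarrow> real"
  assumes "\<And>x. x \<in> {0..1} \<Longrightarrow> isCont f x" "\<And>x. x \<in> {0..1} \<Longrightarrow> (F has_real_derivative f x) (at x)"
  shows "(\<integral>x. f x \<partial>unit_lebesgue) = F 1 - F 0"
proof -
  have "(\<integral>x. f x \<partial>unit_lebesgue) = (\<integral>x. f x * indicator {0..1} x \<partial>lborel)"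
    unfolding unit_lebesgue_def by (subst integral_restrict_space) (auto simp: mult_ac)
  also have "\<dots> = F 1 - F 0"
  proof (rule integral_FTC_Icc_real)
    show "(0::real) \<le> 1" by simp
    show "\<And>x. 0 \<le> x \<Longrightarrow> x \<le> 1 \<Longrightarrow> DERIV F x :> f x" using assms(2) by auto
    show "\<And>x. 0 \<le> x \<Longrightarrow> x \<le> 1 \<Longrightarrow> isCont f x" using assms(1) by auto
  qed
  finally show ?thesis .
qed



lemma integral_unit_lebesgue_one_minus_power:
  "(\<integral>y. (1 - y) ^ k \<partial>unit_lebesgue) = 1 / (1 + real k)"
proof -
  let ?F = "\<lambda>y::real. (1 - (1 - y) ^ Suc k) / (1 + real k)"
  have "(?F has_real_derivative (1 - y) ^ k) (at y)" for y
  proof -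
    have "((\<lambda>y. (1 - y) ^ Suc k) has_real_derivative - ((1 + real k) * (1 - y) ^ k)) (at y)"
      by (rule derivative_eq_intros refl | simp)+
    from DERIV_cdivide[OF DERIV_diff[OF DERIV_const[of 1] this], of "1 + real k"]
    show ?thesis by simp
  qed
  then have "(\<integral>y. (1 - y) ^ k \<partial>unit_lebesgue) = ?F 1 - ?F 0"
    by (intro integral_unit_lebesgue) auto
  then show ?thesis by simp
qed

section \<open>A ranking as a mixture of independent comparisons\<close>

lemma AE_random_ranking: "AE p in random_ranking n. p permutes {1..n}"
proof -
  have "{p. p permutes {1..n}} \<noteq> {}" using permutes_id by blast
  then show ?thesis
    unfolding random_ranking_def
    by (simp add: AE_measure_pmf_iff set_pmf_of_set finite_permutations)
qed

text \<open>Give every man an independent uniform score and let y be the score of j: given y, each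
  other man beats j with probability y, independently. The proof needs no scores. Splitting the
  event for (S, Z) by whether a new man x is above or below j gives the same recursion as y + (1 -
  y) = 1 gives for the integrals, and for empty S the integral is 1/(1 + card Z).\<close>

lemma prob_better_worse:
  assumes j: "j \<in> {1..n}" and S: "S \<subseteq> {1..n} - {j}" and Z: "Z \<subseteq> {1..n} - {j}" and "S \<inter> Z = {}"
  shows "measure_pmf.prob (random_ranking n) {p. (\<forall>i\<in>S. p i < p j) \<and> (\<forall>i\<in>Z. p j < p i)}
    = (\<integral>y. y ^ card S * (1 - y) ^ card Z \<partial>unit_lebesgue)"
proof -
  have "finite S" using S by (rule finite_subset) simp
  then show ?thesis using S Z \<open>S \<inter> Z = {}\<close>
  proof (induction S arbitrary: Z rule: finite_induct)
    case empty
    then show ?case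
      using prob_first_permutation[of "{1..n}" j Z] j
      unfolding random_ranking_def by (auto simp: integral_unit_lebesgue_one_minus_power)
  next
    case (insert x S)
    let ?E = "\<lambda>S Z. {p. (\<forall>i\<in>S. p i < p j) \<and> (\<forall>i\<in>Z. p j < p i)}"
    let ?P = "measure_pmf.prob (random_ranking n)"
    let ?I = "\<lambda>S Z. (\<integral>y. y ^ card S * (1 - y) ^ card Z \<partial>unit_lebesgue)"
    have finZ: "finite Z" using insert.prems by (meson finite_Diff finite_atLeastAtMost finite_subset)
    have xZ: "x \<notin> Z" "x \<noteq> j" using insert.prems by auto
    have "?P (?E S Z) = ?P (?E (insert x S) Z \<union> ?E S (insert x Z))"
    proof (rule measure_pmf.finite_measure_eq_AE)
      show "AE p in random_ranking n. p \<in> ?E S Z \<longleftrightarrow> p \<in> ?E (insert x S) Z \<union> ?E S (insert x Z)"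
        using AE_random_ranking[of n]
      proof eventually_elim
        case (elim p)
        then have "p x \<noteq> p j" using permutes_inj xZ by (metis injD)
        then show ?case by auto
      qed
    qed auto
    also have "\<dots> = ?P (?E (insert x S) Z) + ?P (?E S (insert x Z))"
      by (rule measure_pmf.finite_measure_Union) auto
    finally have "?P (?E (insert x S) Z) = ?P (?E S Z) - ?P (?E S (insert x Z))" by simp
    also have "?P (?E S Z) = ?I S Z"
      by (rule insert.IH) (use insert.prems in auto)
    also have "?P (?E S (insert x Z)) = ?I S (insert x Z)"
      by (rule insert.IH) (use insert.prems insert.hyps in auto)
    also have "?I S Z - ?I S (insert x Z)
        = (\<integral>y. y ^ card S * (1 - y) ^ card Z - y ^ card S * (1 - y) ^ card (insert x Z) \<partial>unit_lebesgue)"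
      by (rule Bochner_Integration.integral_diff[symmetric])
         (intro integrable_unit_lebesgue continuous_intros)+
    also have "\<dots> = ?I (insert x S) Z"
      using insert.hyps xZ finZ by (intro Bochner_Integration.integral_cong) (auto simp: algebra_simps)
    finally show ?case .
  qed
qed

text \<open>The integrand is left as one factor per man, not as powers, because this product form is
  what lets the sum over families of sets factor later.\<close>

lemma prob_better_set:
  assumes j: "j \<in> {1..n}" and S: "S \<subseteq> {1..n} - {j}"
  shows "measure_pmf.prob (random_ranking n) {p. {i \<in> {1..n} - {j}. p i < p j} = S}
    = (\<integral>y. (\<Prod>i\<in>{1..n} - {j}. if i \<in> S then y else 1 - y) \<partial>unit_lebesgue)"
proof -
  let ?Z = "{1..n} - {j} - S"
  have "measure_pmf.prob (random_ranking n) {p. {i \<in> {1..n} - {j}. p i < p j} = S}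
     = measure_pmf.prob (random_ranking n) {p. (\<forall>i\<in>S. p i < p j) \<and> (\<forall>i\<in>?Z. p j < p i)}"
  proof (rule measure_pmf.finite_measure_eq_AE)
    show "AE p in random_ranking n. p \<in> {p. {i \<in> {1..n} - {j}. p i < p j} = S}
        \<longleftrightarrow> p \<in> {p. (\<forall>i\<in>S. p i < p j) \<and> (\<forall>i\<in>?Z. p j < p i)}"
      using AE_random_ranking[of n]
    proof eventually_elim
      case (elim p)
      then have "p i = p j \<longleftrightarrow> i = j" for i by (metis permutes_inj injD)
      then have "p j < p i \<longleftrightarrow> \<not> p i < p j" if "i \<noteq> j" for i
        using that by (metis less_linear less_asym)
      then show ?case using S by auto
    qed
  qed auto
  also have "\<dots> = (\<integral>y. y ^ card S * (1 - y) ^ card ?Z \<partial>unit_lebesgue)"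
    by (rule prob_better_worse[OF j S]) auto
  also have "\<dots> = (\<integral>y. (\<Prod>i\<in>{1..n} - {j}. if i \<in> S then y else 1 - y) \<partial>unit_lebesgue)"
  proof (rule Bochner_Integration.integral_cong[OF refl])
    fix y :: real
    have *: "({1..n} - {j}) \<inter> {i. i \<in> S} = S" "({1..n} - {j}) \<inter> - {i. i \<in> S} = ?Z" using S by auto
    show "y ^ card S * (1 - y) ^ card ?Z = (\<Prod>i\<in>{1..n} - {j}. if i \<in> S then y else 1 - y)"
      by (subst prod.If_cases) (auto simp only: * prod_constant finite_Diff finite_atLeastAtMost)
  qed
  finally show ?thesis .
qed

section \<open>Regrouping the women's choices man by man\<close>

definition man_integral :: "nat \<Rightarrow> nat \<Rightarrow> (nat \<Rightarrow> real) \<Rightarrow> nat \<Rightarrow> real" where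
  "man_integral n d y i = (\<integral>x. (1 - x) ^ d * (\<Prod>j\<in>{1..n} - {i}. 1 - x * y j) \<partial>unit_lebesgue)"

text \<open>Since 1/(1+k) is the integral of (1-x)^k, expanding the product of 1 - x y = y (1-x) +
  (1-y) exhibits \<open>man_integral\<close> as the mean of 1/(1 + d + l), where l counts the
  successes of independent Bernoulli(\<open>y j\<close>) trials. The finite sum also makes it a
  polynomial in y, which later settles measurability.\<close>

lemma man_integral_eq_sum:
  "man_integral n d y i = (\<Sum>Z\<in>Pow ({1..n} - {i}).
     1 / (1 + real (d + card Z)) * (\<Prod>j\<in>{1..n} - {i}. if j \<in> Z then y j else 1 - y j))"
proof -
  let ?A = "{1..n} - {i}"
  let ?c = "\<lambda>Z. \<Prod>j\<in>?A. if j \<in> Z then y j else 1 - y j"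
  have c: "(\<Prod>j\<in>Z. y j * w) * (\<Prod>j\<in>?A - Z. 1 - y j) = ?c Z * w ^ card Z" if "Z \<in> Pow ?A" for Z w
  proof -
    have *: "?A \<inter> {i. i \<in> Z} = Z" "?A \<inter> - {i. i \<in> Z} = ?A - Z" using that by auto
    show ?thesis by (subst prod.If_cases) (auto simp only: * prod.distrib prod_constant finite_Diff finite_atLeastAtMost mult_ac)
  qed
  have "man_integral n d y i
      = (\<integral>x. (\<Sum>Z\<in>Pow ?A. ?c Z * (1 - x) ^ (d + card Z)) \<partial>unit_lebesgue)"
    unfolding man_integral_def
  proof (rule Bochner_Integration.integral_cong[OF refl])
    fix x :: real
    have "(\<Prod>j\<in>?A. 1 - x * y j) = (\<Prod>j\<in>?A. y j * (1 - x) + (1 - y j))"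
      by (simp add: algebra_simps)
    also have "\<dots> = (\<Sum>Z\<in>Pow ?A. ?c Z * (1 - x) ^ card Z)"
      by (subst prod_add, simp) (rule sum.cong[OF refl c])
    finally show "(1 - x) ^ d * (\<Prod>j\<in>?A. 1 - x * y j) = (\<Sum>Z\<in>Pow ?A. ?c Z * (1 - x) ^ (d + card Z))"
      by (simp add: sum_distrib_left power_add mult_ac)
  qed
  also have "\<dots> = (\<Sum>Z\<in>Pow ?A. ?c Z * (1 / (1 + real (d + card Z))))"
    by (subst Bochner_Integration.integral_sum)
       (auto intro!: integrable_unit_lebesgue continuous_intros simp: integral_unit_lebesgue_one_minus_power)
  finally show ?thesis by (simp add: mult_ac)
qed

text \<open>A family S is an off-diagonal 0-1 matrix. Its weight factors over the women's index j,
  the fractions over the men's index i. Reading the matrix by the other index makes the whole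
  summand a product over i, and a sum of products over independent choices is a product of
  sums.\<close>

lemma sum_over_better_sets:
  fixes y :: "nat \<Rightarrow> real"
  shows "(\<Sum>S\<in>(\<Pi>\<^sub>E j\<in>{1..n}. Pow ({1..n} - {j})).
     (\<Prod>i\<in>{1..n}. 1 / (1 + real (d + card {j \<in> {1..n}. i \<in> S j}))) *
     (\<Prod>j\<in>{1..n}. \<Prod>i\<in>{1..n} - {j}. if i \<in> S j then y j else 1 - y j))
   = (\<Prod>i\<in>{1..n}. man_integral n d y i)"
proof -
  let ?N = "{1..n}"
  let ?SS = "\<Pi>\<^sub>E j\<in>?N. Pow (?N - {j})"
  let ?\<tau> = "\<lambda>S. \<lambda>i\<in>?N. {j \<in> ?N. i \<in> S j}"
  let ?\<phi> = "\<lambda>i Z. 1 / (1 + real (d + card Z)) * (\<Prod>j\<in>?N - {i}. if j \<in> Z then y j else 1 - y j)"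
  have swap: "(\<Prod>j\<in>?N. \<Prod>i\<in>?N - {j}. if i \<in> S j then y j else 1 - y j)
     = (\<Prod>i\<in>?N. \<Prod>j\<in>?N - {i}. if j \<in> {j \<in> ?N. i \<in> S j} then y j else 1 - y j)" for S
  proof -
    have "(\<Prod>j\<in>?N. \<Prod>i\<in>?N - {j}. if i \<in> S j then y j else 1 - y j)
        = (\<Prod>j\<in>?N. \<Prod>i | i \<in> ?N \<and> i \<noteq> j. if i \<in> S j then y j else 1 - y j)"
      by (intro prod.cong refl) auto
    also have "\<dots> = (\<Prod>i\<in>?N. \<Prod>j | j \<in> ?N \<and> i \<noteq> j. if i \<in> S j then y j else 1 - y j)"
      by (rule prod.swap_restrict) auto
    also have "\<dots> = (\<Prod>i\<in>?N. \<Prod>j\<in>?N - {i}. if j \<in> {j \<in> ?N. i \<in> S j} then y j else 1 - y j)"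
      by (intro prod.cong refl) auto
    finally show ?thesis .
  qed
  have "(\<Sum>S\<in>?SS. (\<Prod>i\<in>?N. 1 / (1 + real (d + card {j \<in> ?N. i \<in> S j}))) *
     (\<Prod>j\<in>?N. \<Prod>i\<in>?N - {j}. if i \<in> S j then y j else 1 - y j))
     = (\<Sum>S\<in>?SS. \<Prod>i\<in>?N. ?\<phi> i (?\<tau> S i))"
  proof (rule sum.cong[OF refl])
    fix S
    have "(\<Prod>i\<in>?N. ?\<phi> i (?\<tau> S i)) = (\<Prod>i\<in>?N. ?\<phi> i {j \<in> ?N. i \<in> S j})"
      by (intro prod.cong refl) simp
    then show "(\<Prod>i\<in>?N. 1 / (1 + real (d + card {j \<in> ?N. i \<in> S j}))) *
     (\<Prod>j\<in>?N. \<Prod>i\<in>?N - {j}. if i \<in> S j then y j else 1 - y j) = (\<Prod>i\<in>?N. ?\<phi> i (?\<tau> S i))"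
      by (subst swap) (simp only: prod.distrib)
  qed
  \<comment> \<open>Transposition of the matrix, \<open>?\<tau>\<close>, is an involution on
    extensional families, so it is its own inverse witness.\<close>
  also have "\<dots> = (\<Sum>T\<in>?SS. \<Prod>i\<in>?N. ?\<phi> i (T i))"
  proof (rule sum.reindex_bij_witness[where i = ?\<tau> and j = ?\<tau>])
    fix S assume S: "S \<in> ?SS"
    then have S': "S j \<subseteq> ?N - {j}" if "j \<in> ?N" for j using that by auto
    show "?\<tau> (?\<tau> S) = S"
    proof
      fix j show "?\<tau> (?\<tau> S) j = S j"
      proof (cases "j \<in> ?N")
        case True
        then have "?\<tau> (?\<tau> S) j = {i \<in> ?N. i \<in> S j}" by auto
        also have "\<dots> = S j" using S'[OF True] by blast
        finally show ?thesis .
      next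
        case False
        then show ?thesis unfolding PiE_arb[OF S False] by (rule restrict_apply[THEN trans, OF if_not_P])
      qed
    qed
    show "?\<tau> S \<in> ?SS"
    proof (rule PiE_I)
      fix i assume "i \<in> ?N"
      moreover have "i \<notin> S i" if "i \<in> ?N" using S'[OF that] by blast
      ultimately show "?\<tau> S i \<in> Pow (?N - {i})" by auto
    qed (rule restrict_apply[THEN trans, OF if_not_P])
    show "?\<tau> (?\<tau> S) = S" by fact
    show "?\<tau> S \<in> ?SS" by fact
  qed simp
  also have "\<dots> = (\<Prod>i\<in>?N. \<Sum>Z\<in>Pow (?N - {i}). ?\<phi> i Z)"
    by (rule prod_sum_PiE[symmetric]) auto
  also have "\<dots> = (\<Prod>i\<in>?N. man_integral n d y i)"
    by (simp add: man_integral_eq_sum)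
  finally show ?thesis .
qed

abbreviation unit_cube :: "nat \<Rightarrow> (nat \<Rightarrow> real) measure" where
  "unit_cube n \<equiv> Pi\<^sub>M {1..n} (\<lambda>_. unit_lebesgue)"

interpretation unit: prob_space unit_lebesgue
  by (rule prob_space_unit_lebesgue)

interpretation cube: product_sigma_finite "\<lambda>_::nat. unit_lebesgue"
  by (rule product_sigma_finite.intro) (rule unit.sigma_finite_measure_axioms)

lemma prob_space_unit_cube: "prob_space (unit_cube n)"
  by (rule prob_space_PiM) (rule prob_space_unit_lebesgue)

lemma integral_prod_unit_cube:
  fixes f :: "nat \<Rightarrow> real \<Rightarrow> real"
  assumes "\<And>j. j \<in> {1..n} \<Longrightarrow> continuous_on {0..1} (f j)"
  shows "(\<integral>y. (\<Prod>j\<in>{1..n}. f j (y j)) \<partial>unit_cube n) = (\<Prod>j\<in>{1..n}. \<integral>t. f j t \<partial>unit_lebesgue)"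
    and "integrable (unit_cube n) (\<lambda>y. \<Prod>j\<in>{1..n}. f j (y j))"
  using assms by (auto intro!: cube.product_integral_prod cube.product_integrable_prod integrable_unit_lebesgue)

text \<open>Injectivity of M makes the partners distinct, so their rankings are independent and the
  law of the family of better sets is the product of the laws in
  \<open>prob_better_set\<close>.\<close>

lemma expectation_better_sets:
  fixes n N d :: nat and M :: "nat \<Rightarrow> nat"
  assumes M: "M \<in> {1..n} \<rightarrow> {1..N}" "inj_on M {1..n}"
  shows "measure_pmf.expectation (Pi_pmf {1..N} id (\<lambda>_. random_ranking n))
     (\<lambda>Q. \<Prod>i\<in>{1..n}. 1 / (1 + real (d + card {j \<in> {1..n} - {i}. Q (M j) i < Q (M j) j})))
   = (\<integral>y. (\<Prod>i\<in>{1..n}. man_integral n d y i) \<partial>unit_cube n)"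
proof -
  let ?N = "{1..n}"
  let ?q = "Pi_pmf {1..N} id (\<lambda>_. random_ranking n)"
  let ?SS = "\<Pi>\<^sub>E j\<in>?N. Pow (?N - {j})"
  let ?F = "\<lambda>S. \<Prod>i\<in>?N. 1 / (1 + real (d + card {j \<in> ?N. i \<in> S j}))"
  let ?w = "\<lambda>S j t. \<Prod>i\<in>?N - {j}. if i \<in> S then t else 1 - t :: real"
  define B :: "(nat \<Rightarrow> nat \<Rightarrow> nat) \<Rightarrow> nat \<Rightarrow> nat set"
    where "B Q = (\<lambda>j\<in>?N. {i \<in> ?N - {j}. Q (M j) i < Q (M j) j})" for Q
  have w_cont: "continuous_on {0..1} (?w S j)" for S j
  proof (rule continuous_on_prod)
    fix i show "continuous_on {0..1} (\<lambda>t::real. if i \<in> S then t else 1 - t)"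
      by (cases "i \<in> S") (auto intro!: continuous_intros)
  qed
  have finSS: "finite ?SS" by (intro finite_PiE) auto
  have pB: "pmf (map_pmf B ?q) S = (\<Prod>j\<in>?N. \<integral>t. ?w (S j) j t \<partial>unit_lebesgue)" if S: "S \<in> ?SS" for S
  proof -
    \<comment> \<open>One condition per woman: for a matched woman only her own man occurs in it,
      and for an unmatched woman \<open>E w\<close> is the whole space.\<close>
    define E :: "nat \<Rightarrow> (nat \<Rightarrow> nat) set"
      where "E w = {r. \<forall>j\<in>?N. M j = w \<longrightarrow> {i \<in> ?N - {j}. r i < r j} = S j}" for w
    have "B Q = S \<longleftrightarrow> (\<forall>j\<in>?N. {i \<in> ?N - {j}. Q (M j) i < Q (M j) j} = S j)" for Q
    proof
      assume "\<forall>j\<in>?N. {i \<in> ?N - {j}. Q (M j) i < Q (M j) j} = S j"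
      then show "B Q = S" using S unfolding B_def
        by (intro ext) (metis (mono_tags, lifting) PiE_arb restrict_apply)
    qed (auto simp: B_def)
    moreover have "Q \<in> Pi {1..N} E \<longleftrightarrow> (\<forall>j\<in>?N. {i \<in> ?N - {j}. Q (M j) i < Q (M j) j} = S j)" for Q
    proof -
      have "Q \<in> Pi {1..N} E \<longleftrightarrow> (\<forall>w\<in>{1..N}. \<forall>j\<in>?N. M j = w \<longrightarrow> {i \<in> ?N - {j}. Q w i < Q w j} = S j)"
        by (simp only: Pi_iff E_def mem_Collect_eq)
      also have "\<dots> \<longleftrightarrow> (\<forall>j\<in>?N. {i \<in> ?N - {j}. Q (M j) i < Q (M j) j} = S j)"
        using funcset_mem[OF M(1)] by blast
      finally show ?thesis .
    qed
    ultimately have "Q \<in> B -` {S} \<longleftrightarrow> Q \<in> Pi {1..N} E" for Q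
      by (simp only: vimage_singleton_eq)
    then have "B -` {S} = Pi {1..N} E" by blast
    then have "pmf (map_pmf B ?q) S = measure_pmf.prob ?q (Pi {1..N} E)"
      by (simp add: pmf_map)
    also have "\<dots> = (\<Prod>w\<in>{1..N}. measure_pmf.prob (random_ranking n) (E w))"
      by (rule measure_Pi_pmf_Pi) simp
    also have "\<dots> = (\<Prod>w\<in>M ` ?N. measure_pmf.prob (random_ranking n) (E w))"
    proof (rule prod.mono_neutral_right)
      show "\<forall>w\<in>{1..N} - M ` ?N. measure_pmf.prob (random_ranking n) (E w) = 1"
      proof
        fix w assume "w \<in> {1..N} - M ` ?N"
        then have "E w = UNIV" by (auto simp: E_def)
        then show "measure_pmf.prob (random_ranking n) (E w) = 1" by simp
      qed
    qed (use M in auto)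
    also have "\<dots> = (\<Prod>j\<in>?N. measure_pmf.prob (random_ranking n) (E (M j)))"
      using M(2) by (simp add: prod.reindex)
    also have "\<dots> = (\<Prod>j\<in>?N. \<integral>t. ?w (S j) j t \<partial>unit_lebesgue)"
    proof (rule prod.cong[OF refl])
      fix j assume j: "j \<in> ?N"
      have "E (M j) = {r. {i \<in> ?N - {j}. r i < r j} = S j}"
      proof (rule set_eqI)
        fix r
        have "M j' = M j \<longleftrightarrow> j' = j" if "j' \<in> ?N" for j'
          using inj_on_eq_iff[OF M(2) that j] .
        then have "r \<in> E (M j) \<longleftrightarrow> (\<forall>j'\<in>?N. j' = j \<longrightarrow> {i \<in> ?N - {j'}. r i < r j'} = S j')"
          unfolding E_def mem_Collect_eq by (intro ball_cong refl) (simp only:)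
        then show "r \<in> E (M j) \<longleftrightarrow> r \<in> {r. {i \<in> ?N - {j}. r i < r j} = S j}"
          using j by blast
      qed
      moreover have "S j \<subseteq> ?N - {j}" using PiE_mem[OF S j] by (rule PowD)
      ultimately show "measure_pmf.prob (random_ranking n) (E (M j)) = (\<integral>t. ?w (S j) j t \<partial>unit_lebesgue)"
        using prob_better_set[OF j] by (simp only:)
    qed
    finally show ?thesis .
  qed
  have "measure_pmf.expectation ?q
     (\<lambda>Q. \<Prod>i\<in>?N. 1 / (1 + real (d + card {j \<in> ?N - {i}. Q (M j) i < Q (M j) j})))
    = measure_pmf.expectation ?q (\<lambda>Q. ?F (B Q))"
  proof (intro Bochner_Integration.integral_cong refl prod.cong)
    fix Q i assume "i \<in> ?N"
    then have "{j \<in> ?N - {i}. Q (M j) i < Q (M j) j} = {j \<in> ?N. i \<in> B Q j}" by (auto simp: B_def)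
    then show "1 / (1 + real (d + card {j \<in> ?N - {i}. Q (M j) i < Q (M j) j}))
       = 1 / (1 + real (d + card {j \<in> ?N. i \<in> B Q j}))" by simp
  qed
  also have "\<dots> = measure_pmf.expectation (map_pmf B ?q) ?F" by simp
  also have "\<dots> = (\<Sum>S\<in>?SS. ?F S * pmf (map_pmf B ?q) S)"
    by (rule integral_measure_pmf_real[OF finSS]) (auto simp: B_def)
  also have "\<dots> = (\<Sum>S\<in>?SS. \<integral>y. ?F S * (\<Prod>j\<in>?N. ?w (S j) j (y j)) \<partial>unit_cube n)"
  proof (rule sum.cong[OF refl])
    fix S assume S: "S \<in> ?SS"
    have "(\<integral>y. ?F S * (\<Prod>j\<in>?N. ?w (S j) j (y j)) \<partial>unit_cube n)
       = ?F S * (\<integral>y. (\<Prod>j\<in>?N. ?w (S j) j (y j)) \<partial>unit_cube n)" by simp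
    also have "(\<integral>y. (\<Prod>j\<in>?N. ?w (S j) j (y j)) \<partial>unit_cube n) = (\<Prod>j\<in>?N. \<integral>t. ?w (S j) j t \<partial>unit_lebesgue)"
      by (rule integral_prod_unit_cube) (rule w_cont)
    finally show "?F S * pmf (map_pmf B ?q) S = (\<integral>y. ?F S * (\<Prod>j\<in>?N. ?w (S j) j (y j)) \<partial>unit_cube n)"
      by (simp only: pB[OF S])
  qed
  also have "\<dots> = (\<integral>y. (\<Sum>S\<in>?SS. ?F S * (\<Prod>j\<in>?N. ?w (S j) j (y j))) \<partial>unit_cube n)"
  proof (rule Bochner_Integration.integral_sum[symmetric])
    fix S show "integrable (unit_cube n) (\<lambda>y. ?F S * (\<Prod>j\<in>?N. ?w (S j) j (y j)))"
    proof (rule integrable_mult_right)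
      show "integrable (unit_cube n) (\<lambda>y. \<Prod>j\<in>?N. ?w (S j) j (y j))"
        by (rule integral_prod_unit_cube(2)[of n "\<lambda>j. ?w (S j) j"]) (rule w_cont)
    qed
  qed
  also have "\<dots> = (\<integral>y. (\<Prod>i\<in>?N. man_integral n d y i) \<partial>unit_cube n)"
    by (intro Bochner_Integration.integral_cong refl sum_over_better_sets)
  finally show ?thesis .
qed

section \<open>Stability of a fixed matching\<close>

lemma stable_iff:
  assumes M: "M \<in> matchings n N"
  shows "M \<in> stable_matchings n N P Q \<longleftrightarrow>
    (\<forall>i\<in>{1..n}. \<forall>w\<in>{w \<in> {1..N} - {M i}. \<forall>j\<in>{1..n}. M j = w \<longrightarrow> Q w i < Q w j}. \<not> P i w < P i (M i))"
proof -
  have "M \<in> stable_matchings n N P Q \<longleftrightarrow> (\<forall>i w. \<not> blocking_pair n N P Q M i w)"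
    using M by (simp add: stable_matchings_def)
  also have "\<dots> \<longleftrightarrow> (\<forall>i\<in>{1..n}. \<forall>w. w \<in> {1..N} - {M i} \<and> (\<forall>j\<in>{1..n}. M j = w \<longrightarrow> Q w i < Q w j)
      \<longrightarrow> \<not> P i w < P i (M i))"
    (is "?L \<longleftrightarrow> ?R")
  proof
    assume L: ?L
    show ?R
    proof (intro ballI allI impI notI, elim conjE)
      fix i w assume "i \<in> {1..n}" "w \<in> {1..N} - {M i}" "\<forall>j\<in>{1..n}. M j = w \<longrightarrow> Q w i < Q w j"
        "P i w < P i (M i)"
      then have "blocking_pair n N P Q M i w" unfolding blocking_pair_def prefers_def by simp
      then show False using L by blast
    qed
  next
    assume R: ?R
    show ?L
    proof (intro allI notI)
      fix i w assume "blocking_pair n N P Q M i w"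
      then have "i \<in> {1..n}" "w \<in> {1..N} - {M i}" "\<forall>j\<in>{1..n}. M j = w \<longrightarrow> Q w i < Q w j"
        "P i w < P i (M i)" unfolding blocking_pair_def prefers_def by simp_all
      then show False using R by blast
    qed
  qed
  finally show ?thesis by (simp only: Ball_def mem_Collect_eq)
qed

text \<open>A woman who would accept i is either one of the N - n unmatched women, who accept
  anyone, or the partner of another man j whom she ranks below i. Injectivity of M turns the count
  of such partners into a count of men.\<close>

lemma card_dangerous_women:
  assumes M: "M \<in> matchings n N" and i: "i \<in> {1..n}"
  shows "card {w \<in> {1..N} - {M i}. \<forall>j\<in>{1..n}. M j = w \<longrightarrow> Q w i < Q w j}
      = (N - n) + card {j \<in> {1..n} - {i}. Q (M j) i < Q (M j) j}"
proof -
  have inj: "inj_on M {1..n}" and sub: "M ` {1..n} \<subseteq> {1..N}"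
    using M by (auto simp: matchings_def)
  let ?J = "{j \<in> {1..n} - {i}. Q (M j) i < Q (M j) j}"
  have "{w \<in> {1..N} - {M i}. \<forall>j\<in>{1..n}. M j = w \<longrightarrow> Q w i < Q w j}
     = ({1..N} - M ` {1..n}) \<union> M ` ?J" (is "?L = ?R")
  proof
    show "?L \<subseteq> ?R"
    proof
      fix w assume w: "w \<in> ?L"
      show "w \<in> ?R"
      proof (cases "w \<in> M ` {1..n}")
        case True
        then obtain j where "j \<in> {1..n}" "w = M j" by auto
        then show ?thesis using w by auto
      qed (use w in auto)
    qed
    show "?R \<subseteq> ?L"
    proof
      fix w assume "w \<in> ?R"
      then show "w \<in> ?L"
      proof
        assume "w \<in> {1..N} - M ` {1..n}"
        then show ?thesis using i by blast
      next
        assume "w \<in> M ` ?J"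
        then obtain j where j: "w = M j" "j \<in> {1..n}" "j \<noteq> i" "Q (M j) i < Q (M j) j" by blast
        have "\<forall>j'\<in>{1..n}. M j' = w \<longrightarrow> Q w i < Q w j'"
          using inj_onD[OF inj, of _ j] j by metis
        moreover have "w \<noteq> M i" using inj_onD[OF inj, of i j] i j by auto
        moreover have "w \<in> {1..N}" using sub j by blast
        ultimately show ?thesis by simp
      qed
    qed
  qed
  then have "card ?L = card ({1..N} - M ` {1..n}) + card (M ` ?J)"
    by (simp only:) (rule card_Un_disjoint, auto)
  also have "card ({1..N} - M ` {1..n}) = N - n"
    using inj sub by (subst card_Diff_subset) (auto simp: card_image)
  also have "card (M ` ?J) = card ?J"
    by (rule card_image, rule inj_on_subset[OF inj]) auto
  finally show ?thesis .
qed

text \<open>With the women's lists fixed, stability asks each man i to rank \<open>M i\<close> above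
  all women who would accept him. These conditions concern separate lists, so the conditional
  probability is a product of terms 1/(1 + card), whose mean is
  \<open>expectation_better_sets\<close>.\<close>

lemma prob_stable:
  assumes M: "M \<in> matchings n N"
  shows "measure_pmf.prob (random_preferences n N) {(P, Q). M \<in> stable_matchings n N P Q}
    = (\<integral>y. (\<Prod>i\<in>{1..n}. man_integral n (N - n) y i) \<partial>unit_cube n)"
proof -
  let ?p = "Pi_pmf {1..n} id (\<lambda>_. random_ranking N)" and ?q = "Pi_pmf {1..N} id (\<lambda>_. random_ranking n)"
  let ?Z = "\<lambda>Q i. {w \<in> {1..N} - {M i}. \<forall>j\<in>{1..n}. M j = w \<longrightarrow> Q w i < Q w j}"
  let ?F = "\<lambda>Q. \<Prod>i\<in>{1..n}. 1 / (1 + real ((N - n) + card {j \<in> {1..n} - {i}. Q (M j) i < Q (M j) j}))"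
  let ?X = "{(P, Q). M \<in> stable_matchings n N P Q}"
  have M': "M \<in> {1..n} \<rightarrow> {1..N}" "inj_on M {1..n}" using M by (auto simp: matchings_def)
  have inner: "measure_pmf.prob ?p {P. (P, Q) \<in> ?X} = ?F Q" for Q
  proof -
    have "{P. (P, Q) \<in> ?X} = Pi {1..n} (\<lambda>i. {r. \<forall>w\<in>?Z Q i. \<not> r w < r (M i)})"
      using stable_iff[OF M] by (auto simp: Pi_iff)
    then have "measure_pmf.prob ?p {P. (P, Q) \<in> ?X}
      = (\<Prod>i\<in>{1..n}. measure_pmf.prob (random_ranking N) {r. \<forall>w\<in>?Z Q i. \<not> r w < r (M i)})"
      by (simp add: measure_Pi_pmf_Pi)
    also have "\<dots> = ?F Q"
    proof (rule prod.cong[OF refl])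
      fix i assume i: "i \<in> {1..n}"
      have Mi: "M i \<in> {1..N}" using M' i by auto
      have "measure_pmf.prob (random_ranking N) {r. \<forall>w\<in>?Z Q i. \<not> r w < r (M i)}
         = measure_pmf.prob (random_ranking N) {r. \<forall>w\<in>?Z Q i. r (M i) < r w}"
      proof (rule measure_pmf.finite_measure_eq_AE)
        show "AE r in random_ranking N. r \<in> {r. \<forall>w\<in>?Z Q i. \<not> r w < r (M i)}
           \<longleftrightarrow> r \<in> {r. \<forall>w\<in>?Z Q i. r (M i) < r w}"
          using AE_random_ranking[of N]
        proof eventually_elim
          case (elim p)
          then have "p x = p y \<longleftrightarrow> x = y" for x y by (metis permutes_inj injD)
          then have "\<not> p w < p (M i) \<longleftrightarrow> p (M i) < p w" if "w \<noteq> M i" for w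
            using that by (metis less_linear less_asym)
          then show ?case by auto
        qed
      qed auto
      also have "\<dots> = 1 / (1 + real (card (?Z Q i)))"
        unfolding random_ranking_def by (rule prob_first_permutation) (use Mi in auto)
      also have "\<dots> = 1 / (1 + real ((N - n) + card {j \<in> {1..n} - {i}. Q (M j) i < Q (M j) j}))"
        by (simp only: card_dangerous_women[OF M i])
      finally show "measure_pmf.prob (random_ranking N) {r. \<forall>w\<in>?Z Q i. \<not> r w < r (M i)} = \<dots>" .
    qed
    finally show ?thesis .
  qed
  have F: "0 \<le> ?F Q" "?F Q \<le> 1" for Q
    by (auto intro!: prod_nonneg prod_le_1)
  have nonneg: "0 \<le> measure_pmf.expectation ?q ?F"
    by (rule Bochner_Integration.integral_nonneg) (rule F(1))
  have "ennreal (measure_pmf.prob (random_preferences n N) ?X) = (\<integral>\<^sup>+z. indicator ?X z \<partial>random_preferences n N)"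
    by (simp add: measure_pmf.emeasure_eq_measure)
  \<comment> \<open>The two components are swapped so that the women's lists form the outer
    integral.\<close>
  also have "\<dots> = (\<integral>\<^sup>+Q. \<integral>\<^sup>+P. indicator ?X (P, Q) \<partial>?p \<partial>?q)"
    unfolding random_preferences_def
    by (subst pair_commute_pmf) (simp add: nn_integral_pair_pmf' case_prod_unfold)
  also have "\<dots> = (\<integral>\<^sup>+Q. ennreal (?F Q) \<partial>?q)"
  proof (rule nn_integral_cong)
    fix Q
    have "(\<integral>\<^sup>+P. indicator ?X (P, Q) \<partial>?p) = (\<integral>\<^sup>+P. indicator {P. (P, Q) \<in> ?X} P \<partial>?p)"
      by (intro nn_integral_cong) (auto simp: indicator_def)
    also have "\<dots> = ennreal (?F Q)"
      using inner[of Q] by (simp add: measure_pmf.emeasure_eq_measure)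
    finally show "(\<integral>\<^sup>+P. indicator ?X (P, Q) \<partial>?p) = ennreal (?F Q)" .
  qed
  also have "\<dots> = ennreal (measure_pmf.expectation ?q ?F)"
  proof (rule nn_integral_eq_integral)
    show "integrable ?q ?F"
    proof (rule measure_pmf.integrable_const_bound[where B = 1])
      show "AE Q in ?q. norm (?F Q) \<le> 1"
        by (rule AE_I2) (simp only: real_norm_def abs_of_nonneg[OF F(1)] F(2))
    qed simp
  qed (use F in auto)
  finally have "ennreal (measure_pmf.prob (random_preferences n N) ?X) = ennreal (measure_pmf.expectation ?q ?F)" .
  then have "measure_pmf.prob (random_preferences n N) ?X = measure_pmf.expectation ?q ?F"
    by (simp only: ennreal_inj[OF measure_nonneg nonneg])
  also have "\<dots> = (\<integral>y. (\<Prod>i\<in>{1..n}. man_integral n (N - n) y i) \<partial>unit_cube n)"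
    by (rule expectation_better_sets[OF M'])
  finally show ?thesis .
qed

lemma card_matchings:
  assumes "n \<le> N"
  shows "card (matchings n N) * fact (N - n) = fact N"
proof -
  have "card (matchings n N) = (\<Prod>k\<in>{0..<n}. N - k)"
    unfolding matchings_def using card_inj_on_subset_funcset[of "{1..n}" "{1..N}" "{1..n}"] by simp
  also have "(\<Prod>k\<in>{0..<n}. N - k) * fact (N - n) = fact N"
    using assms
  proof (induction n)
    case (Suc n)
    have "fact (N - n) = (N - n) * fact (N - Suc n)"
      using Suc.prems by (metis Suc_diff_Suc Suc_le_lessD fact_Suc of_nat_id)
    with Suc show ?case by (simp add: mult_ac)
  qed simp
  finally show ?thesis .
qed

text \<open>By linearity: the probability of being stable is the same for every matching, so only
  the number of injections enters in front.\<close>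

theorem expected_stable_integral:
  assumes "n \<le> N"
  shows "expected_stable n N = fact N / fact (N - n) *
     (\<integral>y. (\<Prod>i\<in>{1..n}. man_integral n (N - n) y i) \<partial>unit_cube n)"
proof -
  let ?I = "\<integral>y. (\<Prod>i\<in>{1..n}. man_integral n (N - n) y i) \<partial>unit_cube n"
  let ?X = "\<lambda>M. {(P, Q). M \<in> stable_matchings n N P Q}"
  have fin: "finite (matchings n N)"
    unfolding matchings_def by (rule finite_subset[of _ "{1..n} \<rightarrow>\<^sub>E {1..N}"]) (auto intro!: finite_PiE)
  have "expected_stable n N
      = measure_pmf.expectation (random_preferences n N) (\<lambda>z. \<Sum>M\<in>matchings n N. indicator (?X M) z)"
    unfolding expected_stable_def
  proof (rule Bochner_Integration.integral_cong[OF refl])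
    fix z :: "(nat \<Rightarrow> ranking) \<times> (nat \<Rightarrow> ranking)"
    obtain P Q where z: "z = (P, Q)" by (cases z)
    have "(\<Sum>M\<in>matchings n N. indicator (?X M) z) = (\<Sum>M\<in>matchings n N. if M \<in> stable_matchings n N P Q then 1 else 0 :: real)"
      by (intro sum.cong) (auto simp: z)
    also have "\<dots> = real (card (matchings n N \<inter> {M. M \<in> stable_matchings n N P Q}))"
      using fin by (simp add: sum.If_cases)
    also have "matchings n N \<inter> {M. M \<in> stable_matchings n N P Q} = stable_matchings n N P Q"
      by (auto simp: stable_matchings_def)
    finally show "(case z of (P, Q) \<Rightarrow> real (card (stable_matchings n N P Q))) = (\<Sum>M\<in>matchings n N. indicator (?X M) z)"
      by (simp add: z)
  qed
  also have "\<dots> = (\<Sum>M\<in>matchings n N. measure_pmf.prob (random_preferences n N) (?X M))"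
    by (subst Bochner_Integration.integral_sum)
       (auto intro!: measure_pmf.integrable_const_bound[where B = 1] simp: indicator_def)
  also have "\<dots> = real (card (matchings n N)) * ?I"
    using prob_stable by simp
  also have "real (card (matchings n N)) = fact N / fact (N - n)"
    using arg_cong[OF card_matchings[OF assms], of real] by (simp add: field_simps)
  finally show ?thesis .
qed

section \<open>Laplace approximation of the inner integrals\<close>

lemma halfline_moment:
  fixes a :: real
  assumes a: "a > 0"
  shows "has_bochner_integral lborel (\<lambda>x. indicator {0..} x * (x ^ k * exp (- (a * x)))) (fact k / a ^ (k + 1))"
proof -
  have "has_bochner_integral lborel (\<lambda>x. erlang_density 0 a x * x ^ k) (fact k / a ^ k)"
  proof (rule has_bochner_integral_nn_integral)
    show "(\<integral>\<^sup>+ x. ennreal (erlang_density 0 a x * x ^ k) \<partial>lborel) = ennreal (fact k / a ^ k)"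
      using nn_integral_erlang_ith_moment[OF a, of 0 k] by simp
    show "AE x in lborel. 0 \<le> erlang_density 0 a x * x ^ k"
      by (rule AE_I2) (auto simp: erlang_density_def a less_imp_le)
  qed (use a in simp_all)
  then have "has_bochner_integral lborel (\<lambda>x. 1 / a * (erlang_density 0 a x * x ^ k)) (1 / a * (fact k / a ^ k))"
    by (rule has_bochner_integral_mult_right)
  moreover have "1 / a * (erlang_density 0 a x * x ^ k) = indicator {0..} x * (x ^ k * exp (- (a * x)))" for x
    using a by (auto simp: erlang_density_def indicator_def)
  ultimately show ?thesis by (simp add: mult_ac)
qed

text \<open>Passing to the half-line costs nothing in an upper bound and replaces incomplete Gamma
  integrals by exact factorial moments.\<close>

lemma unit_integral_le_halfline:
  fixes f g :: "real \<Rightarrow> real"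
  assumes f: "continuous_on {0..1} f"
    and fg: "\<And>x. 0 \<le> x \<Longrightarrow> x \<le> 1 \<Longrightarrow> f x \<le> g x" and g: "\<And>x. 0 \<le> x \<Longrightarrow> 0 \<le> g x"
    and v: "has_bochner_integral lborel (\<lambda>x. indicator {0..} x * g x) v"
  shows "(\<integral>x. f x \<partial>unit_lebesgue) \<le> v"
proof -
  have "(\<integral>x. f x \<partial>unit_lebesgue) = (\<integral>x. indicator {0..1} x *\<^sub>R f x \<partial>lborel)"
    unfolding unit_lebesgue_def by (subst integral_restrict_space) auto
  also have "\<dots> \<le> (\<integral>x. indicator {0..} x * g x \<partial>lborel)"
  proof (rule Bochner_Integration.integral_mono)
    show "integrable lborel (\<lambda>x. indicator {0..1} x *\<^sub>R f x)"
      by (rule borel_integrable_compact[OF _ f]) simp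
    show "integrable lborel (\<lambda>x. indicator {0..} x * g x)"
      using v by (auto simp: has_bochner_integral_iff)
    show "indicator {0..1} x *\<^sub>R f x \<le> indicator {0..} x * g x" for x
      using fg[of x] g[of x] by (auto simp: indicator_def)
  qed
  also have "\<dots> = v" using v by (rule has_bochner_integral_integral_eq)
  finally show ?thesis .
qed

text \<open>All terms of the series of ln (1 - w) are negative, so stopping at the square bounds it
  from above. The point w = 1, outside the domain of the logarithm, is treated apart.\<close>

lemma one_minus_le_exp_quadratic:
  fixes w :: real
  assumes "0 \<le> w" "w \<le> 1"
  shows "1 - w \<le> exp (- w - w\<^sup>2 / 2)"
proof (cases "w = 1")
  case False
  define g where "g x = - x - x\<^sup>2 / 2 - ln (1 - x)" for x :: real
  have "g 0 \<le> g w"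
  proof (rule DERIV_nonneg_imp_nondecreasing[OF assms(1)])
    fix x assume x: "0 \<le> x" "x \<le> w"
    then have "x < 1" using assms False by simp
    then have "(g has_real_derivative x\<^sup>2 / (1 - x)) (at x)"
      unfolding g_def by (auto intro!: derivative_eq_intros simp: field_simps power2_eq_square)
    then show "\<exists>y. (g has_real_derivative y) (at x) \<and> 0 \<le> y"
      using \<open>x < 1\<close> by (intro exI conjI) auto
  qed
  then have "ln (1 - w) \<le> - w - w\<^sup>2 / 2" by (simp add: g_def)
  then have "exp (ln (1 - w)) \<le> exp (- w - w\<^sup>2 / 2)" by simp
  then show ?thesis using assms False by simp
qed simp

lemma exp_minus_le_quadratic:
  fixes z :: real
  assumes "0 \<le> z"
  shows "exp (- z) \<le> 1 - z + z\<^sup>2 / 2"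
proof -
  define g where "g x = 1 - x + x\<^sup>2 / 2 - exp (- x)" for x :: real
  have "g 0 \<le> g z"
  proof (rule DERIV_nonneg_imp_nondecreasing[OF assms(1)])
    fix x :: real
    have "(g has_real_derivative - 1 + x + exp (- x)) (at x)"
      unfolding g_def by (auto intro!: derivative_eq_intros)
    then show "\<exists>y. (g has_real_derivative y) (at x) \<and> 0 \<le> y"
      using exp_ge_add_one_self[of "- x"] by (intro exI conjI) auto
  qed
  then show ?thesis by (simp add: g_def)
qed

text \<open>The cubic is (1 - w)(1 + w + w^2/2), and the second factor is at most e^w. Unlike a
  bound through logarithms, this reaches w = 1, as the integration over x requires.\<close>

lemma one_minus_ge_exp_cubic:
  fixes w :: real
  assumes "0 \<le> w" "w \<le> 1"
  shows "exp (- w) * (1 - w\<^sup>2 / 2 - w ^ 3 / 2) \<le> 1 - w"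
proof -
  have "1 - w\<^sup>2 / 2 - w ^ 3 / 2 = (1 - w) * (1 + w + w\<^sup>2 / 2)"
    by (simp add: field_simps power2_eq_square power3_eq_cube)
  also have "\<dots> \<le> (1 - w) * exp w"
    using assms exp_lower_Taylor_quadratic[of w] by (intro mult_left_mono) auto
  finally have "exp (- w) * (1 - w\<^sup>2 / 2 - w ^ 3 / 2) \<le> exp (- w) * ((1 - w) * exp w)"
    by (intro mult_left_mono) auto
  also have "exp (- w) * ((1 - w) * exp w) = 1 - w"
    using exp_minus_inverse[of w] by (simp add: algebra_simps)
  finally show ?thesis .
qed

text \<open>An unmatched woman acts like a partner with y = 1: (1-x)^d consists of d more factors of
  the same kind, so d is added both to the sum of the y and to the sum of their squares.\<close>

lemma product_le_gaussian:
  fixes x :: real and y :: "'a \<Rightarrow> real"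
  assumes "finite J" "\<And>j. j \<in> J \<Longrightarrow> 0 \<le> y j \<and> y j \<le> 1" "0 \<le> x" "x \<le> 1"
  shows "(1 - x) ^ d * (\<Prod>j\<in>J. 1 - x * y j)
    \<le> exp (- ((d + (\<Sum>j\<in>J. y j)) * x) - (d + (\<Sum>j\<in>J. (y j)\<^sup>2)) * x\<^sup>2 / 2)"
proof -
  have xy: "0 \<le> x * y j" "x * y j \<le> 1" if "j \<in> J" for j
    using assms that by (auto intro!: mult_le_one mult_nonneg_nonneg)
  have "(1 - x) ^ d * (\<Prod>j\<in>J. 1 - x * y j)
     \<le> exp (- x - x\<^sup>2 / 2) ^ d * (\<Prod>j\<in>J. exp (- (x * y j) - (x * y j)\<^sup>2 / 2))"
    using assms xy
    by (intro mult_mono power_mono prod_mono conjI prod_nonneg one_minus_le_exp_quadratic) auto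
  also have "\<dots> = exp (d * (- x - x\<^sup>2 / 2) + (\<Sum>j\<in>J. - (x * y j) - (x * y j)\<^sup>2 / 2))"
    using assms(1) by (simp add: exp_add exp_sum exp_of_nat_mult)
  also have "d * (- x - x\<^sup>2 / 2) + (\<Sum>j\<in>J. - (x * y j) - (x * y j)\<^sup>2 / 2)
     = - ((d + (\<Sum>j\<in>J. y j)) * x) - (d + (\<Sum>j\<in>J. (y j)\<^sup>2)) * x\<^sup>2 / 2"
    by (simp add: sum_subtractf sum_negf sum_distrib_left[symmetric] sum_divide_distrib[symmetric]
        power_mult_distrib algebra_simps diff_divide_distrib add_divide_distrib)
  finally show ?thesis .
qed

lemma product_ge_cubic:
  fixes x :: real and y :: "'a \<Rightarrow> real"
  assumes fin: "finite J" and y: "\<And>j. j \<in> J \<Longrightarrow> 0 \<le> y j \<and> y j \<le> 1" and x: "0 \<le> x" "x \<le> 1"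
  shows "exp (- ((d + (\<Sum>j\<in>J. y j)) * x)) * (1 - (d + (\<Sum>j\<in>J. (y j)\<^sup>2)) * ((x\<^sup>2 + x ^ 3) / 2))
    \<le> (1 - x) ^ d * (\<Prod>j\<in>J. 1 - x * y j)"
proof -
  \<comment> \<open>As y^3 \<le> y^2 on the unit interval, this one quantity times y^2 bounds the
    defect of each factor; y = 1 covers the d unmatched women.\<close>
  define c where "c = (x\<^sup>2 + x ^ 3) / 2"
  have c: "0 \<le> c" "c \<le> 1"
    using x power_le_one[of x 2] power_le_one[of x 3] by (auto simp: c_def)
  have xy: "0 \<le> x * y j" "x * y j \<le> 1" "0 \<le> (y j)\<^sup>2 * c" "(y j)\<^sup>2 * c \<le> 1" if "j \<in> J" for j
    using y[OF that] x c by (auto intro!: mult_le_one mult_nonneg_nonneg power_le_one)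
  have fac: "exp (- (x * y j)) * (1 - (y j)\<^sup>2 * c) \<le> 1 - x * y j" if "j \<in> J" for j
  proof -
    have "(y j) ^ 3 \<le> (y j) ^ 2" using y[OF that] by (intro power_decreasing) auto
    then have "x ^ 3 * (y j) ^ 3 \<le> x ^ 3 * (y j)\<^sup>2" using x by (intro mult_left_mono) auto
    then have "1 - (y j)\<^sup>2 * c \<le> 1 - (x * y j)\<^sup>2 / 2 - (x * y j) ^ 3 / 2"
      by (simp add: c_def power_mult_distrib algebra_simps)
    then have "exp (- (x * y j)) * (1 - (y j)\<^sup>2 * c) \<le> exp (- (x * y j)) * (1 - (x * y j)\<^sup>2 / 2 - (x * y j) ^ 3 / 2)"
      by (intro mult_left_mono) auto
    also have "\<dots> \<le> 1 - x * y j" by (rule one_minus_ge_exp_cubic) (use xy that in auto)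
    finally show ?thesis .
  qed
  have exp_split: "exp (- ((d + (\<Sum>j\<in>J. y j)) * x)) = exp (- x) ^ d * (\<Prod>j\<in>J. exp (- (x * y j)))"
    using fin by (simp add: exp_of_nat_mult[symmetric] exp_sum[symmetric] exp_add[symmetric]
        sum_negf sum_distrib_left algebra_simps)
  have fac1: "exp (- x) * (1 - c) \<le> 1 - x"
    using one_minus_ge_exp_cubic[OF x] by (simp add: c_def add_divide_distrib algebra_simps)
  have "1 - d * c \<le> (1 - c) ^ d"
    using Bernoulli_inequality[of "- c" d] c by (simp add: mult_ac)
  moreover have "1 - (\<Sum>j\<in>J. (y j)\<^sup>2 * c) \<le> (\<Prod>j\<in>J. 1 - (y j)\<^sup>2 * c)"
    by (rule Weierstrass_prod_ineq) (use xy in auto)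
  \<comment> \<open>Products P and Q that are at most 1 satisfy P + Q - 1 \<le> P Q; this joins the
    Bernoulli and the Weierstrass bound.\<close>
  moreover have "0 \<le> (1 - (1 - c) ^ d) * (1 - (\<Prod>j\<in>J. 1 - (y j)\<^sup>2 * c))"
    using c xy by (intro mult_nonneg_nonneg) (auto intro!: power_le_one prod_le_1)
  ultimately have "1 - d * c - (\<Sum>j\<in>J. (y j)\<^sup>2 * c) \<le> (1 - c) ^ d * (\<Prod>j\<in>J. 1 - (y j)\<^sup>2 * c)"
    by (simp add: algebra_simps)
  then have "exp (- ((d + (\<Sum>j\<in>J. y j)) * x)) * (1 - (d + (\<Sum>j\<in>J. (y j)\<^sup>2)) * c)
     \<le> exp (- ((d + (\<Sum>j\<in>J. y j)) * x)) * ((1 - c) ^ d * (\<Prod>j\<in>J. 1 - (y j)\<^sup>2 * c))"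
    by (intro mult_left_mono) (auto simp: algebra_simps sum_distrib_left sum_distrib_right)
  also have "\<dots>
     = (exp (- x) * (1 - c)) ^ d * (\<Prod>j\<in>J. exp (- (x * y j)) * (1 - (y j)\<^sup>2 * c))"
    by (subst exp_split) (simp only: power_mult_distrib prod.distrib mult_ac)
  also have "\<dots> \<le> (1 - x) ^ d * (\<Prod>j\<in>J. 1 - x * y j)"
    using c xy x by (intro mult_mono power_mono prod_mono conjI prod_nonneg fac fac1) auto
  finally show ?thesis unfolding c_def .
qed

lemma man_integral_nonneg:
  assumes y: "\<And>j. j \<in> {1..n} \<Longrightarrow> 0 \<le> y j \<and> y j \<le> 1"
  shows "0 \<le> man_integral n d y i"
  unfolding man_integral_def
proof (rule Bochner_Integration.integral_nonneg_AE, rule AE_I2)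
  fix x assume "x \<in> space unit_lebesgue"
  then have x: "0 \<le> x" "x \<le> 1" by auto
  have "0 \<le> 1 - x * y j" if "j \<in> {1..n}" for j
    using mult_le_one[of x "y j"] y[OF that] x by auto
  with x show "0 \<le> (1 - x) ^ d * (\<Prod>j\<in>{1..n} - {i}. 1 - x * y j)"
    by (intro mult_nonneg_nonneg prod_nonneg) auto
qed

section \<open>Two-sided bounds on one inner integral\<close>

context
  fixes n d :: nat and y :: "nat \<Rightarrow> real" and i :: nat and a b :: real
  assumes y: "\<And>j. j \<in> {1..n} \<Longrightarrow> 0 \<le> y j \<and> y j \<le> 1"
    and a_def: "a = d + (\<Sum>j\<in>{1..n} - {i}. y j)"
    and b_def: "b = d + (\<Sum>j\<in>{1..n} - {i}. (y j)\<^sup>2)"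
    and a: "a > 0"
begin

text \<open>The integrand is at most exp (- a x - b x^2/2). Expanding the Gaussian factor to second
  order and integrating against a e^(-a x), whose moments of order 2 and 4 are 2/a^2 and 24/a^4,
  gives b/a^2 and 3 b^2/a^4.\<close>

lemma man_integral_upper: "a * man_integral n d y i \<le> 1 - b / a\<^sup>2 + 3 * b\<^sup>2 / a ^ 4"
  and man_integral_upper_simple: "man_integral n d y i \<le> 1 / a"
proof -
  let ?f = "\<lambda>x. (1 - x) ^ d * (\<Prod>j\<in>{1..n} - {i}. 1 - x * y j)"
  let ?m = "\<lambda>k x. x ^ k * exp (- (a * x))"
  let ?g = "\<lambda>x. ?m 0 x - b / 2 * ?m 2 x + b\<^sup>2 / 8 * ?m 4 x"
  have b: "0 \<le> b" unfolding b_def by (simp add: sum_nonneg)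
  have cont: "continuous_on {0..1} ?f" by (intro continuous_intros)
  have le: "?f x \<le> exp (- (a * x) - b * x\<^sup>2 / 2)" if "0 \<le> x" "x \<le> 1" for x
    unfolding a_def b_def by (rule product_le_gaussian) (use y that in auto)
  have gg: "exp (- (a * x) - b * x\<^sup>2 / 2) \<le> ?g x" for x
  proof -
    have "exp (- (b * x\<^sup>2 / 2)) \<le> 1 - b * x\<^sup>2 / 2 + (b * x\<^sup>2 / 2)\<^sup>2 / 2"
      by (rule exp_minus_le_quadratic) (use b in auto)
    then have "exp (- (a * x)) * exp (- (b * x\<^sup>2 / 2)) \<le> exp (- (a * x)) * (1 - b * x\<^sup>2 / 2 + (b * x\<^sup>2 / 2)\<^sup>2 / 2)"
      by (intro mult_left_mono) auto
    moreover have "exp (- (a * x)) * (1 - b * x\<^sup>2 / 2 + (b * x\<^sup>2 / 2)\<^sup>2 / 2) = ?g x"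
      by (simp add: algebra_simps power2_eq_square power4_eq_xxxx)
    ultimately show ?thesis by (simp add: exp_add[symmetric])
  qed
  have "has_bochner_integral lborel
     (\<lambda>x. indicator {0..} x * ?m 0 x - b / 2 * (indicator {0..} x * ?m 2 x) + b\<^sup>2 / 8 * (indicator {0..} x * ?m 4 x))
     (fact 0 / a ^ (0 + 1) - b / 2 * (fact 2 / a ^ (2 + 1)) + b\<^sup>2 / 8 * (fact 4 / a ^ (4 + 1)))"
    by (intro has_bochner_integral_add has_bochner_integral_diff has_bochner_integral_mult_right halfline_moment a)
  moreover have "(\<lambda>x. indicator {0..} x * ?m 0 x - b / 2 * (indicator {0..} x * ?m 2 x) + b\<^sup>2 / 8 * (indicator {0..} x * ?m 4 x))
     = (\<lambda>x. indicator {0..} x * ?g x)"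
    by (rule ext) (simp add: algebra_simps)
  ultimately have hb: "has_bochner_integral lborel (\<lambda>x. indicator {0..} x * ?g x)
     (fact 0 / a ^ (0 + 1) - b / 2 * (fact 2 / a ^ (2 + 1)) + b\<^sup>2 / 8 * (fact 4 / a ^ (4 + 1)))"
    by simp
  have "man_integral n d y i \<le> fact 0 / a ^ (0 + 1) - b / 2 * (fact 2 / a ^ (2 + 1)) + b\<^sup>2 / 8 * (fact 4 / a ^ (4 + 1))"
    unfolding man_integral_def
  proof (rule unit_integral_le_halfline[OF cont _ _ hb])
    show "?f x \<le> ?g x" if "0 \<le> x" "x \<le> 1" for x using le[OF that] gg[of x] by linarith
    show "0 \<le> ?g x" for x using gg[of x] exp_ge_zero order_trans by blast
  qed
  also have "\<dots> = (1 - b / a\<^sup>2 + 3 * b\<^sup>2 / a ^ 4) / a"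
    using a by (simp add: field_simps fact_numeral power2_eq_square power3_eq_cube eval_nat_numeral)
  finally show "a * man_integral n d y i \<le> 1 - b / a\<^sup>2 + 3 * b\<^sup>2 / a ^ 4"
    using a by (simp add: field_simps)
  have "man_integral n d y i \<le> fact 0 / a ^ (0 + 1)"
    unfolding man_integral_def
  proof (rule unit_integral_le_halfline[OF cont _ _ halfline_moment[OF a]])
    show "?f x \<le> ?m 0 x" if "0 \<le> x" "x \<le> 1" for x
      using le[OF that] b by (intro order_trans[OF le[OF that]]) auto
  qed auto
  then show "man_integral n d y i \<le> 1 / a" by simp
qed

text \<open>Against a e^(-a x), the correction b (x^2 + x^3)/2 integrates to b/a^2 + 3 b/a^3. The
  main term loses e^(-a) because x stops at 1, and 27/a^3 pays for this through e^a \<ge>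
  (a/3)^3.\<close>

lemma man_integral_lower: "1 - b / a\<^sup>2 - (3 * b + 27) / a ^ 3 \<le> a * man_integral n d y i"
proof -
  let ?f = "\<lambda>x. (1 - x) ^ d * (\<Prod>j\<in>{1..n} - {i}. 1 - x * y j)"
  let ?m = "\<lambda>k x. x ^ k * exp (- (a * x))"
  have b: "0 \<le> b" unfolding b_def by (simp add: sum_nonneg)
  have cont: "continuous_on {0..1} ?f" by (intro continuous_intros)
  have low: "?m 0 x - (b / 2 * ?m 2 x + b / 2 * ?m 3 x) \<le> ?f x" if "0 \<le> x" "x \<le> 1" for x
  proof -
    have "exp (- (a * x)) * (1 - b * ((x\<^sup>2 + x ^ 3) / 2)) \<le> ?f x"
      unfolding a_def b_def by (rule product_ge_cubic) (use y that in auto)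
    then show ?thesis by (simp add: algebra_simps add_divide_distrib)
  qed
  have "has_bochner_integral lborel
     (\<lambda>x. b / 2 * (indicator {0..} x * ?m 2 x) + b / 2 * (indicator {0..} x * ?m 3 x))
     (b / 2 * (fact 2 / a ^ (2 + 1)) + b / 2 * (fact 3 / a ^ (3 + 1)))"
    by (intro has_bochner_integral_add has_bochner_integral_mult_right halfline_moment a)
  moreover have "(\<lambda>x. b / 2 * (indicator {0..} x * ?m 2 x) + b / 2 * (indicator {0..} x * ?m 3 x))
     = (\<lambda>x. indicator {0..} x * (b / 2 * ?m 2 x + b / 2 * ?m 3 x))"
    by (rule ext) (simp add: algebra_simps)
  ultimately have hb: "has_bochner_integral lborel (\<lambda>x. indicator {0..} x * (b / 2 * ?m 2 x + b / 2 * ?m 3 x))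
     (b / 2 * (fact 2 / a ^ (2 + 1)) + b / 2 * (fact 3 / a ^ (3 + 1)))" by simp
  have tail: "(\<integral>x. b / 2 * ?m 2 x + b / 2 * ?m 3 x \<partial>unit_lebesgue)
     \<le> b / 2 * (fact 2 / a ^ (2 + 1)) + b / 2 * (fact 3 / a ^ (3 + 1))"
    by (rule unit_integral_le_halfline[OF _ _ _ hb]) (use b in \<open>auto intro!: continuous_intros\<close>)
  have main: "(\<integral>x. ?m 0 x \<partial>unit_lebesgue) = (- exp (- (a * 1)) / a) - (- exp (- (a * 0)) / a)"
    by (rule integral_unit_lebesgue[where F = "\<lambda>x. - exp (- (a * x)) / a"])
       (use a in \<open>auto intro!: derivative_eq_intros continuous_intros\<close>)
  have "(\<integral>x. ?m 0 x \<partial>unit_lebesgue) - (\<integral>x. b / 2 * ?m 2 x + b / 2 * ?m 3 x \<partial>unit_lebesgue)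
     = (\<integral>x. ?m 0 x - (b / 2 * ?m 2 x + b / 2 * ?m 3 x) \<partial>unit_lebesgue)"
    by (rule Bochner_Integration.integral_diff[symmetric]) (intro integrable_unit_lebesgue continuous_intros)+
  also have "\<dots> \<le> man_integral n d y i"
    unfolding man_integral_def
    by (rule Bochner_Integration.integral_mono)
       (use low in \<open>auto intro!: integrable_unit_lebesgue continuous_intros\<close>)
  finally have *: "1 / a - exp (- a) / a - (b / 2 * (fact 2 / a ^ (2 + 1)) + b / 2 * (fact 3 / a ^ (3 + 1)))
     \<le> man_integral n d y i"
    using main tail by simp
  have "a ^ 3 / 27 \<le> exp a"
  proof -
    have "(a / 3) ^ 3 \<le> (1 + a / real 3) ^ 3" using a by (intro power_mono) auto
    also have "\<dots> \<le> exp a" using a exp_ge_one_plus_x_over_n_power_n[of 3 a] by simp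
    finally show ?thesis by (simp add: power_divide)
  qed
  then have e: "exp (- a) \<le> 27 / a ^ 3"
    using a by (simp add: exp_minus field_simps)
  have "1 - b / a\<^sup>2 - (3 * b + 27) / a ^ 3 \<le> 1 - exp (- a) - b / a\<^sup>2 - 3 * b / a ^ 3"
    using e by (simp add: add_divide_distrib)
  also have "\<dots> = a * (1 / a - exp (- a) / a - (b / 2 * (fact 2 / a ^ (2 + 1)) + b / 2 * (fact 3 / a ^ (3 + 1))))"
    using a by (simp add: field_simps fact_numeral power2_eq_square power3_eq_cube eval_nat_numeral)
  also have "\<dots> \<le> a * man_integral n d y i"
    using * a by (intro mult_left_mono) auto
  finally show ?thesis .
qed

end

section \<open>The product of all inner integrals\<close>

context
  fixes n d :: nat and y :: "nat \<Rightarrow> real" and A B :: real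
  assumes y: "\<And>j. j \<in> {1..n} \<Longrightarrow> 0 \<le> y j \<and> y j \<le> 1"
    and d: "d \<ge> 1"
    and A_def: "A = d + (\<Sum>j\<in>{1..n}. y j)"
    and B_def: "B = d + (\<Sum>j\<in>{1..n}. (y j)\<^sup>2)"
begin

private lemma minus_one:
  assumes "i \<in> {1..n}"
  shows "A - y i = d + (\<Sum>j\<in>{1..n} - {i}. y j)" "B - (y i)\<^sup>2 = d + (\<Sum>j\<in>{1..n} - {i}. (y j)\<^sup>2)"
  unfolding A_def B_def using assms by (simp_all add: sum_diff1)

private lemma minus_one_ge:
  assumes "i \<in> {1..n}"
  shows "A - y i \<ge> 1" "B - (y i)\<^sup>2 \<ge> 1"
  unfolding minus_one[OF assms] using d y by (auto intro!: add_increasing2 sum_nonneg)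

lemma prod_man_integral_le: "A ^ n * (\<Prod>i\<in>{1..n}. man_integral n d y i) \<le> exp 2"
proof -
  have A: "A \<ge> 1" unfolding A_def using d y by (auto intro!: add_increasing2 sum_nonneg)
  have "A ^ n * (\<Prod>i\<in>{1..n}. man_integral n d y i) = (\<Prod>i\<in>{1..n}. A * man_integral n d y i)"
    by (simp add: prod.distrib)
  also have "\<dots> \<le> (\<Prod>i\<in>{1..n}. exp (2 * (y i / A)))"
  proof (intro prod_mono conjI)
    fix i assume i: "i \<in> {1..n}"
    show "0 \<le> A * man_integral n d y i" using A man_integral_nonneg[OF y] by simp
    have "man_integral n d y i \<le> 1 / (A - y i)"
      by (rule man_integral_upper_simple[OF y minus_one[OF i]]) (use minus_one_ge[OF i] in auto)
    then have "A * man_integral n d y i \<le> A / (A - y i)"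
      using A mult_left_mono[of "man_integral n d y i" "1 / (A - y i)" A] by simp
    also have "\<dots> \<le> 1 + 2 * (y i / A)"
    proof -
      \<comment> \<open>A \<ge> 2 y_i because A - y_i \<ge> d \<ge> 1 \<ge> y_i.\<close>
      have "0 \<le> y i * (A - 2 * y i)"
        using y[OF i] minus_one_ge(1)[OF i] by (intro mult_nonneg_nonneg) auto
      then have "A * A \<le> (A + 2 * y i) * (A - y i)" by (simp add: algebra_simps)
      then show ?thesis using A minus_one_ge(1)[OF i] by (simp add: field_simps)
    qed
    also have "\<dots> \<le> exp (2 * (y i / A))" by (rule exp_ge_add_one_self)
    finally show "A * man_integral n d y i \<le> exp (2 * (y i / A))" .
  qed
  also have "\<dots> = exp (2 * ((\<Sum>i\<in>{1..n}. y i) / A))"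
    by (simp add: exp_sum[symmetric] sum_distrib_left sum_divide_distrib)
  also have "\<dots> \<le> exp 2"
  proof -
    have "(\<Sum>i\<in>{1..n}. y i) / A \<le> 1" using A by (subst divide_le_eq) (auto simp: A_def)
    then show ?thesis by simp
  qed
  finally show ?thesis .
qed

text \<open>The ratios A/(A - y_i) multiply to about exp (\<Sum> y_i/A) = exp (1 - d/A), the bounds
  on (A - y_i) I_i to about exp (- n B/A^2). The 3 is 2 from ln (1 - z) \<ge> - z - 2 z^2 plus 1
  from leaving y_i^2 out of B; 48 is 3 * 2^4, from A - y_i \<ge> A/2.\<close>

lemma prod_man_integral_upper:
  assumes A2: "A \<ge> 2"
  shows "A ^ n * (\<Prod>i\<in>{1..n}. man_integral n d y i)
    \<le> exp (1 - d / A - n * B / A\<^sup>2 + (3 * n / A\<^sup>2 + 48 * n * B\<^sup>2 / A ^ 4))"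
proof -
  have "A ^ n * (\<Prod>i\<in>{1..n}. man_integral n d y i) = (\<Prod>i\<in>{1..n}. A * man_integral n d y i)"
    by (simp add: prod.distrib)
  also have "\<dots> \<le> (\<Prod>i\<in>{1..n}. exp (y i / A - B / A\<^sup>2 + (3 / A\<^sup>2 + 48 * B\<^sup>2 / A ^ 4)))"
  proof (intro prod_mono conjI)
    fix i assume i: "i \<in> {1..n}"
    let ?a = "A - y i" and ?b = "B - (y i)\<^sup>2" and ?z = "y i / A"
    note yi = y[OF i] and ge = minus_one_ge[OF i]
    have sq: "(y i)\<^sup>2 \<le> 1" using yi by (intro power_le_one) auto
    have b: "?b \<le> B" "B - 1 \<le> ?b" "0 \<le> ?b" "B \<ge> 1" using sq ge zero_le_power2[of "y i"] by linarith+
    have a: "?a \<le> A" "A / 2 \<le> ?a" "?a > 0" using yi A2 ge by auto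
    have z: "0 \<le> ?z" "?z \<le> 1 / 2" "?z\<^sup>2 \<le> 1 / A\<^sup>2"
      using yi A2 sq by (auto simp: power_divide divide_right_mono)
    show nonneg: "0 \<le> A * man_integral n d y i" using A2 man_integral_nonneg[OF y] by simp
    have "- ?z - 2 * ?z\<^sup>2 \<le> ln (1 - ?z)" by (rule ln_one_minus_pos_lower_bound) (use z in auto)
    moreover have "0 < 1 - ?z" using z(2) by linarith
    ultimately have "exp (- ?z - 2 * ?z\<^sup>2) \<le> 1 - ?z" by (simp only: ln_ge_iff)
    then have "1 \<le> exp (?z + 2 * ?z\<^sup>2) * (1 - ?z)"
      using mult_left_mono[of "exp (- ?z - 2 * ?z\<^sup>2)" "1 - ?z" "exp (?z + 2 * ?z\<^sup>2)"]
      by (simp add: exp_add[symmetric])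
    then have f1: "A / ?a \<le> exp (?z + 2 * ?z\<^sup>2)"
      using a A2 by (simp add: field_simps)
    have "?a * man_integral n d y i \<le> 1 - ?b / ?a\<^sup>2 + 3 * ?b\<^sup>2 / ?a ^ 4"
      by (rule man_integral_upper[OF y minus_one[OF i]]) (use a in auto)
    also have "\<dots> \<le> exp (- (?b / ?a\<^sup>2) + 3 * ?b\<^sup>2 / ?a ^ 4)"
      using exp_ge_add_one_self[of "- (?b / ?a\<^sup>2) + 3 * ?b\<^sup>2 / ?a ^ 4"] by linarith
    finally have f2: "?a * man_integral n d y i \<le> exp (- (?b / ?a\<^sup>2) + 3 * ?b\<^sup>2 / ?a ^ 4)" .
    have "(B - 1) / A\<^sup>2 \<le> ?b / ?a\<^sup>2"
      using a b by (intro frac_le power_mono) auto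
    moreover have "?b\<^sup>2 / ?a ^ 4 \<le> B\<^sup>2 / (A / 2) ^ 4"
      using a b A2 by (intro frac_le power_mono) auto
    ultimately have e: "?z + 2 * ?z\<^sup>2 + (- (?b / ?a\<^sup>2) + 3 * ?b\<^sup>2 / ?a ^ 4)
        \<le> ?z - B / A\<^sup>2 + (3 / A\<^sup>2 + 48 * B\<^sup>2 / A ^ 4)"
      using z(3) by (simp add: power_divide diff_divide_distrib)
    have "A * man_integral n d y i = (A / ?a) * (?a * man_integral n d y i)" using a by simp
    also have "\<dots> \<le> exp (?z + 2 * ?z\<^sup>2) * exp (- (?b / ?a\<^sup>2) + 3 * ?b\<^sup>2 / ?a ^ 4)"
      using a A2 man_integral_nonneg[OF y] by (intro mult_mono f1 f2) auto
    also have "\<dots> \<le> exp (?z - B / A\<^sup>2 + (3 / A\<^sup>2 + 48 * B\<^sup>2 / A ^ 4))"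
      using e by (simp add: exp_add[symmetric])
    finally show "A * man_integral n d y i \<le> exp (?z - B / A\<^sup>2 + (3 / A\<^sup>2 + 48 * B\<^sup>2 / A ^ 4))" .
  qed
  also have "\<dots> = exp ((\<Sum>i\<in>{1..n}. y i) / A - n * B / A\<^sup>2 + (3 * n / A\<^sup>2 + 48 * n * B\<^sup>2 / A ^ 4))"
    by (simp add: exp_sum[symmetric] sum.distrib sum_subtractf sum_divide_distrib algebra_simps)
  also have "(\<Sum>i\<in>{1..n}. y i) / A = 1 - d / A"
    using A2 by (simp add: A_def field_simps)
  finally show ?thesis .
qed

text \<open>In q, 32 is 8, from replacing (A - 1)^2 by A^2, plus 3 * 2^3, and 216 is 27 * 2^3; the
  powers of two come from A - y_i \<ge> A/2. The term 2 q^2 is the price of writing 1 - q as an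
  exponential.\<close>

lemma prod_man_integral_lower:
  fixes q :: real
  assumes A2: "A \<ge> 2" and q_def: "q = B / A\<^sup>2 + (32 * B + 216) / A ^ 3" and q: "q \<le> 1 / 2"
  shows "exp (1 - d / A - n * q - 2 * n * q\<^sup>2) \<le> A ^ n * (\<Prod>i\<in>{1..n}. man_integral n d y i)"
proof -
  have "exp (1 - d / A - n * q - 2 * n * q\<^sup>2) = exp ((\<Sum>i\<in>{1..n}. y i) / A - n * q - 2 * n * q\<^sup>2)"
    using A2 by (simp add: A_def field_simps)
  also have "\<dots> = (\<Prod>i\<in>{1..n}. exp (y i / A - q - 2 * q\<^sup>2))"
    by (simp add: exp_sum[symmetric] sum.distrib sum_subtractf sum_divide_distrib algebra_simps)
  also have "\<dots> \<le> (\<Prod>i\<in>{1..n}. A * man_integral n d y i)"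
  proof (intro prod_mono conjI)
    fix i assume i: "i \<in> {1..n}"
    let ?a = "A - y i" and ?b = "B - (y i)\<^sup>2" and ?z = "y i / A"
    note yi = y[OF i] and ge = minus_one_ge[OF i]
    have b: "?b \<le> B" "0 \<le> ?b" "B \<ge> 1" using ge zero_le_power2[of "y i"] by linarith+
    have a: "?a \<le> A" "A / 2 \<le> ?a" "A - 1 \<le> ?a" "?a > 0" using yi A2 ge by auto
    have z: "0 \<le> ?z" "?z \<le> 1 / 2" using yi A2 by auto
    have "0 \<le> B / A\<^sup>2 + (32 * B + 216) / A ^ 3"
      using b A2 by (intro add_nonneg_nonneg divide_nonneg_nonneg) auto
    then have q0: "0 \<le> q" by (simp only: q_def)
    have "exp ?z * (1 - ?z) \<le> exp ?z * exp (- ?z)"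
      using exp_ge_add_one_self[of "- ?z"] by (intro mult_left_mono) auto
    then have f1: "exp ?z \<le> A / ?a"
      using a A2 by (simp add: exp_add[symmetric] field_simps)
    have "1 / ?a\<^sup>2 \<le> 1 / (A - 1)\<^sup>2"
      using a A2 by (intro divide_left_mono power_mono mult_pos_pos) auto
    also have "\<dots> \<le> 1 / A\<^sup>2 + 8 / A ^ 3"
    proof -
      \<comment> \<open>The right-hand side is (A + 8)(A - 1)^2 - A^3.\<close>
      have "0 \<le> (A - 2) * (6 * A - 3) + 2" using A2 by (intro add_nonneg_nonneg mult_nonneg_nonneg) auto
      then have "A ^ 3 \<le> (A + 8) * (A - 1)\<^sup>2"
        by (simp add: algebra_simps power2_eq_square power3_eq_cube)
      then have "1 / (A - 1)\<^sup>2 \<le> (A + 8) / A ^ 3"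
        using A2 by (simp add: field_simps)
      also have "\<dots> = 1 / A\<^sup>2 + 8 / A ^ 3"
        using A2 by (simp add: field_simps power2_eq_square power3_eq_cube)
      finally show ?thesis .
    qed
    finally have "B * (1 / ?a\<^sup>2) \<le> B * (1 / A\<^sup>2 + 8 / A ^ 3)" using b by (intro mult_left_mono) auto
    moreover have "?b / ?a\<^sup>2 \<le> B / ?a\<^sup>2" using b by (intro divide_right_mono) auto
    moreover have "(3 * ?b + 27) / ?a ^ 3 \<le> (3 * B + 27) / (A / 2) ^ 3"
      using a b A2 by (intro frac_le power_mono) auto
    moreover have "B * (1 / A\<^sup>2 + 8 / A ^ 3) = B / A\<^sup>2 + 8 * B / A ^ 3"
      by (simp add: algebra_simps)
    moreover have "(3 * B + 27) / (A / 2) ^ 3 = (24 * B + 216) / A ^ 3"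
      by (simp add: power_divide)
    moreover have "8 * B / A ^ 3 + (24 * B + 216) / A ^ 3 = (32 * B + 216) / A ^ 3"
      by (simp add: add_divide_distrib[symmetric])
    moreover have "B * (1 / ?a\<^sup>2) = B / ?a\<^sup>2" by simp
    ultimately have qle: "?b / ?a\<^sup>2 + (3 * ?b + 27) / ?a ^ 3 \<le> q"
      unfolding q_def by linarith
    have "- q - 2 * q\<^sup>2 \<le> ln (1 - q)" by (rule ln_one_minus_pos_lower_bound) (use q q0 in auto)
    then have "exp (- q - 2 * q\<^sup>2) \<le> 1 - q" using q by (subst (asm) ln_ge_iff) auto
    also have "\<dots> \<le> 1 - ?b / ?a\<^sup>2 - (3 * ?b + 27) / ?a ^ 3" using qle by simp
    also have "\<dots> \<le> ?a * man_integral n d y i"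
      by (rule man_integral_lower[OF y minus_one[OF i]]) (use a in auto)
    finally have f2: "exp (- q - 2 * q\<^sup>2) \<le> ?a * man_integral n d y i" .
    have "exp (?z - q - 2 * q\<^sup>2) = exp ?z * exp (- q - 2 * q\<^sup>2)"
      by (simp add: exp_add[symmetric])
    also have "\<dots> \<le> (A / ?a) * (?a * man_integral n d y i)"
      using a A2 by (intro mult_mono f1 f2) auto
    also have "\<dots> = A * man_integral n d y i" using a by simp
    finally show "exp (?z - q - 2 * q\<^sup>2) \<le> A * man_integral n d y i" .
  qed simp
  also have "\<dots> = A ^ n * (\<Prod>i\<in>{1..n}. man_integral n d y i)"
    by (simp add: prod.distrib)
  finally show ?thesis .
qed

end

section \<open>Stability of the exponent at typical points\<close>

text \<open>The second moment of \<open>u Y\<close> when \<open>Y\<close> has density proportional to \<open>exp (- u y)\<close> on the unit interval.\<close>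

definition second_moment :: "real \<Rightarrow> real" where
  "second_moment u = 2 - (u\<^sup>2 + 2 * u) / (exp u - 1)"

lemma exp_minus_one_lower:
  fixes u :: real
  assumes "u > 0"
  shows "u \<le> exp u - 1" "u\<^sup>2 / 2 \<le> exp u - 1" "u ^ 3 / 27 \<le> exp u - 1"
proof -
  show "u \<le> exp u - 1" using exp_ge_add_one_self[of u] by linarith
  show "u\<^sup>2 / 2 \<le> exp u - 1" using exp_lower_Taylor_quadratic[of u] assms by simp
  have "1 + u ^ 3 / 27 \<le> (1 + u / real 3) ^ 3"
    using assms by (simp add: power3_eq_cube field_simps)
  also have "\<dots> \<le> exp u" using assms exp_ge_one_plus_x_over_n_power_n[of 3 u] by simp
  finally show "u ^ 3 / 27 \<le> exp u - 1" by simp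
qed

text \<open>Only the relative error of u matters, because the derivative is O(1/x): x times it is a
  combination of ratios x^k/(e^x - 1), bounded by 1, 2 and 27 for k = 1, 2, 3, with positive part at
  most 27 + 4 + 2 + 2 = 35. Intermediate points are at least s/2, which doubles 35 to 70.\<close>

lemma second_moment_lipschitz:
  fixes s u \<epsilon> :: real
  assumes s: "s > 0" and us: "\<bar>u - s\<bar> \<le> \<epsilon> * s" and e: "\<epsilon> \<le> 1 / 2"
  shows "\<bar>second_moment u - second_moment s\<bar> \<le> 70 * \<epsilon>"
proof -
  define D where "D x = (x\<^sup>2 + 2 * x) * exp x / (exp x - 1)\<^sup>2 - (2 * x + 2) / (exp x - 1)" for x :: real
  have deriv: "(second_moment has_real_derivative D x) (at x)" if "x > 0" for x
  proof -
    have ne: "exp x - 1 \<noteq> 0" using that by simp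
    have "(second_moment has_real_derivative
        0 - ((2 * x + 2) * (exp x - 1) - (x\<^sup>2 + 2 * x) * exp x) / ((exp x - 1) * (exp x - 1))) (at x)"
      unfolding second_moment_def[abs_def]
      by (rule derivative_eq_intros refl ne | simp)+
    also have "0 - ((2 * x + 2) * (exp x - 1) - (x\<^sup>2 + 2 * x) * exp x) / ((exp x - 1) * (exp x - 1)) = D x"
      unfolding D_def using ne by (simp add: diff_divide_distrib power2_eq_square)
    finally show ?thesis .
  qed
  have bound: "\<bar>D x\<bar> \<le> 35 / x" if x: "x > 0" for x
  proof -
    define E where "E = exp x - 1"
    have E: "x \<le> E" "x\<^sup>2 / 2 \<le> E" "x ^ 3 / 27 \<le> E" "E > 0"
      using exp_minus_one_lower[OF x] x by (auto simp: E_def)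
    have r: "x / E \<le> 1" "x\<^sup>2 / E \<le> 2" "x ^ 3 / E \<le> 27" "0 \<le> x / E" "0 \<le> x\<^sup>2 / E" "0 \<le> x ^ 3 / E"
      using E x by (auto simp: divide_le_eq)
    have p: "(x / E) * (x\<^sup>2 / E) \<le> 1 * 2" "(x / E) * (x / E) \<le> 1 * 1" "0 \<le> (x / E) * (x\<^sup>2 / E)"
      using r by (intro mult_mono mult_nonneg_nonneg; simp)+
    have "x * D x = x ^ 3 / E + 2 * (x\<^sup>2 / E) + (x / E) * (x\<^sup>2 / E) + 2 * ((x / E) * (x / E))
       - (2 * (x\<^sup>2 / E) + 2 * (x / E))"
    proof -
      have "exp x = E + 1" by (simp add: E_def)
      then show ?thesis
        unfolding D_def E_def[symmetric] using E(4)
        by (simp add: field_simps power2_eq_square power3_eq_cube)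
    qed
    then have "\<bar>x * D x\<bar> \<le> 35"
      using r p mult_nonneg_nonneg[OF r(4,4)] by linarith
    then show ?thesis using x by (simp add: abs_mult field_simps)
  qed
  have lo: "x \<ge> s / 2" if "x \<ge> min s u" for x
  proof -
    have "\<epsilon> * s \<le> s / 2" using mult_right_mono[OF e, of s] s by simp
    then show ?thesis using that us s by linarith
  qed
  have "\<bar>second_moment u - second_moment s\<bar> \<le> \<bar>u - s\<bar> * (70 / s)"
  proof (cases "u = s")
    case False
    have "\<exists>z. z \<ge> min s u \<and> \<bar>second_moment u - second_moment s\<bar> = \<bar>u - s\<bar> * \<bar>D z\<bar>"
    proof (cases "s < u")
      case True
      obtain z where "s < z" "z < u" "second_moment u - second_moment s = (u - s) * D z"
        using MVT2[OF True, of second_moment D] deriv s by auto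
      then show ?thesis by (intro exI[of _ z]) (auto simp: abs_mult)
    next
      case F: False
      then have "u < s" using False by simp
      moreover have "u > 0" using lo[of u] s by simp
      ultimately obtain z where "u < z" "z < s" "second_moment s - second_moment u = (s - u) * D z"
        using MVT2[of u s second_moment D] deriv by auto
      then have "\<bar>second_moment u - second_moment s\<bar> = \<bar>u - s\<bar> * \<bar>D z\<bar>"
        by (metis abs_minus_commute abs_mult)
      then show ?thesis using \<open>u < z\<close> by (intro exI[of _ z]) auto
    qed
    then obtain z where z: "z \<ge> min s u" "\<bar>second_moment u - second_moment s\<bar> = \<bar>u - s\<bar> * \<bar>D z\<bar>" by blast
    have zs: "z \<ge> s / 2" using lo z by blast
    then have "\<bar>D z\<bar> \<le> 35 / z" using s by (intro bound) auto
    also have "\<dots> \<le> 35 / (s / 2)" using zs s by (intro divide_left_mono) auto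
    finally have "\<bar>D z\<bar> \<le> 70 / s" by simp
    then show ?thesis unfolding z(2) by (intro mult_left_mono) auto
  qed simp
  also have "\<dots> \<le> \<epsilon> * s * (70 / s)" using us s by (intro mult_right_mono) auto
  finally show ?thesis using s by simp
qed

text \<open>With \<open>\<kappa>\<close> = s d/n and \<open>\<kappa>2\<close> = s^2 d/n, d/A is near
  \<open>\<kappa>\<close>, n d/A^2 is near \<open>\<kappa>2\<close>, and n T/A^2 is near
  \<open>second_moment s\<close> = 2 - \<open>\<kappa>2\<close> - 2 \<open>\<kappa>\<close>. The
  \<open>\<kappa>2\<close> cancel, leaving 1 - \<open>\<kappa>\<close> - (2 - 2
  \<open>\<kappa>\<close>) = \<open>\<kappa>\<close> - 1. Since \<open>\<kappa>\<close> \<le> 1 and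
  \<open>\<kappa>2\<close> \<le> 2 for every s, all constants are absolute.\<close>

lemma exponent_close:
  fixes n d A T s u \<epsilon> :: real
  assumes pos: "n > 0" "d > 0" "s > 0" "A > 0" and es: "exp s - 1 = n / d" and e: "\<epsilon> \<le> 1 / 2"
    and us: "\<bar>u - s\<bar> \<le> \<epsilon> * s" and uA: "\<bar>u * A / n - 1\<bar> \<le> \<epsilon>" and uT: "\<bar>u\<^sup>2 * T / n - second_moment u\<bar> \<le> \<epsilon>"
  shows "\<bar>(1 - d / A - n * (d + T) / A\<^sup>2) - (s * d / n - 1)\<bar> \<le> 320 * \<epsilon>"
    and "n * (d + T) / A\<^sup>2 \<le> 200"
proof -
  have e0: "\<epsilon> \<ge> 0" using uA by linarith
  define \<alpha> where "\<alpha> = u / s"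
  define t where "t = u * A / n"
  define \<theta> where "\<theta> = 1 / t"
  define \<kappa> where "\<kappa> = s * d / n"
  define \<kappa>2 where "\<kappa>2 = s\<^sup>2 * d / n"
  have t1: "\<bar>t - 1\<bar> \<le> \<epsilon>" using uA by (simp add: t_def)
  then have t: "\<bar>t - 1\<bar> \<le> \<epsilon>" "t \<ge> 1 / 2" using e by linarith+
  have u: "u > 0"
  proof (rule ccontr)
    assume "\<not> u > 0"
    then have "t \<le> 0" using pos unfolding t_def by (intro divide_nonpos_pos mult_nonpos_nonneg) auto
    then show False using t(2) by simp
  qed
  have \<alpha>: "\<bar>\<alpha> - 1\<bar> \<le> \<epsilon>" "\<alpha> > 0"
    using us u pos by (auto simp: \<alpha>_def field_simps abs_if split: if_splits)
  have \<theta>: "\<bar>\<theta> - 1\<bar> \<le> 2 * \<epsilon>" "0 < \<theta>" "\<theta> \<le> 2"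
  proof -
    have "\<theta> - 1 = (1 - t) / t" using t(2) by (auto simp: \<theta>_def field_simps)
    then have "\<bar>\<theta> - 1\<bar> = \<bar>t - 1\<bar> / t" using t(2) by (simp add: abs_minus_commute)
    also have "\<dots> \<le> \<epsilon> / (1 / 2)" using t e0 by (intro frac_le) auto
    finally show "\<bar>\<theta> - 1\<bar> \<le> 2 * \<epsilon>" by simp
    show "0 < \<theta>" "\<theta> \<le> 2" using t(2) by (auto simp: \<theta>_def divide_le_eq)
  qed
  have \<kappa>: "0 \<le> \<kappa>" "\<kappa> \<le> 1" "0 \<le> \<kappa>2" "\<kappa>2 \<le> 2"
    using exp_minus_one_lower[OF pos(3)] pos unfolding es \<kappa>_def \<kappa>2_def by (auto simp: field_simps)
  have sm: "second_moment s = 2 - \<kappa>2 - 2 * \<kappa>"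
    using pos unfolding second_moment_def es \<kappa>_def \<kappa>2_def by (simp add: field_simps)
  have dA: "d / A = \<alpha> * \<theta> * \<kappa>"
    using pos u by (simp add: \<alpha>_def \<theta>_def t_def \<kappa>_def field_simps)
  have "\<bar>\<alpha> * \<theta> - 1\<bar> = \<bar>(\<alpha> - 1) * \<theta> + (\<theta> - 1)\<bar>" by (simp add: algebra_simps)
  also have "\<dots> \<le> \<bar>\<alpha> - 1\<bar> * \<theta> + \<bar>\<theta> - 1\<bar>" using \<theta>(2) by (intro order_trans[OF abs_triangle_ineq]) (simp add: abs_mult)
  also have "\<dots> \<le> \<epsilon> * 2 + 2 * \<epsilon>" using \<alpha> \<theta> e0 by (intro add_mono mult_mono) auto
  finally have at: "\<bar>\<alpha> * \<theta> - 1\<bar> \<le> 4 * \<epsilon>" by simp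
  have "d / A - \<kappa> = (\<alpha> * \<theta> - 1) * \<kappa>" unfolding dA by (simp add: algebra_simps)
  then have "\<bar>d / A - \<kappa>\<bar> = \<bar>\<alpha> * \<theta> - 1\<bar> * \<kappa>" using \<kappa>(1) by (simp add: abs_mult)
  also have "\<dots> \<le> 4 * \<epsilon> * 1" using at \<kappa> e0 by (intro mult_mono) auto
  finally have p1: "\<bar>d / A - \<kappa>\<bar> \<le> 4 * \<epsilon>" by simp
  define W where "W = \<alpha>\<^sup>2 * \<kappa>2 + u\<^sup>2 * T / n"
  have nB: "n * (d + T) / A\<^sup>2 = \<theta>\<^sup>2 * W"
    using pos u by (simp add: W_def \<alpha>_def \<theta>_def t_def \<kappa>2_def field_simps power2_eq_square)
  have "\<bar>\<alpha>\<^sup>2 - 1\<bar> = \<bar>\<alpha> - 1\<bar> * (\<alpha> + 1)"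
    using \<alpha>(2) by (simp add: power2_eq_square square_diff_one_factored abs_mult)
  also have "\<dots> \<le> \<epsilon> * (5 / 2)" using \<alpha> e e0 by (intro mult_mono) auto
  finally have "\<bar>\<alpha>\<^sup>2 - 1\<bar> * \<kappa>2 \<le> \<epsilon> * (5 / 2) * 2" using \<kappa> e0 by (intro mult_mono) auto
  then have "\<bar>\<alpha>\<^sup>2 * \<kappa>2 - \<kappa>2\<bar> \<le> 5 * \<epsilon>"
    using \<kappa>(3) abs_mult[of "\<alpha>\<^sup>2 - 1" \<kappa>2] by (simp add: left_diff_distrib)
  moreover have "\<bar>second_moment u - second_moment s\<bar> \<le> 70 * \<epsilon>"
    by (rule second_moment_lipschitz[OF pos(3) us e])
  ultimately have W: "\<bar>W - (2 - 2 * \<kappa>)\<bar> \<le> 76 * \<epsilon>"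
    using uT unfolding sm W_def by linarith
  have "\<bar>\<theta>\<^sup>2 - 1\<bar> = \<bar>\<theta> - 1\<bar> * (\<theta> + 1)"
    using \<theta>(2) by (simp add: power2_eq_square square_diff_one_factored abs_mult)
  also have "\<dots> \<le> 2 * \<epsilon> * 3" using \<theta> e0 by (intro mult_mono) auto
  finally have t2: "\<bar>\<theta>\<^sup>2 - 1\<bar> \<le> 6 * \<epsilon>" by simp
  have th4: "\<theta>\<^sup>2 \<le> 4" using power_mono[of \<theta> 2 2] \<theta> by simp
  have "\<bar>\<theta>\<^sup>2 * W - (2 - 2 * \<kappa>)\<bar> = \<bar>\<theta>\<^sup>2 * (W - (2 - 2 * \<kappa>)) + (\<theta>\<^sup>2 - 1) * (2 - 2 * \<kappa>)\<bar>"
    by (simp add: algebra_simps)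
  also have "\<dots> \<le> \<theta>\<^sup>2 * \<bar>W - (2 - 2 * \<kappa>)\<bar> + \<bar>\<theta>\<^sup>2 - 1\<bar> * (2 - 2 * \<kappa>)"
    using \<kappa> by (intro order_trans[OF abs_triangle_ineq]) (simp add: abs_mult)
  also have "\<dots> \<le> 4 * (76 * \<epsilon>) + 6 * \<epsilon> * 2" using th4 W t2 \<kappa> e0 by (intro add_mono mult_mono) auto
  finally have p2: "\<bar>n * (d + T) / A\<^sup>2 - (2 - 2 * \<kappa>)\<bar> \<le> 316 * \<epsilon>" unfolding nB by simp
  show "\<bar>(1 - d / A - n * (d + T) / A\<^sup>2) - (s * d / n - 1)\<bar> \<le> 320 * \<epsilon>"
  proof -
    have "\<bar>(1 - a - x) - (k - 1)\<bar> \<le> 320 * e" if "\<bar>a - k\<bar> \<le> 4 * e" "\<bar>x - (2 - 2 * k)\<bar> \<le> 316 * e"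
      for a x k e :: real using that by linarith
    from this[OF p1 p2] show ?thesis unfolding \<kappa>_def .
  qed
  \<comment> \<open>At most 2 + 316/2 = 160, rounded up.\<close>
  show "n * (d + T) / A\<^sup>2 \<le> 200" using p2 \<kappa> e by linarith
qed

section \<open>The mixing measure\<close>

text \<open>Divided by b, the weight g is the density of minus the logarithm of a Beta(d, m + 1)
  variable, distributed as a sum of independent exponentials of rates d, ..., d + m; hence mean H
  and variance H2. The proof bypasses this representation: one factor 1 - e^(-u) splits the integral
  for (d, m + 1) into those for (d, m) and (d + 1, m).\<close>

lemma exponential_integral_one_minus_exp_power:
  fixes d m :: nat
  assumes "d \<ge> 1"
  defines "H \<equiv> \<lambda>d m. \<Sum>k=d..d+m. 1 / real k" and "H2 \<equiv> \<lambda>d m. \<Sum>k=d..d+m. 1 / (real k)\<^sup>2"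
    and "b \<equiv> \<lambda>d m. fact (d - 1) * fact m / fact (d + m) :: real"
    and "g \<equiv> \<lambda>d m u. exp (- (real d * u)) * (1 - exp (- u)) ^ m"
  shows "has_bochner_integral lborel (\<lambda>u. indicator {0..} u * g d m u) (b d m)"
    and "has_bochner_integral lborel (\<lambda>u. indicator {0..} u * (u * g d m u)) (b d m * H d m)"
    and "has_bochner_integral lborel (\<lambda>u. indicator {0..} u * (u\<^sup>2 * g d m u)) (b d m * ((H d m)\<^sup>2 + H2 d m))"
proof -
  have "has_bochner_integral lborel (\<lambda>u. indicator {0..} u * g d m u) (b d m) \<and>
    has_bochner_integral lborel (\<lambda>u. indicator {0..} u * (u * g d m u)) (b d m * H d m) \<and>
    has_bochner_integral lborel (\<lambda>u. indicator {0..} u * (u\<^sup>2 * g d m u)) (b d m * ((H d m)\<^sup>2 + H2 d m))"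
    using assms(1)
  proof (induction m arbitrary: d)
    case 0
    have f: "fact d = real d * fact (d - 1)" using 0 fact_reduce[of d, where ?'a = real] by simp
    show ?case
      using halfline_moment[of "real d" 0] halfline_moment[of "real d" 1] halfline_moment[of "real d" 2] 0
      unfolding g_def b_def H_def H2_def by (simp add: f power2_eq_square power3_eq_cube eval_nat_numeral)
  next
    case (Suc m)
    define p where "p = real d + real m + 1"
    have d: "d \<ge> 1" "real d > 0" and d1: "Suc d \<ge> 1" using Suc.prems by auto
    have p: "p > 0" "p = real (d + Suc m)" by (auto simp: p_def)
    have split: "g d (Suc m) u = g d m u - g (Suc d) m u" for u
      unfolding g_def by (simp add: algebra_simps exp_add[symmetric] exp_diff[symmetric])
    have fd: "fact d = real d * fact (d - 1)" using d fact_reduce[of d, where ?'a = real] by simp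
    have fm: "fact (Suc m) = (real m + 1) * fact m" "fact (d + Suc m) = p * fact (d + m)"
      by (simp_all add: p_def add_ac)
    have "b d (Suc m) = b d m * (real m + 1) / p"
      unfolding b_def fm using p(1) by (simp add: mult_ac)
    then have b1: "b d m = b d (Suc m) * (p / (real m + 1))"
      using p(1) by simp
    have sd: "Suc d - 1 = d" "Suc d + m = d + Suc m" by simp_all
    have b2: "b (Suc d) m = b d (Suc m) * (real d / (real m + 1))"
      unfolding b_def sd fd fm(1) by simp
    \<comment> \<open>Of the block d..d+m+1, the pair (d, m) misses the last term and the pair (d +
      1, m) the first.\<close>
    have H1: "H d m = H d (Suc m) - 1 / p" "H2 d m = H2 d (Suc m) - 1 / p\<^sup>2"
      unfolding H_def H2_def p(2) by (simp_all del: of_nat_add of_nat_Suc)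
    have "{d..d + Suc m} = insert d {Suc d..Suc d + m}" by auto
    then have H2': "H (Suc d) m = H d (Suc m) - 1 / real d" "H2 (Suc d) m = H2 d (Suc m) - 1 / (real d)\<^sup>2"
      unfolding H_def H2_def by simp_all
    note IH = Suc.IH[OF d(1)] Suc.IH[OF d1]
    have pm: "p - real d = real m + 1" by (simp add: p_def)
    have "b d m - b (Suc d) m = b d (Suc m) * ((p - real d) / (real m + 1))"
      unfolding b1 b2 by (simp add: diff_divide_distrib right_diff_distrib)
    then have e0: "b d m - b (Suc d) m = b d (Suc m)" unfolding pm by simp
    have gen: "B * (v / c) * x - B * (w / c) * y = B * ((v * x - w * y) / c)" for B v w c x y :: real
      by (simp add: diff_divide_distrib right_diff_distrib mult_ac)
    have "b d m * H d m - b (Suc d) m * H (Suc d) m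
       = b d (Suc m) * ((p * (H d (Suc m) - 1 / p) - real d * (H d (Suc m) - 1 / real d)) / (real m + 1))"
      unfolding b1 b2 H1 H2' by (rule gen)
    also have "p * (H d (Suc m) - 1 / p) - real d * (H d (Suc m) - 1 / real d) = (p - real d) * H d (Suc m)"
      using p(1) d(2) by (simp add: algebra_simps)
    also have "b d (Suc m) * ((p - real d) * H d (Suc m) / (real m + 1)) = b d (Suc m) * H d (Suc m)"
      unfolding pm by simp
    finally have e1: "b d m * H d m - b (Suc d) m * H (Suc d) m = b d (Suc m) * H d (Suc m)" .
    \<comment> \<open>The 1/x terms cancel, and - 2 h does not depend on x, so it drops out of the
      difference between x = p and x = d.\<close>
    have q: "x * ((h - 1 / x)\<^sup>2 + (h2 - 1 / x\<^sup>2)) = x * (h\<^sup>2 + h2) - 2 * h" if "x > 0" for x h h2 :: real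
      using that by (simp add: field_simps power2_eq_square)
    have "b d m * ((H d m)\<^sup>2 + H2 d m) - b (Suc d) m * ((H (Suc d) m)\<^sup>2 + H2 (Suc d) m)
       = b d (Suc m) * ((p * ((H d (Suc m) - 1 / p)\<^sup>2 + (H2 d (Suc m) - 1 / p\<^sup>2))
          - real d * ((H d (Suc m) - 1 / real d)\<^sup>2 + (H2 d (Suc m) - 1 / (real d)\<^sup>2))) / (real m + 1))"
      unfolding b1 b2 H1 H2' by (rule gen)
    also have "p * ((H d (Suc m) - 1 / p)\<^sup>2 + (H2 d (Suc m) - 1 / p\<^sup>2))
          - real d * ((H d (Suc m) - 1 / real d)\<^sup>2 + (H2 d (Suc m) - 1 / (real d)\<^sup>2))
       = (p - real d) * ((H d (Suc m))\<^sup>2 + H2 d (Suc m))"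
      unfolding q[OF p(1)] q[OF d(2)] by (simp add: algebra_simps)
    also have "b d (Suc m) * ((p - real d) * ((H d (Suc m))\<^sup>2 + H2 d (Suc m)) / (real m + 1))
       = b d (Suc m) * ((H d (Suc m))\<^sup>2 + H2 d (Suc m))"
      unfolding pm by simp
    finally have e2: "b d m * ((H d m)\<^sup>2 + H2 d m) - b (Suc d) m * ((H (Suc d) m)\<^sup>2 + H2 (Suc d) m)
       = b d (Suc m) * ((H d (Suc m))\<^sup>2 + H2 d (Suc m))" .
    have s0: "(\<lambda>u. indicator {0..} u * g d (Suc m) u) = (\<lambda>u. indicator {0..} u * g d m u - indicator {0..} u * g (Suc d) m u)"
      and s1: "(\<lambda>u. indicator {0..} u * (u * g d (Suc m) u)) = (\<lambda>u. indicator {0..} u * (u * g d m u) - indicator {0..} u * (u * g (Suc d) m u))"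
      and s2: "(\<lambda>u. indicator {0..} u * (u\<^sup>2 * g d (Suc m) u)) = (\<lambda>u. indicator {0..} u * (u\<^sup>2 * g d m u) - indicator {0..} u * (u\<^sup>2 * g (Suc d) m u))"
      unfolding split by (auto simp: algebra_simps fun_eq_iff)
    show ?case
      using has_bochner_integral_diff[OF IH(1)[THEN conjunct1] IH(2)[THEN conjunct1]]
        has_bochner_integral_diff[OF IH(1)[THEN conjunct2, THEN conjunct1] IH(2)[THEN conjunct2, THEN conjunct1]]
        has_bochner_integral_diff[OF IH(1)[THEN conjunct2, THEN conjunct2] IH(2)[THEN conjunct2, THEN conjunct2]]
      unfolding s0 s1 s2 e0 e1 e2 by (intro conjI)
  qed
  then show "has_bochner_integral lborel (\<lambda>u. indicator {0..} u * g d m u) (b d m)"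
    and "has_bochner_integral lborel (\<lambda>u. indicator {0..} u * (u * g d m u)) (b d m * H d m)"
    and "has_bochner_integral lborel (\<lambda>u. indicator {0..} u * (u\<^sup>2 * g d m u)) (b d m * ((H d m)\<^sup>2 + H2 d m))"
    by blast+
qed

text \<open>Each sum is compared with a telescoping one: ln ((k+1)/k) lies between 1/(k+1) and 1/k,
  and 1/k^2 \<le> 2 (1/k - 1/(k+1)). Keeping v instead of 1/d matters for d far above n: there s is
  about n/d and v about n/d^2, so v/s^2 is about 1/n, whereas (1/d)/s^2 would be about
  d/n^2.\<close>

lemma harmonic_block_bounds:
  fixes d n :: nat
  assumes "d \<ge> 1" "n \<ge> 1"
  defines "v \<equiv> 1 / real d - 1 / real (d + n)" and "s \<equiv> ln (real (d + n) / real d)"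
  shows "s \<le> (\<Sum>k=d..d+(n-1). 1 / real k)" "(\<Sum>k=d..d+(n-1). 1 / real k) \<le> s + v"
    "(\<Sum>k=d..d+(n-1). 1 / (real k)\<^sup>2) \<le> 2 * v"
proof -
  have step: "1 / (real k + 1) \<le> ln (real (Suc k) / real k) \<and> ln (real (Suc k) / real k) \<le> 1 / real k"
    if "k \<ge> 1" for k :: nat
  proof
    have "ln (real k / real (Suc k)) \<le> real k / real (Suc k) - 1"
      using that by (intro ln_le_minus_one) auto
    also have "\<dots> = - (1 / (real k + 1))" using that by (simp add: field_simps)
    finally show "1 / (real k + 1) \<le> ln (real (Suc k) / real k)" using that by (simp add: ln_div)
    have "ln (real (Suc k) / real k) \<le> real (Suc k) / real k - 1"
      using that by (intro ln_le_minus_one) auto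
    also have "\<dots> = 1 / real k" using that by (simp add: field_simps)
    finally show "ln (real (Suc k) / real k) \<le> 1 / real k" .
  qed
  have r: "1 / (real k)\<^sup>2 \<le> 2 * (1 / real k - 1 / (real k + 1))" if "k \<ge> 1" for k :: nat
  proof -
    have "1 / (real k)\<^sup>2 = 2 / (2 * (real k)\<^sup>2)" by simp
    also have "\<dots> \<le> 2 / (real k * (real k + 1))"
      using that by (intro divide_left_mono mult_pos_pos) (auto simp: power2_eq_square algebra_simps)
    also have "\<dots> = 2 * (1 / real k - 1 / (real k + 1))"
      using that by (simp add: diff_frac_eq)
    finally show ?thesis .
  qed
  have "ln (real (d + Suc m) / real d) \<le> (\<Sum>k=d..d+m. 1 / real k)
    \<and> (\<Sum>k=d..d+m. 1 / real k) \<le> ln (real (d + Suc m) / real d) + (1 / real d - 1 / real (d + Suc m))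
    \<and> (\<Sum>k=d..d+m. 1 / (real k)\<^sup>2) \<le> 2 * (1 / real d - 1 / real (d + Suc m))" for m
  proof (induction m)
    case 0
    show ?case using r[OF assms(1)] step[OF assms(1)] by (simp add: add_ac)
  next
    case (Suc m)
    let ?k = "d + Suc m"
    have l: "ln (real (d + Suc (Suc m)) / real d) = ln (real ?k / real d) + ln (real (Suc ?k) / real ?k)"
      using assms(1) by (simp add: ln_div del: of_nat_add of_nat_Suc)
    have k: "?k \<ge> 1" by simp
    have "{d..d + Suc m} = insert ?k {d..d + m}" by auto
    then have sums: "(\<Sum>k=d..d + Suc m. f k) = f ?k + (\<Sum>k=d..d+m. f k)" for f :: "nat \<Rightarrow> real" by simp
    have "real (d + Suc (Suc m)) = real ?k + 1" by simp
    then show ?case using Suc.IH step[OF k] r[OF k] unfolding l sums by (auto simp del: of_nat_add)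
  qed
  from this[of "n - 1"] show "s \<le> (\<Sum>k=d..d+(n-1). 1 / real k)" "(\<Sum>k=d..d+(n-1). 1 / real k) \<le> s + v"
    "(\<Sum>k=d..d+(n-1). 1 / (real k)\<^sup>2) \<le> 2 * v"
    using assms(2) unfolding s_def v_def by simp_all
qed

section \<open>Exponential laws truncated to the unit interval\<close>

definition exp_mean :: "real \<Rightarrow> real" where
  "exp_mean u = (1 - exp (- u)) / u"

lemma exp_mean_integral:
  assumes "u > 0"
  shows "(\<integral>t. exp (- (u * t)) \<partial>unit_lebesgue) = exp_mean u"
proof -
  have "(\<integral>t. exp (- (u * t)) \<partial>unit_lebesgue) = (- exp (- (u * 1)) / u) - (- exp (- (u * 0)) / u)"
    by (rule integral_unit_lebesgue[where F = "\<lambda>x. - exp (- (u * x)) / u"])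
       (use assms in \<open>auto intro!: derivative_eq_intros continuous_intros\<close>)
  then show ?thesis by (simp add: exp_mean_def diff_divide_distrib)
qed

lemma exp_mean_pos: "u > 0 \<Longrightarrow> exp_mean u > 0"
  by (simp add: exp_mean_def)

lemma exp_mean_le_1:
  assumes "u > 0" shows "exp_mean u \<le> 1"
  using exp_ge_add_one_self[of "- u"] assms by (simp add: exp_mean_def divide_le_eq)

lemma exp_mean_antimono:
  assumes "0 < u" "u \<le> v" shows "exp_mean v \<le> exp_mean u"
proof -
  have "(\<integral>t. exp (- (v * t)) \<partial>unit_lebesgue) \<le> (\<integral>t. exp (- (u * t)) \<partial>unit_lebesgue)"
    by (rule Bochner_Integration.integral_mono)
       (use assms in \<open>auto intro!: integrable_unit_lebesgue continuous_intros mult_right_mono\<close>)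
  then show ?thesis using assms by (simp add: exp_mean_integral)
qed

lemma exp_mean_mono_scaled:
  assumes "0 < u" "u \<le> v" shows "u * exp_mean u \<le> v * exp_mean v"
  using assms by (simp add: exp_mean_def)

text \<open>Equivalent to (1 + u) e^(-u) \<le> 1. It later bounds division by
  \<open>exp_mean s\<close> by multiplication by 1 + s.\<close>

lemma exp_mean_ge:
  assumes "u > 0" shows "1 / (1 + u) \<le> exp_mean u"
proof -
  have "(1 + u) * exp (- u) \<le> exp u * exp (- u)"
    using exp_ge_add_one_self[of u] by (intro mult_right_mono) auto
  then have "(1 + u) * exp (- u) \<le> 1" by (simp add: exp_add[symmetric])
  then show ?thesis using assms by (simp add: exp_mean_def field_simps)
qed

text \<open>A positive function h that decreases while u h(u) increases changes by at most the
  factor by which u changes. So relative closeness of u and s carries over, whatever the size of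
  s.\<close>

lemma exp_mean_close:
  assumes s: "s > 0" and u: "u > 0" "\<bar>u - s\<bar> \<le> \<epsilon> * s" and e: "0 < \<epsilon>" "\<epsilon> < 1"
  shows "exp_mean u \<le> exp_mean s / (1 - \<epsilon>)" "exp_mean s / (1 + \<epsilon>) \<le> exp_mean u"
proof -
  note hs = exp_mean_pos[OF s] and hu = exp_mean_pos[OF u(1)]
  have b: "(1 - \<epsilon>) * s \<le> u" "u \<le> (1 + \<epsilon>) * s" using u(2) by (auto simp: algebra_simps abs_le_iff)
  have "(1 - \<epsilon>) * exp_mean u \<le> exp_mean s"
  proof (cases "s \<le> u")
    case True
    have "(1 - \<epsilon>) * exp_mean u \<le> 1 * exp_mean s"
      using e hs hu exp_mean_antimono[OF s True] by (intro mult_mono) auto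
    then show ?thesis by simp
  next
    case False
    have "(1 - \<epsilon>) * s * exp_mean u \<le> u * exp_mean u" using b hu by (intro mult_right_mono) auto
    also have "\<dots> \<le> s * exp_mean s" using exp_mean_mono_scaled[OF u(1)] False by simp
    finally have "s * ((1 - \<epsilon>) * exp_mean u) \<le> s * exp_mean s" by (simp add: mult_ac)
    then show ?thesis using s by simp
  qed
  then show "exp_mean u \<le> exp_mean s / (1 - \<epsilon>)" using e by (simp add: field_simps)
  have "exp_mean s \<le> (1 + \<epsilon>) * exp_mean u"
  proof (cases "s \<le> u")
    case False
    have "1 * exp_mean s \<le> (1 + \<epsilon>) * exp_mean u"
      using e hs hu exp_mean_antimono[OF u(1)] False by (intro mult_mono) auto
    then show ?thesis by simp
  next
    case True
    have "s * exp_mean s \<le> u * exp_mean u" using exp_mean_mono_scaled[OF s True] .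
    also have "\<dots> \<le> (1 + \<epsilon>) * s * exp_mean u" using b hu by (intro mult_right_mono) auto
    finally have "s * exp_mean s \<le> s * ((1 + \<epsilon>) * exp_mean u)" by (simp add: mult_ac)
    then show ?thesis using s by simp
  qed
  then show "exp_mean s / (1 + \<epsilon>) \<le> exp_mean u" using e by (simp add: field_simps)
qed

lemma second_moment_integral:
  assumes u: "u > 0"
  shows "(\<integral>t. exp (- (u * t)) * (u * t)\<^sup>2 \<partial>unit_lebesgue) = exp_mean u * second_moment u"
proof -
  let ?F = "\<lambda>t. - (exp (- (u * t)) * ((u * t)\<^sup>2 + 2 * (u * t) + 2)) / u"
  have "(?F has_real_derivative exp (- (u * t)) * (u * t)\<^sup>2) (at t)" for t
  proof -
    have "(?F has_real_derivative
        - ((exp (- (u * t)) * (- u)) * ((u * t)\<^sup>2 + 2 * (u * t) + 2) + exp (- (u * t)) * (2 * (u * t) * u + 2 * u)) / u) (at t)"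
      by (auto intro!: derivative_eq_intros simp: power2_eq_square algebra_simps)
    also have "- ((exp (- (u * t)) * (- u)) * ((u * t)\<^sup>2 + 2 * (u * t) + 2) + exp (- (u * t)) * (2 * (u * t) * u + 2 * u)) / u
       = exp (- (u * t)) * (u * t)\<^sup>2"
      using u by (simp add: field_simps)
    finally show ?thesis .
  qed
  then have "(\<integral>t. exp (- (u * t)) * (u * t)\<^sup>2 \<partial>unit_lebesgue) = ?F 1 - ?F 0"
    by (intro integral_unit_lebesgue) auto
  also have "\<dots> = (2 * (1 - exp (- u)) - exp (- u) * (u\<^sup>2 + 2 * u)) / u"
    using u by (simp add: field_simps)
  also have "\<dots> = exp_mean u * second_moment u"
  proof -
    have e: "(1 - exp (- u)) / (exp u - 1) = exp (- u)" using u by (simp add: exp_minus field_simps)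
    have "exp_mean u * second_moment u
       = (2 * (1 - exp (- u)) - (1 - exp (- u)) / (exp u - 1) * (u\<^sup>2 + 2 * u)) / u"
    proof -
      have "a / u * (2 - q / c) = (2 * a - a / c * q) / u" for a c q :: real
        by (simp add: right_diff_distrib diff_divide_distrib mult_ac)
      then show ?thesis unfolding exp_mean_def second_moment_def .
    qed
    then show ?thesis unfolding e by simp
  qed
  finally show ?thesis .
qed

text \<open>Half of the exponent absorbs the power, as (z/8)^4 \<le> e^(z/2) and 8^4 = 4096; the
  other half leaves \<open>exp_mean (u / 2)\<close>, at most twice \<open>exp_mean u\<close>. The
  bound has to be proportional to \<open>exp_mean u\<close>, the normalising constant of the
  truncated law.\<close>

lemma fourth_moment_bound:
  assumes u: "u > 0"
  shows "(\<integral>t. exp (- (u * t)) * (u * t) ^ 4 \<partial>unit_lebesgue) \<le> 8192 * exp_mean u"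
proof -
  have pw: "exp (- z) * z ^ 4 \<le> 4096 * exp (- (z / 2))" if "z \<ge> 0" for z :: real
  proof -
    have "(z / 8) ^ 4 \<le> (1 + (z / 2) / real 4) ^ 4" using that by (intro power_mono) auto
    also have "\<dots> \<le> exp (z / 2)" using that by (intro exp_ge_one_plus_x_over_n_power_n) auto
    finally have "z ^ 4 \<le> 4096 * exp (z / 2)" by (simp add: power_divide)
    then have "exp (- z) * z ^ 4 \<le> exp (- z) * (4096 * exp (z / 2))" by (intro mult_left_mono) auto
    also have "\<dots> = 4096 * exp (- (z / 2))" by (simp add: exp_add[symmetric])
    finally show ?thesis .
  qed
  have "(\<integral>t. exp (- (u * t)) * (u * t) ^ 4 \<partial>unit_lebesgue) \<le> (\<integral>t. 4096 * exp (- (u / 2 * t)) \<partial>unit_lebesgue)"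
    using u pw[of "u * t" for t]
    by (intro Bochner_Integration.integral_mono) (auto intro!: integrable_unit_lebesgue continuous_intros)
  also have "\<dots> = 4096 * exp_mean (u / 2)" using u by (simp add: exp_mean_integral[of "u / 2", simplified])
  also have "\<dots> \<le> 8192 * exp_mean u"
    using u by (simp add: exp_mean_def divide_right_mono)
  finally show ?thesis .
qed

section \<open>The joint measure of u and y\<close>

lemma coordinate_measurable:
  assumes "j \<in> {1..n}"
  shows "(\<lambda>y. y j) \<in> borel_measurable (unit_cube n)"
proof -
  have "(\<lambda>y. y j) \<in> measurable (unit_cube n) unit_lebesgue"
    using assms by (rule measurable_component_singleton)
  then show ?thesis by (rule measurable_compose) (rule measurable_unit_lebesgue, simp)
qed

lemma unit_cube_bounds:
  assumes "y \<in> space (unit_cube n)" "j \<in> {1..n}"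
  shows "0 \<le> y j \<and> y j \<le> 1"
  using assms by (auto simp: space_PiM PiE_iff)

interpretation unit_cube: prob_space "unit_cube n" for n
  by (rule prob_space_unit_cube)

interpretation mix: pair_sigma_finite "lborel :: real measure" "unit_cube n" for n
  by standard

text \<open>(n+d)!/d! is the number of matchings, and (n-1)! cancels the Gamma integral that
  produces A^(-n).\<close>

definition mix_const :: "nat \<Rightarrow> nat \<Rightarrow> real" where
  "mix_const n d = fact (n + d) / (fact d * fact (n - 1))"

definition mix_weight :: "nat \<Rightarrow> nat \<Rightarrow> real \<Rightarrow> (nat \<Rightarrow> real) \<Rightarrow> real" where
  "mix_weight n d u y = (if 0 < u then mix_const n d * u ^ (n - 1) * exp (- (u * (d + (\<Sum>j\<in>{1..n}. y j)))) else 0)"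

definition mix_measure :: "nat \<Rightarrow> nat \<Rightarrow> (real \<times> (nat \<Rightarrow> real)) measure" where
  "mix_measure n d = density (lborel \<Otimes>\<^sub>M unit_cube n) (\<lambda>(u, y). ennreal (mix_weight n d u y))"

lemma mix_const_pos: "mix_const n d > 0" by (simp add: mix_const_def)

lemma snd_coordinate_measurable:
  assumes "j \<in> {1..n}"
  shows "(\<lambda>z. snd z j) \<in> borel_measurable (lborel \<Otimes>\<^sub>M unit_cube n)"
  by (rule measurable_compose[OF measurable_snd coordinate_measurable[OF assms]])

lemma mix_weight_measurable:
  "(\<lambda>(u, y). ennreal (mix_weight n d u y)) \<in> borel_measurable (lborel \<Otimes>\<^sub>M unit_cube n)"
proof -
  have [measurable]: "(\<lambda>z. \<Sum>j\<in>{1..n}. snd z j) \<in> borel_measurable (lborel \<Otimes>\<^sub>M unit_cube n)"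
    by (intro borel_measurable_sum snd_coordinate_measurable)
  have "(\<lambda>z. ennreal (mix_weight n d (fst z) (snd z))) \<in> borel_measurable (lborel \<Otimes>\<^sub>M unit_cube n)"
    unfolding mix_weight_def by measurable
  then show ?thesis by (simp add: case_prod_unfold)
qed

lemma sets_mix_measure [measurable_cong]: "sets (mix_measure n d) = sets (lborel \<Otimes>\<^sub>M unit_cube n)"
  by (simp add: mix_measure_def)

lemma space_mix_measure: "space (mix_measure n d) = UNIV \<times> space (unit_cube n)"
  by (simp add: mix_measure_def space_pair_measure)

lemma
  assumes [measurable]: "f \<in> borel_measurable (lborel \<Otimes>\<^sub>M unit_cube n)"
  shows nn_integral_mix_cube_first: "(\<integral>\<^sup>+z. f z \<partial>mix_measure n d)
      = (\<integral>\<^sup>+u. \<integral>\<^sup>+y. ennreal (mix_weight n d u y) * f (u, y) \<partial>unit_cube n \<partial>lborel)"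
    and nn_integral_mix_line_first: "(\<integral>\<^sup>+z. f z \<partial>mix_measure n d)
      = (\<integral>\<^sup>+y. \<integral>\<^sup>+u. ennreal (mix_weight n d u y) * f (u, y) \<partial>lborel \<partial>unit_cube n)"
proof -
  let ?g = "\<lambda>z. (case z of (u, y) \<Rightarrow> ennreal (mix_weight n d u y)) * f z"
  have m: "?g \<in> borel_measurable (lborel \<Otimes>\<^sub>M unit_cube n)"
    by (rule borel_measurable_times_ennreal[OF mix_weight_measurable assms])
  have "(\<integral>\<^sup>+z. f z \<partial>mix_measure n d) = integral\<^sup>N (lborel \<Otimes>\<^sub>M unit_cube n) ?g"
    unfolding mix_measure_def by (rule nn_integral_density[OF mix_weight_measurable assms])
  then show "(\<integral>\<^sup>+z. f z \<partial>mix_measure n d)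
      = (\<integral>\<^sup>+u. \<integral>\<^sup>+y. ennreal (mix_weight n d u y) * f (u, y) \<partial>unit_cube n \<partial>lborel)"
    and "(\<integral>\<^sup>+z. f z \<partial>mix_measure n d)
      = (\<integral>\<^sup>+y. \<integral>\<^sup>+u. ennreal (mix_weight n d u y) * f (u, y) \<partial>lborel \<partial>unit_cube n)"
    using unit_cube.nn_integral_fst[OF m] mix.nn_integral_snd[OF m] by simp_all
qed

lemma cube_exp_integral:
  assumes u: "u > 0"
  shows "(\<integral>\<^sup>+y. ennreal (exp (- (u * (\<Sum>j\<in>{1..n}. y j)))) \<partial>unit_cube n) = ennreal (exp_mean u ^ n)"
proof -
  have eq: "exp (- (u * (\<Sum>j\<in>{1..n}. y j))) = (\<Prod>j\<in>{1..n}. exp (- (u * y j)))" for y :: "nat \<Rightarrow> real"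
    by (simp add: exp_sum[symmetric] sum_negf sum_distrib_left)
  have cont: "continuous_on {0..1} (\<lambda>t. exp (- (u * t)))" by (intro continuous_intros)
  have int: "integrable (unit_cube n) (\<lambda>y. \<Prod>j\<in>{1..n}. exp (- (u * y j)))"
    and val: "(\<integral>y. (\<Prod>j\<in>{1..n}. exp (- (u * y j))) \<partial>unit_cube n) = exp_mean u ^ n"
    using integral_prod_unit_cube[of n "\<lambda>_ t. exp (- (u * t))"] exp_mean_integral[OF u] cont by auto
  show ?thesis unfolding eq
    by (subst nn_integral_eq_integral[OF int], rule AE_I2, rule prod_nonneg, simp, simp only: val)
qed

text \<open>Integrating out y leaves u^(n-1) \<open>exp_mean u\<close>^n. The power of u cancels n -
  1 denominators, which gives the Beta-type weight (1 - e^(-u))^(n-1), and a single factor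
  \<open>exp_mean u\<close> is left over.\<close>

lemma nn_integral_mix_fst:
  fixes \<phi> :: "real \<Rightarrow> real"
  assumes \<phi>: "\<phi> \<in> borel_measurable borel" "\<And>u. u > 0 \<Longrightarrow> \<phi> u \<ge> 0" and n: "n \<ge> 1"
  shows "(\<integral>\<^sup>+z. ennreal (\<phi> (fst z)) \<partial>mix_measure n d)
     = (\<integral>\<^sup>+u. ennreal (mix_const n d * (indicator {0<..} u * (exp (- (d * u)) * (1 - exp (- u)) ^ (n - 1))) * (exp_mean u * \<phi> u)) \<partial>lborel)"
proof -
  have "(\<integral>\<^sup>+z. ennreal (\<phi> (fst z)) \<partial>mix_measure n d)
     = (\<integral>\<^sup>+u. \<integral>\<^sup>+y. ennreal (mix_weight n d u y) * ennreal (\<phi> u) \<partial>unit_cube n \<partial>lborel)"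
    using nn_integral_mix_cube_first[of "\<lambda>z. ennreal (\<phi> (fst z))" n d] \<phi>(1) by simp
  also have "\<dots> = (\<integral>\<^sup>+u. ennreal (mix_const n d * (indicator {0<..} u * (exp (- (d * u)) * (1 - exp (- u)) ^ (n - 1))) * (exp_mean u * \<phi> u)) \<partial>lborel)"
  proof (rule nn_integral_cong)
    fix u :: real
    show "(\<integral>\<^sup>+y. ennreal (mix_weight n d u y) * ennreal (\<phi> u) \<partial>unit_cube n)
      = ennreal (mix_const n d * (indicator {0<..} u * (exp (- (d * u)) * (1 - exp (- u)) ^ (n - 1))) * (exp_mean u * \<phi> u))"
    proof (cases "u > 0")
      case True
      let ?c = "mix_const n d * u ^ (n - 1) * exp (- (u * d)) * \<phi> u"
      have c: "?c \<ge> 0" using True mix_const_pos[of n d] \<phi>(2)[OF True] by simp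
      have "(\<integral>\<^sup>+y. ennreal (mix_weight n d u y) * ennreal (\<phi> u) \<partial>unit_cube n)
         = (\<integral>\<^sup>+y. ennreal ?c * ennreal (exp (- (u * (\<Sum>j\<in>{1..n}. y j)))) \<partial>unit_cube n)"
      proof (rule nn_integral_cong)
        fix y :: "nat \<Rightarrow> real"
        have *: "mix_weight n d u y * \<phi> u = ?c * exp (- (u * (\<Sum>j\<in>{1..n}. y j)))"
          using True by (simp add: mix_weight_def distrib_left exp_diff exp_minus exp_add field_simps)
        show "ennreal (mix_weight n d u y) * ennreal (\<phi> u) = ennreal ?c * ennreal (exp (- (u * (\<Sum>j\<in>{1..n}. y j))))"
          by (simp only: ennreal_mult''[OF \<phi>(2)[OF True], symmetric] ennreal_mult''[OF exp_ge_zero, symmetric] *)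
      qed
      also have "\<dots> = ennreal ?c * ennreal (exp_mean u ^ n)"
      proof (subst nn_integral_cmult)
        have [measurable]: "(\<lambda>y. \<Sum>j\<in>{1..n}. y j) \<in> borel_measurable (unit_cube n)"
          by (intro borel_measurable_sum coordinate_measurable)
        show "(\<lambda>y. ennreal (exp (- (u * (\<Sum>j\<in>{1..n}. y j))))) \<in> borel_measurable (unit_cube n)"
          by measurable
      qed (simp only: cube_exp_integral[OF True])
      also have "\<dots> = ennreal (?c * exp_mean u ^ n)"
        using exp_mean_pos[OF True] by (intro ennreal_mult''[symmetric]) simp
      also have "exp_mean u ^ n = exp_mean u * ((1 - exp (- u)) / u) ^ (n - 1)"
        using n by (cases n) (auto simp: exp_mean_def)
      finally show ?thesis using True by (simp add: power_divide mult_ac)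
    qed (simp add: mix_weight_def)
  qed
  finally show ?thesis .
qed


text \<open>A variance bound: for fixed u the (u y_j)^2 are independent with mean
  \<open>second_moment u\<close>, so the mean square of their averaged deviation is 1/n times one
  variance, which the fourth moment bounds. The law is not normalised, hence the factor
  \<open>exp_mean u ^ n\<close>.\<close>

lemma nn_integral_cube_second_moment:
  assumes u: "u > 0" and n: "n \<ge> 1"
  shows "(\<integral>\<^sup>+y. ennreal (exp (- (u * (\<Sum>j\<in>{1..n}. y j))) * (u\<^sup>2 * (\<Sum>j\<in>{1..n}. (y j)\<^sup>2) / n - second_moment u)\<^sup>2) \<partial>unit_cube n)
    \<le> ennreal (8192 / n * exp_mean u ^ n)"
proof -
  let ?N = "{1..n}" and ?h = "exp_mean u"
  define f where "f t = (u * t)\<^sup>2 - second_moment u" for t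
  \<comment> \<open>The k-th factor of e^(-u \<Sum> y) f(y_i) f(y_j) as a product over all
    coordinates; if i = j, then f occurs twice at k = i.\<close>
  define g where "g i j k t = exp (- (u * t)) * ((if k = i then f t else 1) * (if k = j then f t else 1))"
    for i j k :: nat and t
  have cont_if: "continuous_on {0..1} (\<lambda>t. if b then f t else 1)" for b
    by (cases b) (auto simp: f_def intro!: continuous_intros)
  have cont: "continuous_on {0..1} (g i j k)" for i j k
    unfolding g_def by (intro continuous_intros cont_if)
  have int: "integrable (unit_cube n) (\<lambda>y. \<Prod>k\<in>?N. g i j k (y k))"
    and val: "(\<integral>y. (\<Prod>k\<in>?N. g i j k (y k)) \<partial>unit_cube n) = (\<Prod>k\<in>?N. \<integral>t. g i j k t \<partial>unit_lebesgue)" for i j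
    using integral_prod_unit_cube[of n "g i j"] cont by auto
  have pointwise: "exp (- (u * (\<Sum>j\<in>?N. y j))) * (u\<^sup>2 * (\<Sum>j\<in>?N. (y j)\<^sup>2) / n - second_moment u)\<^sup>2
      = 1 / (real n)\<^sup>2 * (\<Sum>i\<in>?N. \<Sum>j\<in>?N. \<Prod>k\<in>?N. g i j k (y k))" for y :: "nat \<Rightarrow> real"
  proof -
    have "(\<Prod>k\<in>?N. g i j k (y k)) = exp (- (u * (\<Sum>j\<in>?N. y j))) * (f (y i) * f (y j))"
      if "i \<in> ?N" "j \<in> ?N" for i j
      unfolding g_def prod.distrib using that
      by (simp add: exp_sum[symmetric] sum_negf sum_distrib_left)
    then have "(\<Sum>i\<in>?N. \<Sum>j\<in>?N. \<Prod>k\<in>?N. g i j k (y k))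
       = (\<Sum>i\<in>?N. \<Sum>j\<in>?N. exp (- (u * (\<Sum>j\<in>?N. y j))) * (f (y i) * f (y j)))"
      by (intro sum.cong refl)
    also have "\<dots> = exp (- (u * (\<Sum>j\<in>?N. y j))) * (\<Sum>i\<in>?N. f (y i))\<^sup>2"
      by (simp only: power2_eq_square sum_product sum_distrib_left[symmetric])
    finally have "(\<Sum>i\<in>?N. \<Sum>j\<in>?N. \<Prod>k\<in>?N. g i j k (y k))
       = exp (- (u * (\<Sum>j\<in>?N. y j))) * (\<Sum>i\<in>?N. f (y i))\<^sup>2" .
    moreover have "u\<^sup>2 * (\<Sum>j\<in>?N. (y j)\<^sup>2) / n - second_moment u = (\<Sum>i\<in>?N. f (y i)) / n"
      using n by (simp add: f_def sum_subtractf sum_distrib_left power_mult_distrib diff_divide_distrib)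
    ultimately show ?thesis by (simp add: power_divide)
  qed
  have i0: "integrable unit_lebesgue (\<lambda>t. exp (- (u * t)))" "integrable unit_lebesgue (\<lambda>t. exp (- (u * t)) * (u * t)\<^sup>2)"
    "integrable unit_lebesgue (\<lambda>t. exp (- (u * t)) * (u * t) ^ 4)"
    by (intro integrable_unit_lebesgue continuous_intros)+
  have int_f: "(\<integral>t. exp (- (u * t)) * f t \<partial>unit_lebesgue) = 0"
  proof -
    have "(\<integral>t. exp (- (u * t)) * f t \<partial>unit_lebesgue)
      = (\<integral>t. exp (- (u * t)) * (u * t)\<^sup>2 - second_moment u * exp (- (u * t)) \<partial>unit_lebesgue)"
      by (simp add: f_def algebra_simps)
    also have "\<dots> = 0" using i0 by (simp add: exp_mean_integral[OF u] second_moment_integral[OF u])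
    finally show ?thesis .
  qed
  have int_f2: "(\<integral>t. exp (- (u * t)) * (f t * f t) \<partial>unit_lebesgue) \<le> 8192 * ?h"
  proof -
    have "(\<integral>t. exp (- (u * t)) * (f t * f t) \<partial>unit_lebesgue)
      = (\<integral>t. exp (- (u * t)) * (u * t) ^ 4 - 2 * second_moment u * (exp (- (u * t)) * (u * t)\<^sup>2)
           + (second_moment u)\<^sup>2 * exp (- (u * t)) \<partial>unit_lebesgue)"
      by (intro Bochner_Integration.integral_cong) (auto simp: f_def algebra_simps power2_eq_square power4_eq_xxxx)
    also have "\<dots> = (\<integral>t. exp (- (u * t)) * (u * t) ^ 4 \<partial>unit_lebesgue)
        - 2 * second_moment u * (?h * second_moment u) + (second_moment u)\<^sup>2 * ?h"
      using i0 by (simp add: exp_mean_integral[OF u] second_moment_integral[OF u])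
    also have "\<dots> = (\<integral>t. exp (- (u * t)) * (u * t) ^ 4 \<partial>unit_lebesgue) - ?h * (second_moment u)\<^sup>2"
      by (simp add: power2_eq_square)
    also have "\<dots> \<le> 8192 * ?h"
    proof -
      have "0 \<le> ?h * (second_moment u)\<^sup>2" using exp_mean_pos[OF u] by simp
      then show ?thesis using fourth_moment_bound[OF u] by linarith
    qed
    finally show ?thesis .
  qed
  have g_off: "(\<Prod>k\<in>?N. \<integral>t. g i j k t \<partial>unit_lebesgue) = 0" if "i \<in> ?N" "i \<noteq> j" for i j
  proof (rule prod_zero)
    show "\<exists>k\<in>?N. (\<integral>t. g i j k t \<partial>unit_lebesgue) = 0"
      using that int_f by (intro bexI[of _ i]) (auto simp: g_def)
  qed simp
  have g_diag: "(\<Prod>k\<in>?N. \<integral>t. g i i k t \<partial>unit_lebesgue) \<le> 8192 * ?h ^ n" if i: "i \<in> ?N" for i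
  proof -
    have "(\<Prod>k\<in>?N. \<integral>t. g i i k t \<partial>unit_lebesgue)
      = (\<integral>t. exp (- (u * t)) * (f t * f t) \<partial>unit_lebesgue) * (\<Prod>k\<in>?N - {i}. \<integral>t. g i i k t \<partial>unit_lebesgue)"
    proof -
      have "g i i i t = exp (- (u * t)) * (f t * f t)" for t by (simp add: g_def)
      then show ?thesis
        using prod.remove[OF _ i, of "\<lambda>k. \<integral>t. g i i k t \<partial>unit_lebesgue"] by simp
    qed
    also have "(\<Prod>k\<in>?N - {i}. \<integral>t. g i i k t \<partial>unit_lebesgue) = (\<Prod>k\<in>?N - {i}. ?h)"
      by (intro prod.cong refl) (auto simp: g_def exp_mean_integral[OF u])
    also have "\<dots> = ?h ^ (n - 1)" using i by simp
    also have "(\<integral>t. exp (- (u * t)) * (f t * f t) \<partial>unit_lebesgue) * ?h ^ (n - 1) \<le> (8192 * ?h) * ?h ^ (n - 1)"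
      using int_f2 exp_mean_pos[OF u] by (intro mult_right_mono) auto
    also have "\<dots> = 8192 * ?h ^ n" using n by (cases n) auto
    finally show ?thesis .
  qed
  have "(\<integral>\<^sup>+y. ennreal (exp (- (u * (\<Sum>j\<in>?N. y j))) * (u\<^sup>2 * (\<Sum>j\<in>?N. (y j)\<^sup>2) / n - second_moment u)\<^sup>2) \<partial>unit_cube n)
     = ennreal (\<integral>y. exp (- (u * (\<Sum>j\<in>?N. y j))) * (u\<^sup>2 * (\<Sum>j\<in>?N. (y j)\<^sup>2) / n - second_moment u)\<^sup>2 \<partial>unit_cube n)"
  proof (rule nn_integral_eq_integral)
    show "integrable (unit_cube n) (\<lambda>y. exp (- (u * (\<Sum>j\<in>?N. y j))) * (u\<^sup>2 * (\<Sum>j\<in>?N. (y j)\<^sup>2) / n - second_moment u)\<^sup>2)"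
      unfolding pointwise by (intro integrable_mult_right Bochner_Integration.integrable_sum int)
  qed simp
  also have "(\<integral>y. exp (- (u * (\<Sum>j\<in>?N. y j))) * (u\<^sup>2 * (\<Sum>j\<in>?N. (y j)\<^sup>2) / n - second_moment u)\<^sup>2 \<partial>unit_cube n)
     = 1 / (real n)\<^sup>2 * (\<integral>y. (\<Sum>i\<in>?N. \<Sum>j\<in>?N. \<Prod>k\<in>?N. g i j k (y k)) \<partial>unit_cube n)"
    unfolding pointwise by (rule integral_mult_right_zero)
  also have "(\<integral>y. (\<Sum>i\<in>?N. \<Sum>j\<in>?N. \<Prod>k\<in>?N. g i j k (y k)) \<partial>unit_cube n)
     = (\<Sum>i\<in>?N. \<integral>y. (\<Sum>j\<in>?N. \<Prod>k\<in>?N. g i j k (y k)) \<partial>unit_cube n)"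
    by (intro Bochner_Integration.integral_sum Bochner_Integration.integrable_sum int)
  also have "\<dots> = (\<Sum>i\<in>?N. \<Sum>j\<in>?N. \<integral>y. (\<Prod>k\<in>?N. g i j k (y k)) \<partial>unit_cube n)"
    by (intro sum.cong refl Bochner_Integration.integral_sum int)
  also have "\<dots> = (\<Sum>i\<in>?N. \<Prod>k\<in>?N. \<integral>t. g i i k t \<partial>unit_lebesgue)"
  proof (rule sum.cong[OF refl])
    fix i assume i: "i \<in> ?N"
    have "(\<Sum>j\<in>?N. \<integral>y. (\<Prod>k\<in>?N. g i j k (y k)) \<partial>unit_cube n)
      = (\<Sum>j\<in>?N. if j = i then (\<Prod>k\<in>?N. \<integral>t. g i i k t \<partial>unit_lebesgue) else 0)"
      unfolding val using g_off[OF i] by (intro sum.cong refl) auto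
    then show "(\<Sum>j\<in>?N. \<integral>y. (\<Prod>k\<in>?N. g i j k (y k)) \<partial>unit_cube n) = (\<Prod>k\<in>?N. \<integral>t. g i i k t \<partial>unit_lebesgue)"
      using i by simp
  qed
  also have "ennreal (1 / (real n)\<^sup>2 * (\<Sum>i\<in>?N. \<Prod>k\<in>?N. \<integral>t. g i i k t \<partial>unit_lebesgue)) \<le> ennreal (8192 / n * ?h ^ n)"
  proof (rule ennreal_leI)
    have "(\<Sum>i\<in>?N. \<Prod>k\<in>?N. \<integral>t. g i i k t \<partial>unit_lebesgue) \<le> (\<Sum>i\<in>?N. 8192 * ?h ^ n)"
      by (rule sum_mono) (rule g_diag)
    then have "1 / (real n)\<^sup>2 * (\<Sum>i\<in>?N. \<Prod>k\<in>?N. \<integral>t. g i i k t \<partial>unit_lebesgue) \<le> 1 / (real n)\<^sup>2 * (n * (8192 * ?h ^ n))"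
      by (intro mult_left_mono) auto
    also have "\<dots> = 8192 / n * ?h ^ n" using n by (simp add: power2_eq_square)
    finally show "1 / (real n)\<^sup>2 * (\<Sum>i\<in>?N. \<Prod>k\<in>?N. \<integral>t. g i i k t \<partial>unit_lebesgue) \<le> 8192 / n * ?h ^ n" .
  qed
  finally show ?thesis .
qed

lemma nn_integral_has_bochner_integral:
  fixes f :: "'a \<Rightarrow> real"
  assumes "has_bochner_integral M f v" "AE x in M. 0 \<le> f x"
  shows "(\<integral>\<^sup>+x. ennreal (f x) \<partial>M) = ennreal v"
  using assms nn_integral_eq_integral[of M f] by (auto simp: has_bochner_integral_iff)

text \<open>Up to normalisation u A has the Gamma(n) law, with mean and variance n, so (u A/n - 1)^2
  has mean 1/n. The ranges 0 < u and 0 \<le> u differ by a null set.\<close>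

lemma nn_integral_gamma:
  fixes A c :: real
  assumes A: "A > 0" and c: "c \<ge> 0" and n: "n \<ge> 1"
  shows "(\<integral>\<^sup>+u. ennreal (if 0 < u then c * u ^ (n - 1) * exp (- (u * A)) else 0) \<partial>lborel)
      = ennreal (c * (fact (n - 1) / A ^ n))"
    and "(\<integral>\<^sup>+u. ennreal (if 0 < u then c * u ^ (n - 1) * exp (- (u * A)) else 0) * ennreal ((u * A / n - 1)\<^sup>2) \<partial>lborel)
      = ennreal (1 / n) * ennreal (c * (fact (n - 1) / A ^ n))"
proof -
  let ?m = "\<lambda>k u. indicator {0..} u * (u ^ k * exp (- (A * u))) :: real"
  have ne: "AE u in lborel. u \<noteq> (0::real)" by (rule AE_lborel_singleton)
  have "has_bochner_integral lborel (\<lambda>u. c * ?m (n - 1) u) (c * (fact (n - 1) / A ^ (n - 1 + 1)))"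
    by (intro has_bochner_integral_mult_right halfline_moment A)
  from nn_integral_has_bochner_integral[OF this]
  have "(\<integral>\<^sup>+u. ennreal (c * ?m (n - 1) u) \<partial>lborel) = ennreal (c * (fact (n - 1) / A ^ n))"
    using c n by (auto simp: indicator_def)
  moreover have "(\<integral>\<^sup>+u. ennreal (if 0 < u then c * u ^ (n - 1) * exp (- (u * A)) else 0) \<partial>lborel)
     = (\<integral>\<^sup>+u. ennreal (c * ?m (n - 1) u) \<partial>lborel)"
    by (rule nn_integral_cong_AE) (use ne in eventually_elim, auto simp: indicator_def mult_ac)
  ultimately show "(\<integral>\<^sup>+u. ennreal (if 0 < u then c * u ^ (n - 1) * exp (- (u * A)) else 0) \<partial>lborel)
      = ennreal (c * (fact (n - 1) / A ^ n))" by simp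
  let ?f = "\<lambda>u. c * (A\<^sup>2 / (real n)\<^sup>2 * ?m (n + 1) u - 2 * A / n * ?m n u + ?m (n - 1) u)"
  have f_eq: "?f u = indicator {0..} u * (c * u ^ (n - 1) * exp (- (A * u)) * (u * A / n - 1)\<^sup>2)" for u
  proof -
    have "u ^ (n + 1) = u ^ (n - 1) * u\<^sup>2" "u ^ n = u ^ (n - 1) * u"
      using n by (auto simp: power_add[symmetric] power_Suc2[symmetric] simp del: power_Suc)
    then show ?thesis using n
      by (simp only:) (simp add: power2_eq_square field_simps)
  qed
  have "has_bochner_integral lborel ?f
     (c * (A\<^sup>2 / (real n)\<^sup>2 * (fact (n + 1) / A ^ (n + 1 + 1)) - 2 * A / n * (fact n / A ^ (n + 1)) + fact (n - 1) / A ^ (n - 1 + 1)))"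
    by (intro has_bochner_integral_mult_right has_bochner_integral_add has_bochner_integral_diff halfline_moment A)
  also have "c * (A\<^sup>2 / (real n)\<^sup>2 * (fact (n + 1) / A ^ (n + 1 + 1)) - 2 * A / n * (fact n / A ^ (n + 1)) + fact (n - 1) / A ^ (n - 1 + 1))
     = 1 / n * (c * (fact (n - 1) / A ^ n))"
  proof -
    have f: "fact n = real n * fact (n - 1)" "fact (n + 1) = (real n + 1) * (real n * fact (n - 1))"
      using n fact_reduce[of n, where ?'a = real] by auto
    define x where "x = fact (n - 1) / A ^ n"
    have "A\<^sup>2 / (real n)\<^sup>2 * (fact (n + 1) / A ^ (n + 1 + 1)) = (real n + 1) / n * x"
      unfolding f x_def using A n by (simp add: power2_eq_square field_simps)
    also have "(real n + 1) / n = 1 + 1 / n" using n by (simp add: field_simps)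
    finally have h1: "A\<^sup>2 / (real n)\<^sup>2 * (fact (n + 1) / A ^ (n + 1 + 1)) = (1 + 1 / n) * x" .
    have h2: "2 * A / n * (fact n / A ^ (n + 1)) = 2 * x"
      unfolding f x_def using A n by simp
    have h3: "fact (n - 1) / A ^ (n - 1 + 1) = x" using n by (simp add: x_def)
    show ?thesis unfolding h1 h2 h3 unfolding x_def[symmetric] by (simp add: algebra_simps)
  qed
  finally have "has_bochner_integral lborel ?f (1 / n * (c * (fact (n - 1) / A ^ n)))" .
  from nn_integral_has_bochner_integral[OF this]
  have "(\<integral>\<^sup>+u. ennreal (?f u) \<partial>lborel) = ennreal (1 / n * (c * (fact (n - 1) / A ^ n)))"
    unfolding f_eq using c by (auto simp: indicator_def)
  moreover have "(\<integral>\<^sup>+u. ennreal (if 0 < u then c * u ^ (n - 1) * exp (- (u * A)) else 0) * ennreal ((u * A / n - 1)\<^sup>2) \<partial>lborel)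
     = (\<integral>\<^sup>+u. ennreal (?f u) \<partial>lborel)"
    unfolding f_eq ennreal_mult''[OF zero_le_power2, symmetric]
    by (rule nn_integral_cong_AE) (use ne in eventually_elim, auto simp: indicator_def mult_ac)
  ultimately show "(\<integral>\<^sup>+u. ennreal (if 0 < u then c * u ^ (n - 1) * exp (- (u * A)) else 0) * ennreal ((u * A / n - 1)\<^sup>2) \<partial>lborel)
      = ennreal (1 / n) * ennreal (c * (fact (n - 1) / A ^ n))"
    using A c by (simp add: ennreal_mult'[symmetric])
qed

lemma cube_sum_measurable:
  "(\<lambda>y. \<Sum>j\<in>{1..n}. y j) \<in> borel_measurable (unit_cube n)"
  "(\<lambda>y. \<Sum>j\<in>{1..n}. (y j)\<^sup>2) \<in> borel_measurable (unit_cube n)"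
  by (intro borel_measurable_sum borel_measurable_power coordinate_measurable; assumption)+

lemma pair_sum_measurable:
  "(\<lambda>z. \<Sum>j\<in>{1..n}. snd z j) \<in> borel_measurable (lborel \<Otimes>\<^sub>M unit_cube n)"
  "(\<lambda>z. \<Sum>j\<in>{1..n}. (snd z j)\<^sup>2) \<in> borel_measurable (lborel \<Otimes>\<^sub>M unit_cube n)"
  by (intro borel_measurable_sum borel_measurable_power snd_coordinate_measurable; assumption)+

lemma scaled_gap_measurable:
  "(\<lambda>z. ennreal ((fst z * (d + (\<Sum>j\<in>{1..n}. snd z j)) / n - 1)\<^sup>2)) \<in> borel_measurable (lborel \<Otimes>\<^sub>M unit_cube n)"
proof -
  note pair_sum_measurable[measurable]
  show ?thesis by measurable
qed

lemma second_moment_gap_measurable: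
  "(\<lambda>z. ennreal (((fst z)\<^sup>2 * (\<Sum>j\<in>{1..n}. (snd z j)\<^sup>2) / n - second_moment (fst z))\<^sup>2))
    \<in> borel_measurable (lborel \<Otimes>\<^sub>M unit_cube n)"
proof -
  note pair_sum_measurable[measurable]
  show ?thesis unfolding second_moment_def by measurable
qed

lemma prod_man_integral_measurable:
  "(\<lambda>y. \<Prod>i\<in>{1..n}. man_integral n d y i) \<in> borel_measurable (unit_cube n)"
  unfolding man_integral_eq_sum
proof (intro borel_measurable_prod borel_measurable_sum borel_measurable_times borel_measurable_const)
  fix i Z j assume "j \<in> {1..n} - {i}"
  then have "(\<lambda>y. y j) \<in> borel_measurable (unit_cube n)" by (intro coordinate_measurable) auto
  then show "(\<lambda>y. if j \<in> Z then y j else 1 - y j) \<in> borel_measurable (unit_cube n)"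
    by (cases "j \<in> Z") auto
qed

lemma scaled_prod_measurable:
  "(\<lambda>z. ennreal ((d + (\<Sum>j\<in>{1..n}. snd z j)) ^ n * (\<Prod>i\<in>{1..n}. man_integral n d (snd z) i)))
    \<in> borel_measurable (lborel \<Otimes>\<^sub>M unit_cube n)"
proof -
  note pair_sum_measurable[measurable]
  have [measurable]: "(\<lambda>z. \<Prod>i\<in>{1..n}. man_integral n d (snd z) i) \<in> borel_measurable (lborel \<Otimes>\<^sub>M unit_cube n)"
    by (rule measurable_compose[OF measurable_snd prod_man_integral_measurable])
  show ?thesis by measurable
qed

text \<open>The line is integrated first: the inner integral is 1/n times the inner mass for every
  y.\<close>

lemma nn_integral_mix_scaled_gap:
  assumes n: "n \<ge> 1" and d: "d \<ge> 1"
  shows "(\<integral>\<^sup>+z. ennreal ((fst z * (d + (\<Sum>j\<in>{1..n}. snd z j)) / n - 1)\<^sup>2) \<partial>mix_measure n d)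
     = ennreal (1 / n) * (\<integral>\<^sup>+z. 1 \<partial>mix_measure n d)"
proof -
  note cube_sum_measurable[measurable]
  let ?A = "\<lambda>y. real d + (\<Sum>j\<in>{1..n}. y j)"
  let ?K = "\<lambda>y. ennreal (mix_const n d * (fact (n - 1) / ?A y ^ n))"
  have A: "?A y > 0" if "y \<in> space (unit_cube n)" for y
    using d unit_cube_bounds[OF that] by (intro add_pos_nonneg sum_nonneg) auto
  have "(\<integral>\<^sup>+z. ennreal ((fst z * ?A (snd z) / n - 1)\<^sup>2) \<partial>mix_measure n d)
     = (\<integral>\<^sup>+y. \<integral>\<^sup>+u. ennreal (mix_weight n d u y) * ennreal ((u * ?A y / n - 1)\<^sup>2) \<partial>lborel \<partial>unit_cube n)"
    using nn_integral_mix_line_first[OF scaled_gap_measurable[of d n], of d] by simp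
  also have "\<dots> = (\<integral>\<^sup>+y. ennreal (1 / n) * ?K y \<partial>unit_cube n)"
    unfolding mix_weight_def
    by (intro nn_integral_cong nn_integral_gamma(2) A n less_imp_le mix_const_pos)
  also have "\<dots> = ennreal (1 / n) * (\<integral>\<^sup>+y. ?K y \<partial>unit_cube n)"
    by (rule nn_integral_cmult) measurable
  also have "(\<integral>\<^sup>+y. ?K y \<partial>unit_cube n) = (\<integral>\<^sup>+y. \<integral>\<^sup>+u. ennreal (mix_weight n d u y) \<partial>lborel \<partial>unit_cube n)"
    unfolding mix_weight_def
    by (intro nn_integral_cong nn_integral_gamma(1)[symmetric] A n less_imp_le mix_const_pos)
  also have "\<dots> = (\<integral>\<^sup>+z. 1 \<partial>mix_measure n d)"
    by (subst nn_integral_mix_line_first) simp_all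
  finally show ?thesis .
qed

text \<open>The cube is integrated first, because the coordinates are independent only for fixed
  u.\<close>

lemma nn_integral_mix_second_moment:
  assumes n: "n \<ge> 1"
  shows "(\<integral>\<^sup>+z. ennreal (((fst z)\<^sup>2 * (\<Sum>j\<in>{1..n}. (snd z j)\<^sup>2) / n - second_moment (fst z))\<^sup>2) \<partial>mix_measure n d)
     \<le> ennreal (8192 / n) * (\<integral>\<^sup>+z. 1 \<partial>mix_measure n d)"
proof -
  let ?T = "\<lambda>y. \<Sum>j\<in>{1..n}. (y j)\<^sup>2" and ?Y = "\<lambda>y. \<Sum>j\<in>{1..n}. y j"
  note cube_sum_measurable[measurable]
  have "(\<integral>\<^sup>+z. ennreal (((fst z)\<^sup>2 * ?T (snd z) / n - second_moment (fst z))\<^sup>2) \<partial>mix_measure n d)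
     = (\<integral>\<^sup>+u. \<integral>\<^sup>+y. ennreal (mix_weight n d u y) * ennreal ((u\<^sup>2 * ?T y / n - second_moment u)\<^sup>2) \<partial>unit_cube n \<partial>lborel)"
    using nn_integral_mix_cube_first[OF second_moment_gap_measurable[of n], of d] by simp
  also have "\<dots> \<le> (\<integral>\<^sup>+u. ennreal (8192 / n) * (\<integral>\<^sup>+y. ennreal (mix_weight n d u y) \<partial>unit_cube n) \<partial>lborel)"
  proof (rule nn_integral_mono)
    fix u :: real
    show "(\<integral>\<^sup>+y. ennreal (mix_weight n d u y) * ennreal ((u\<^sup>2 * ?T y / n - second_moment u)\<^sup>2) \<partial>unit_cube n)
      \<le> ennreal (8192 / n) * (\<integral>\<^sup>+y. ennreal (mix_weight n d u y) \<partial>unit_cube n)"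
    proof (cases "u > 0")
      case True
      define c where "c = mix_const n d * u ^ (n - 1) * exp (- (u * d))"
      have c: "c \<ge> 0" using True mix_const_pos[of n d] by (simp add: c_def)
      have w: "mix_weight n d u y = c * exp (- (u * ?Y y))" for y :: "nat \<Rightarrow> real"
        using True by (simp add: mix_weight_def c_def distrib_left exp_diff exp_minus exp_add field_simps)
      have "(\<integral>\<^sup>+y. ennreal (mix_weight n d u y) * ennreal ((u\<^sup>2 * ?T y / n - second_moment u)\<^sup>2) \<partial>unit_cube n)
         = (\<integral>\<^sup>+y. ennreal c * ennreal (exp (- (u * ?Y y)) * (u\<^sup>2 * ?T y / n - second_moment u)\<^sup>2) \<partial>unit_cube n)"
        unfolding w by (intro nn_integral_cong) (simp add: ennreal_mult'' ennreal_mult'[OF c] mult.assoc)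
      also have "\<dots> = ennreal c * (\<integral>\<^sup>+y. ennreal (exp (- (u * ?Y y)) * (u\<^sup>2 * ?T y / n - second_moment u)\<^sup>2) \<partial>unit_cube n)"
        by (rule nn_integral_cmult) measurable
      also have "\<dots> \<le> ennreal c * ennreal (8192 / n * exp_mean u ^ n)"
        by (intro mult_left_mono nn_integral_cube_second_moment[OF True n]) simp
      also have "\<dots> = ennreal (8192 / n) * (ennreal c * ennreal (exp_mean u ^ n))"
        by (subst ennreal_mult') (auto simp: mult_ac)
      also have "ennreal c * ennreal (exp_mean u ^ n) = (\<integral>\<^sup>+y. ennreal (mix_weight n d u y) \<partial>unit_cube n)"
      proof -
        have "(\<integral>\<^sup>+y. ennreal (mix_weight n d u y) \<partial>unit_cube n) = (\<integral>\<^sup>+y. ennreal c * ennreal (exp (- (u * ?Y y))) \<partial>unit_cube n)"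
          unfolding w by (intro nn_integral_cong) (simp add: ennreal_mult'[OF c])
        also have "\<dots> = ennreal c * (\<integral>\<^sup>+y. ennreal (exp (- (u * ?Y y))) \<partial>unit_cube n)"
          by (rule nn_integral_cmult) measurable
        finally show ?thesis by (simp only: cube_exp_integral[OF True])
      qed
      finally show ?thesis .
    qed (simp add: mix_weight_def)
  qed
  also have "\<dots> = ennreal (8192 / n) * (\<integral>\<^sup>+u. \<integral>\<^sup>+y. ennreal (mix_weight n d u y) \<partial>unit_cube n \<partial>lborel)"
    using unit_cube.borel_measurable_nn_integral_fst[OF mix_weight_measurable[of n d]]
    by (intro nn_integral_cmult) simp
  also have "(\<integral>\<^sup>+u. \<integral>\<^sup>+y. ennreal (mix_weight n d u y) \<partial>unit_cube n \<partial>lborel) = (\<integral>\<^sup>+z. 1 \<partial>mix_measure n d)"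
    by (subst nn_integral_mix_cube_first) simp_all
  finally show ?thesis .
qed

text \<open>Integrating the weight over u gives a constant times (n-1)!/A^n, which cancels A^n and
  leaves the prefactor of \<open>expected_stable_integral\<close>. Integrability on the cube follows
  from the bound e^2 and A \<ge> 1.\<close>

lemma expected_stable_mix:
  assumes n: "n \<ge> 1" and d: "d \<ge> 1"
  shows "ennreal (expected_stable n (n + d))
     = (\<integral>\<^sup>+z. ennreal ((d + (\<Sum>j\<in>{1..n}. snd z j)) ^ n * (\<Prod>i\<in>{1..n}. man_integral n d (snd z) i)) \<partial>mix_measure n d)"
proof -
  let ?A = "\<lambda>y. real d + (\<Sum>j\<in>{1..n}. y j)" and ?I = "\<lambda>y. \<Prod>i\<in>{1..n}. man_integral n d y i"
  have A: "?A y \<ge> 1" if "y \<in> space (unit_cube n)" for y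
    using d unit_cube_bounds[OF that] by (intro add_increasing2 sum_nonneg) auto
  have I: "0 \<le> ?I y" if "y \<in> space (unit_cube n)" for y
    using unit_cube_bounds[OF that] by (intro prod_nonneg man_integral_nonneg) auto
  have int: "integrable (unit_cube n) ?I"
  proof (rule unit_cube.integrable_const_bound[where B = "exp 2"])
    show "AE y in unit_cube n. norm (?I y) \<le> exp 2"
    proof (rule AE_I2)
      fix y assume y: "y \<in> space (unit_cube n)"
      have "1 * ?I y \<le> ?A y ^ n * ?I y" using A[OF y] I[OF y] by (intro mult_right_mono one_le_power)
      also have "\<dots> \<le> exp 2"
        by (rule prod_man_integral_le[OF _ d refl]) (use unit_cube_bounds[OF y] in auto)
      finally show "norm (?I y) \<le> exp 2" using I[OF y] by simp
    qed
  qed (rule prod_man_integral_measurable)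
  have "(\<integral>\<^sup>+z. ennreal (?A (snd z) ^ n * ?I (snd z)) \<partial>mix_measure n d)
     = (\<integral>\<^sup>+y. \<integral>\<^sup>+u. ennreal (mix_weight n d u y) * ennreal (?A y ^ n * ?I y) \<partial>lborel \<partial>unit_cube n)"
    using nn_integral_mix_line_first[OF scaled_prod_measurable[of d n], of d] by simp
  also have "\<dots> = (\<integral>\<^sup>+y. ennreal (mix_const n d * fact (n - 1) * ?I y) \<partial>unit_cube n)"
  proof (rule nn_integral_cong)
    fix y assume y: "y \<in> space (unit_cube n)"
    have "(\<integral>\<^sup>+u. ennreal (mix_weight n d u y) * ennreal (?A y ^ n * ?I y) \<partial>lborel)
       = (\<integral>\<^sup>+u. ennreal (mix_weight n d u y) \<partial>lborel) * ennreal (?A y ^ n * ?I y)"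
      unfolding mix_weight_def by (rule nn_integral_multc) measurable
    also have "(\<integral>\<^sup>+u. ennreal (mix_weight n d u y) \<partial>lborel) = ennreal (mix_const n d * (fact (n - 1) / ?A y ^ n))"
      unfolding mix_weight_def using A[OF y] by (intro nn_integral_gamma(1) n less_imp_le mix_const_pos) linarith
    also have "ennreal (mix_const n d * (fact (n - 1) / ?A y ^ n)) * ennreal (?A y ^ n * ?I y)
       = ennreal (mix_const n d * (fact (n - 1) / ?A y ^ n) * (?A y ^ n * ?I y))"
      using A[OF y] I[OF y] by (intro ennreal_mult''[symmetric] mult_nonneg_nonneg) auto
    also have "mix_const n d * (fact (n - 1) / ?A y ^ n) * (?A y ^ n * ?I y) = mix_const n d * fact (n - 1) * ?I y"
      using A[OF y] by simp
    finally show "(\<integral>\<^sup>+u. ennreal (mix_weight n d u y) * ennreal (?A y ^ n * ?I y) \<partial>lborel)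
       = ennreal (mix_const n d * fact (n - 1) * ?I y)" .
  qed
  also have "\<dots> = ennreal (\<integral>y. mix_const n d * fact (n - 1) * ?I y \<partial>unit_cube n)"
    using I mix_const_pos[of n d]
    by (intro nn_integral_eq_integral integrable_mult_right int AE_I2 mult_nonneg_nonneg) auto
  also have "(\<integral>y. mix_const n d * fact (n - 1) * ?I y \<partial>unit_cube n) = expected_stable n (n + d)"
    by (simp add: expected_stable_integral mix_const_def)
  finally show ?thesis by simp
qed

section \<open>Concentration of u and the total mass\<close>

definition mix_base :: "nat \<Rightarrow> nat \<Rightarrow> real \<Rightarrow> real" where
  "mix_base n d u = mix_const n d * (indicator {0<..} u * (exp (- (real d * u)) * (1 - exp (- u)) ^ (n - 1)))"

context
  fixes n d :: nat and N s v :: real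
  assumes n: "n \<ge> 1" and d: "d \<ge> 1"
  defines "N \<equiv> real (n + d)" and "s \<equiv> ln (real (n + d) / real d)" and "v \<equiv> 1 / real d - 1 / real (n + d)"
begin

private abbreviation "base \<equiv> mix_base n d"

private lemma base_nonneg: "base u \<ge> 0"
  using mix_const_pos[of n d] by (auto simp: mix_base_def indicator_def)

private lemma base_measurable [measurable]: "base \<in> borel_measurable borel"
  unfolding mix_base_def[abs_def] by measurable

private lemma s_pos: "s > 0"
  using n d by (auto simp: s_def)

private lemma v_bounds: "0 \<le> v" "v \<le> 1"
proof -
  show "0 \<le> v" using d by (simp add: v_def frac_le)
  have "1 / real d \<le> 1" using d by simp
  moreover have "0 \<le> 1 / real (n + d)" by simp
  ultimately show "v \<le> 1" unfolding v_def by linarith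
qed

text \<open>The mass is N/d = e^s. The second moment is taken around s instead of the mean H: it is
  the variance H2 \<le> 2 v plus (H - s)^2 \<le> v^2 \<le> v.\<close>

private lemma nn_integral_base:
  "(\<integral>\<^sup>+u. ennreal (base u) \<partial>lborel) = ennreal (N / d)"
  "(\<integral>\<^sup>+u. ennreal (base u * (u - s)\<^sup>2) \<partial>lborel) \<le> ennreal (N / d * (3 * v))"
proof -
  define H where "H = (\<Sum>k=d..d+(n-1). 1 / real k)"
  define H2 where "H2 = (\<Sum>k=d..d+(n-1). 1 / (real k)\<^sup>2)"
  define b :: real where "b = fact (d - 1) * fact (n - 1) / fact (d + (n - 1))"
  let ?g = "\<lambda>u. exp (- (real d * u)) * (1 - exp (- u)) ^ (n - 1)"
  note I = exponential_integral_one_minus_exp_power[OF d, of "n - 1", folded H_def H2_def b_def]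
  have ne: "AE u in lborel. u \<noteq> (0::real)" by (rule AE_lborel_singleton)
  have Cb: "mix_const n d * b = N / d"
  proof -
    have "fact d = real d * fact (d - 1)" using d fact_reduce[of d, where ?'a = real] by simp
    moreover have "fact (n + d) = N * fact (d + (n - 1))"
    proof -
      have "n + d = Suc (d + (n - 1))" using n by simp
      then show ?thesis unfolding N_def by (metis fact_Suc)
    qed
    ultimately show ?thesis unfolding mix_const_def b_def by simp
  qed
  have "has_bochner_integral lborel (\<lambda>u. mix_const n d * (indicator {0..} u * ?g u)) (mix_const n d * b)"
    by (intro has_bochner_integral_mult_right I)
  from nn_integral_has_bochner_integral[OF this]
  have "(\<integral>\<^sup>+u. ennreal (mix_const n d * (indicator {0..} u * ?g u)) \<partial>lborel) = ennreal (N / d)"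
    using mix_const_pos[of n d] Cb by (auto simp: indicator_def)
  moreover have "(\<integral>\<^sup>+u. ennreal (base u) \<partial>lborel) = (\<integral>\<^sup>+u. ennreal (mix_const n d * (indicator {0..} u * ?g u)) \<partial>lborel)"
    by (rule nn_integral_cong_AE) (use ne in eventually_elim, auto simp: mix_base_def indicator_def)
  ultimately show "(\<integral>\<^sup>+u. ennreal (base u) \<partial>lborel) = ennreal (N / d)" by simp
  let ?f = "\<lambda>u. mix_const n d * (indicator {0..} u * (u\<^sup>2 * ?g u) - 2 * s * (indicator {0..} u * (u * ?g u)) + s\<^sup>2 * (indicator {0..} u * ?g u))"
  have f_eq: "?f u = mix_const n d * (indicator {0..} u * ?g u) * (u - s)\<^sup>2" for u
    by (simp add: algebra_simps power2_eq_square)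
  have "has_bochner_integral lborel ?f (mix_const n d * (b * (H\<^sup>2 + H2) - 2 * s * (b * H) + s\<^sup>2 * b))"
    by (intro has_bochner_integral_mult_right has_bochner_integral_add has_bochner_integral_diff I)
  from nn_integral_has_bochner_integral[OF this]
  have "(\<integral>\<^sup>+u. ennreal (?f u) \<partial>lborel) = ennreal (mix_const n d * (b * (H\<^sup>2 + H2) - 2 * s * (b * H) + s\<^sup>2 * b))"
    unfolding f_eq using mix_const_pos[of n d] by (auto simp: indicator_def)
  also have "mix_const n d * (b * (H\<^sup>2 + H2) - 2 * s * (b * H) + s\<^sup>2 * b) = (mix_const n d * b) * (H2 + (H - s)\<^sup>2)"
    by (simp add: algebra_simps power2_eq_square)
  also have "ennreal ((mix_const n d * b) * (H2 + (H - s)\<^sup>2)) \<le> ennreal (N / d * (3 * v))"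
  proof (rule ennreal_leI)
    have hb: "s \<le> H" "H \<le> s + v" "H2 \<le> 2 * v"
      using harmonic_block_bounds[OF d n] unfolding H_def H2_def s_def v_def by (simp_all add: add.commute)
    have "(H - s)\<^sup>2 \<le> v * 1"
      unfolding power2_eq_square using hb v_bounds by (intro mult_mono) auto
    then have "H2 + (H - s)\<^sup>2 \<le> 3 * v" using hb by simp
    then show "mix_const n d * b * (H2 + (H - s)\<^sup>2) \<le> N / d * (3 * v)"
      unfolding Cb by (intro mult_left_mono) (auto simp: N_def)
  qed
  finally have "(\<integral>\<^sup>+u. ennreal (?f u) \<partial>lborel) \<le> ennreal (N / d * (3 * v))" .
  moreover have "(\<integral>\<^sup>+u. ennreal (base u * (u - s)\<^sup>2) \<partial>lborel) = (\<integral>\<^sup>+u. ennreal (?f u) \<partial>lborel)"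
    unfolding f_eq by (rule nn_integral_cong_AE) (use ne in eventually_elim, auto simp: mix_base_def indicator_def)
  ultimately show "(\<integral>\<^sup>+u. ennreal (base u * (u - s)\<^sup>2) \<partial>lborel) \<le> ennreal (N / d * (3 * v))" by simp
qed

private lemma nn_integral_base_scaled:
  assumes "c \<ge> 0"
  shows "(\<integral>\<^sup>+u. ennreal (base u * (c * (u - s)\<^sup>2)) \<partial>lborel) \<le> ennreal (c * (N / d * (3 * v)))"
proof -
  have "(\<integral>\<^sup>+u. ennreal (base u * (c * (u - s)\<^sup>2)) \<partial>lborel) = (\<integral>\<^sup>+u. ennreal c * ennreal (base u * (u - s)\<^sup>2) \<partial>lborel)"
    using assms by (intro nn_integral_cong) (simp add: ennreal_mult'[symmetric] mult_ac)
  also have "\<dots> = ennreal c * (\<integral>\<^sup>+u. ennreal (base u * (u - s)\<^sup>2) \<partial>lborel)"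
    by (rule nn_integral_cmult) measurable
  also have "\<dots> \<le> ennreal c * ennreal (N / d * (3 * v))"
    by (intro mult_left_mono nn_integral_base) simp
  finally show ?thesis by (simp only: ennreal_mult'[OF assms])
qed

private lemma nn_integral_mix_base:
  fixes \<phi> :: "real \<Rightarrow> real"
  assumes "\<phi> \<in> borel_measurable borel" "\<And>u. u > 0 \<Longrightarrow> \<phi> u \<ge> 0"
  shows "(\<integral>\<^sup>+z. ennreal (\<phi> (fst z)) \<partial>mix_measure n d) = (\<integral>\<^sup>+u. ennreal (base u * (exp_mean u * \<phi> u)) \<partial>lborel)"
  unfolding mix_base_def by (rule nn_integral_mix_fst[OF assms n])

private lemma base_pos_imp: "base u \<noteq> 0 \<Longrightarrow> u > 0"
  by (auto simp: mix_base_def indicator_def split: if_splits)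

text \<open>The extra factor is dropped since \<open>exp_mean u\<close> \<le> 1. With c =
  1/(\<epsilon> s)^2 this is the Chebyshev bound for relative deviations above \<epsilon>.\<close>

lemma nn_integral_mix_deviation:
  assumes "c \<ge> 0"
  shows "(\<integral>\<^sup>+z. ennreal (c * (fst z - s)\<^sup>2) \<partial>mix_measure n d) \<le> ennreal (c * (N / d * (3 * v)))"
proof -
  have "(\<integral>\<^sup>+z. ennreal (c * (fst z - s)\<^sup>2) \<partial>mix_measure n d)
      = (\<integral>\<^sup>+u. ennreal (base u * (exp_mean u * (c * (u - s)\<^sup>2))) \<partial>lborel)"
    by (rule nn_integral_mix_base) (use assms in auto)
  also have "\<dots> \<le> (\<integral>\<^sup>+u. ennreal (base u * (c * (u - s)\<^sup>2)) \<partial>lborel)"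
  proof (intro nn_integral_mono ennreal_leI)
    fix u
    show "base u * (exp_mean u * (c * (u - s)\<^sup>2)) \<le> base u * (c * (u - s)\<^sup>2)"
    proof (cases "base u = 0")
      case False
      then have "exp_mean u \<le> 1" by (intro exp_mean_le_1 base_pos_imp)
      then show ?thesis using assms base_nonneg[of u]
        by (intro mult_left_mono mult_left_le_one_le) (auto simp: exp_mean_pos base_pos_imp[OF False] less_imp_le)
    qed simp
  qed
  also have "\<dots> \<le> ennreal (c * (N / d * (3 * v)))" by (rule nn_integral_base_scaled[OF assms])
  finally show ?thesis .
qed

text \<open>For u within \<epsilon> s of s, \<open>exp_mean u\<close> is replaced by
  \<open>exp_mean s\<close> at the cost of a factor 1 - \<epsilon> or 1 + \<epsilon>; elsewhere both
  are at most 1 \<le> (u - s)^2/(\<epsilon> s)^2. The mass is thus about e^s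
  \<open>exp_mean s\<close> = (e^s - 1)/s.\<close>

lemma mix_total_bounds:
  assumes e: "0 < \<epsilon>" "\<epsilon> < 1"
  shows "(\<integral>\<^sup>+z. 1 \<partial>mix_measure n d) \<le> ennreal (N / d * (exp_mean s / (1 - \<epsilon>)) + 1 / (\<epsilon> * s)\<^sup>2 * (N / d * (3 * v)))" (is ?upper)
    and "ennreal (N / d * (exp_mean s / (1 + \<epsilon>))) \<le> (\<integral>\<^sup>+z. 1 \<partial>mix_measure n d) + ennreal (1 / (\<epsilon> * s)\<^sup>2 * (N / d * (3 * v)))" (is ?lower)
proof -
  let ?c = "1 / (\<epsilon> * s)\<^sup>2"
  have c: "?c \<ge> 0" by simp
  have [measurable]: "exp_mean \<in> borel_measurable borel" unfolding exp_mean_def[abs_def] by measurable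
  have total: "(\<integral>\<^sup>+z. 1 \<partial>mix_measure n d) = (\<integral>\<^sup>+u. ennreal (base u * exp_mean u) \<partial>lborel)"
    using nn_integral_mix_base[of "\<lambda>_. 1"] by simp
  have far: "1 \<le> ?c * (u - s)\<^sup>2" if "\<not> \<bar>u - s\<bar> \<le> \<epsilon> * s" for u
  proof -
    have "(\<epsilon> * s)\<^sup>2 \<le> \<bar>u - s\<bar>\<^sup>2" using that e s_pos by (intro power_mono) auto
    then show ?thesis using e s_pos by (simp add: field_simps)
  qed
  have cmult: "(\<integral>\<^sup>+u. ennreal (base u * a) \<partial>lborel) = ennreal (N / d * a)" if "a \<ge> 0" for a
    by (simp only: ennreal_mult''[OF that]) (subst nn_integral_multc, measurable, simp only: nn_integral_base(1))
  have hs: "exp_mean s > 0" "exp_mean s \<le> 1" using s_pos by (auto intro: exp_mean_pos exp_mean_le_1)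
  have "(\<integral>\<^sup>+u. ennreal (base u * exp_mean u) \<partial>lborel)
     \<le> (\<integral>\<^sup>+u. ennreal (base u * (exp_mean s / (1 - \<epsilon>))) + ennreal (base u * (?c * (u - s)\<^sup>2)) \<partial>lborel)"
  proof (rule nn_integral_mono)
    fix u
    have "base u * exp_mean u \<le> base u * (exp_mean s / (1 - \<epsilon>)) + base u * (?c * (u - s)\<^sup>2)"
    proof (cases "base u = 0")
      case False
      note u = base_pos_imp[OF False]
      have "exp_mean u \<le> exp_mean s / (1 - \<epsilon>) + ?c * (u - s)\<^sup>2"
      proof (cases "\<bar>u - s\<bar> \<le> \<epsilon> * s")
        case True
        then show ?thesis using exp_mean_close(1)[OF s_pos u True e] by (intro add_increasing2) auto
      next
        case False
        then show ?thesis using far[OF False] exp_mean_le_1[OF u] hs e by (intro add_increasing) auto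
      qed
      then show ?thesis unfolding distrib_left[symmetric] by (rule mult_left_mono[OF _ base_nonneg])
    qed simp
    then have "ennreal (base u * exp_mean u) \<le> ennreal (base u * (exp_mean s / (1 - \<epsilon>)) + base u * (?c * (u - s)\<^sup>2))"
      by (rule ennreal_leI)
    also have "\<dots> = ennreal (base u * (exp_mean s / (1 - \<epsilon>))) + ennreal (base u * (?c * (u - s)\<^sup>2))"
      using base_nonneg[of u] hs e by (intro ennreal_plus mult_nonneg_nonneg) auto
    finally show "ennreal (base u * exp_mean u) \<le> \<dots>" .
  qed
  also have "\<dots> = (\<integral>\<^sup>+u. ennreal (base u * (exp_mean s / (1 - \<epsilon>))) \<partial>lborel) + (\<integral>\<^sup>+u. ennreal (base u * (?c * (u - s)\<^sup>2)) \<partial>lborel)"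
    by (rule nn_integral_add) measurable
  also have "\<dots> \<le> ennreal (N / d * (exp_mean s / (1 - \<epsilon>))) + ennreal (?c * (N / d * (3 * v)))"
    by (rule add_mono[OF eq_refl[OF cmult] nn_integral_base_scaled[OF c]]) (use hs e in auto)
  also have "\<dots> = ennreal (N / d * (exp_mean s / (1 - \<epsilon>)) + ?c * (N / d * (3 * v)))"
    using hs e v_bounds by (intro ennreal_plus[symmetric]) (auto simp: N_def)
  finally show ?upper unfolding total .
  have "ennreal (N / d * (exp_mean s / (1 + \<epsilon>))) = (\<integral>\<^sup>+u. ennreal (base u * (exp_mean s / (1 + \<epsilon>))) \<partial>lborel)"
    using hs e by (intro cmult[symmetric]) auto
  also have "\<dots> \<le> (\<integral>\<^sup>+u. ennreal (base u * exp_mean u) + ennreal (base u * (?c * (u - s)\<^sup>2)) \<partial>lborel)"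
  proof (rule nn_integral_mono)
    fix u
    have "base u * (exp_mean s / (1 + \<epsilon>)) \<le> base u * exp_mean u + base u * (?c * (u - s)\<^sup>2)"
      and "0 \<le> base u * exp_mean u"
    proof -
      show "base u * (exp_mean s / (1 + \<epsilon>)) \<le> base u * exp_mean u + base u * (?c * (u - s)\<^sup>2)"
      proof (cases "base u = 0")
        case False
        note u = base_pos_imp[OF False]
        have "exp_mean s / (1 + \<epsilon>) \<le> exp_mean u + ?c * (u - s)\<^sup>2"
        proof (cases "\<bar>u - s\<bar> \<le> \<epsilon> * s")
          case True
          then show ?thesis using exp_mean_close(2)[OF s_pos u True e] by (intro add_increasing2) auto
        next
          case False
          have "exp_mean s / (1 + \<epsilon>) \<le> 1" using hs e by (simp add: divide_le_eq)
          then show ?thesis using far[OF False] exp_mean_pos[OF u] by linarith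
        qed
        then show ?thesis unfolding distrib_left[symmetric] by (rule mult_left_mono[OF _ base_nonneg])
      qed simp
      show "0 \<le> base u * exp_mean u"
        using base_nonneg[of u] exp_mean_pos[of u] base_pos_imp[of u] by (cases "base u = 0") auto
    qed
    then have "ennreal (base u * (exp_mean s / (1 + \<epsilon>))) \<le> ennreal (base u * exp_mean u + base u * (?c * (u - s)\<^sup>2))"
      by (intro ennreal_leI)
    also have "\<dots> = ennreal (base u * exp_mean u) + ennreal (base u * (?c * (u - s)\<^sup>2))"
      by (rule ennreal_plus) (fact, intro mult_nonneg_nonneg base_nonneg c zero_le_power2)
    finally show "ennreal (base u * (exp_mean s / (1 + \<epsilon>))) \<le> \<dots>" .
  qed
  also have "\<dots> = (\<integral>\<^sup>+u. ennreal (base u * exp_mean u) \<partial>lborel) + (\<integral>\<^sup>+u. ennreal (base u * (?c * (u - s)\<^sup>2)) \<partial>lborel)"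
    by (rule nn_integral_add) measurable
  also have "\<dots> \<le> (\<integral>\<^sup>+u. ennreal (base u * exp_mean u) \<partial>lborel) + ennreal (?c * (N / d * (3 * v)))"
    by (intro add_mono nn_integral_base_scaled c order_refl)
  finally show ?lower unfolding total .
qed

end

section \<open>Asymptotics\<close>

text \<open>In the typical region, \<open>range_bound n\<close> dominates \<open>1 / A\<close> and \<open>rate_bound n\<close> dominates the
  quantity \<open>n q\<close> of \<open>prod_man_integral_lower\<close>, uniformly in \<open>d\<close>.\<close>

definition range_bound :: "nat \<Rightarrow> real" where
  "range_bound n = 3 * ln (real n + 1) / n"

definition rate_bound :: "nat \<Rightarrow> real" where
  "rate_bound n = 200 + 6400 * range_bound n + 216 * n * range_bound n ^ 3"

text \<open>The first two terms are errors of the upper bound, the other three of the lower bound;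
  one function serves both. With 200 the bound on n (d + T)/A^2, 40000 is 200^2 and 6400 is 32 *
  200.\<close>

definition exponent_error :: "nat \<Rightarrow> real" where
  "exponent_error n = 3 * n * (range_bound n)\<^sup>2 + 48 * 40000 / n + 6400 * range_bound n
     + 216 * n * range_bound n ^ 3 + 2 * (rate_bound n)\<^sup>2 / n"

lemma range_bound_tendsto: "range_bound \<longlonglongrightarrow> 0"
  unfolding range_bound_def[abs_def] by real_asymp

lemma exponent_error_tendsto: "exponent_error \<longlonglongrightarrow> 0"
  unfolding exponent_error_def[abs_def] rate_bound_def range_bound_def by real_asymp

lemma rate_bound_small: "eventually (\<lambda>n. rate_bound n \<le> n / 2 \<and> range_bound n \<le> 1 / 2) sequentially"
proof -
  have "(\<lambda>n. rate_bound n / n) \<longlonglongrightarrow> 0" unfolding rate_bound_def range_bound_def by real_asymp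
  then have "eventually (\<lambda>n. rate_bound n / n < 1 / 2) sequentially" by (rule order_tendstoD) simp
  moreover have "eventually (\<lambda>n. range_bound n < 1 / 2) sequentially"
    using range_bound_tendsto by (rule order_tendstoD) simp
  moreover have "eventually (\<lambda>n::nat. n > 0) sequentially" by (rule eventually_gt_at_top)
  ultimately show ?thesis by eventually_elim (auto simp: field_simps)
qed

section \<open>Estimates at a typical point\<close>

context
  fixes n d :: nat and y :: "nat \<Rightarrow> real" and s u A T \<epsilon> :: real
  assumes y: "\<And>j. j \<in> {1..n} \<Longrightarrow> 0 \<le> y j \<and> y j \<le> 1"
    and n: "n \<ge> 1" and d: "d \<ge> 1"
    and s_def: "s = ln (real (n + d) / real d)"
    and A_def: "A = d + (\<Sum>j\<in>{1..n}. y j)"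
    and T_def: "T = (\<Sum>j\<in>{1..n}. (y j)\<^sup>2)"
    and small: "rate_bound n \<le> n / 2" "range_bound n \<le> 1 / 2"
    and e: "\<epsilon> \<le> 1 / 2" and us: "\<bar>u - s\<bar> \<le> \<epsilon> * s"
    and uA: "\<bar>u * A / n - 1\<bar> \<le> \<epsilon>" and uT: "\<bar>u\<^sup>2 * T / n - second_moment u\<bar> \<le> \<epsilon>"
begin

private lemma center_pos: "s > 0" using n d by (auto simp: s_def)

private lemma A_pos: "A > 0"
  unfolding A_def using d y by (intro add_pos_nonneg sum_nonneg) auto

text \<open>From d \<ge> 1 follows s \<le> ln (n + 1), hence u \<le> 3/2 ln (n + 1); then u A \<ge>
  n/2 forces A to be at least of order n/ln n, uniformly in d.\<close>

private lemma A_lower: "1 / A \<le> range_bound n" "A \<ge> 2"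
proof -
  have "real (n + d) / real d \<le> real n + 1"
  proof -
    have "real n * 1 \<le> real n * real d" using d by (intro mult_left_mono) auto
    then show ?thesis using d by (simp add: field_simps)
  qed
  then have "s \<le> ln (real n + 1)" unfolding s_def using d by simp
  moreover have "\<epsilon> * s \<le> 1 / 2 * s" using e center_pos by (intro mult_right_mono) auto
  ultimately have u: "u \<le> 3 / 2 * ln (real n + 1)" using us by linarith
  have "1 / 2 \<le> u * A / n" using uA e by linarith
  then have "real n \<le> 2 * (u * A)" using n by (simp add: field_simps)
  also have "\<dots> \<le> 2 * (3 / 2 * ln (real n + 1) * A)"
    using u A_pos by (intro mult_left_mono mult_right_mono) auto
  finally show 1: "1 / A \<le> range_bound n"
    unfolding range_bound_def using n A_pos by (simp add: field_simps)
  then have "1 / A \<le> 1 / 2" using small by linarith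
  then show "A \<ge> 2" using A_pos by (simp add: field_simps)
qed

private lemma range_nonneg: "range_bound n \<ge> 0" unfolding range_bound_def by simp

private lemma exp_s: "exp s - 1 = real n / real d"
  using d unfolding s_def by (simp add: field_simps)

private lemma B_le: "n * (d + T) / A\<^sup>2 \<le> 200" "0 \<le> n * (d + T) / A\<^sup>2"
proof -
  show "n * (d + T) / A\<^sup>2 \<le> 200"
    by (rule exponent_close(2)[OF _ _ center_pos A_pos exp_s e us uA uT]) (use n d in auto)
  have "T \<ge> 0" unfolding T_def by (intro sum_nonneg) auto
  then show "0 \<le> n * (d + T) / A\<^sup>2" by simp
qed

private lemma main_exponent: "\<bar>(1 - d / A - n * (d + T) / A\<^sup>2) - (s * d / n - 1)\<bar> \<le> 320 * \<epsilon>"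
  by (rule exponent_close(1)[OF _ _ center_pos A_pos exp_s e us uA uT]) (use n d in auto)

private lemma inverse_powers: "n / A\<^sup>2 \<le> n * (range_bound n)\<^sup>2" "n / A ^ 3 \<le> n * range_bound n ^ 3"
proof -
  have "(1 / A) ^ k \<le> range_bound n ^ k" for k
    using A_lower(1) A_pos by (intro power_mono) auto
  then have "real n * (1 / A) ^ k \<le> n * range_bound n ^ k" for k by (intro mult_left_mono) auto
  from this[of 2] this[of 3] show "n / A\<^sup>2 \<le> n * (range_bound n)\<^sup>2" "n / A ^ 3 \<le> n * range_bound n ^ 3"
    by (simp_all add: power_divide)
qed

private lemma error_nonneg:
  "0 \<le> n * (range_bound n)\<^sup>2" "0 \<le> n * range_bound n ^ 3" "0 \<le> (rate_bound n)\<^sup>2 / n" "0 \<le> 48 * 40000 / real n"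
  using range_nonneg by auto

lemma typical_upper:
  "A ^ n * (\<Prod>i\<in>{1..n}. man_integral n d y i) \<le> exp (s * d / n - 1 + 320 * \<epsilon> + exponent_error n)"
proof -
  let ?\<beta> = "n * (d + T) / A\<^sup>2"
  have "A ^ n * (\<Prod>i\<in>{1..n}. man_integral n d y i)
    \<le> exp (1 - d / A - n * (d + T) / A\<^sup>2 + (3 * n / A\<^sup>2 + 48 * n * (d + T)\<^sup>2 / A ^ 4))"
    by (rule prod_man_integral_upper[OF y d A_def _ A_lower(2)]) (simp_all add: T_def)
  also have "\<dots> \<le> exp (s * d / n - 1 + 320 * \<epsilon> + exponent_error n)"
  proof (subst exp_le_cancel_iff)
    have "48 * n * (d + T)\<^sup>2 / A ^ 4 = 48 * ?\<beta>\<^sup>2 / n"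
      using n A_pos by (simp add: field_simps power2_eq_square power4_eq_xxxx)
    also have "\<dots> \<le> 48 * 200\<^sup>2 / n" using B_le by (intro divide_right_mono mult_left_mono power_mono) auto
    finally have "48 * n * (d + T)\<^sup>2 / A ^ 4 \<le> 48 * 40000 / n" by simp
    moreover have "3 * n / A\<^sup>2 \<le> 3 * (n * (range_bound n)\<^sup>2)" using inverse_powers(1) by simp
    moreover have "exponent_error n \<ge> 3 * (n * (range_bound n)\<^sup>2) + 48 * 40000 / n"
      unfolding exponent_error_def using error_nonneg range_nonneg by simp
    ultimately show "1 - d / A - ?\<beta> + (3 * n / A\<^sup>2 + 48 * n * (d + T)\<^sup>2 / A ^ 4)
      \<le> s * d / n - 1 + 320 * \<epsilon> + exponent_error n"
      using main_exponent by linarith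
  qed
  finally show ?thesis .
qed

lemma typical_lower:
  "exp (s * d / n - 1 - 320 * \<epsilon> - exponent_error n) \<le> A ^ n * (\<Prod>i\<in>{1..n}. man_integral n d y i)"
proof -
  let ?\<beta> = "n * (d + T) / A\<^sup>2"
  define B where "B = d + T"
  define q where "q = B / A\<^sup>2 + (32 * B + 216) / A ^ 3"
  \<comment> \<open>Only the first term belongs to the limiting exponent; the other two are errors
    controlled by 1/A.\<close>
  have nq: "n * q = ?\<beta> + 32 * ?\<beta> * (1 / A) + 216 * (n / A ^ 3)"
    using A_pos unfolding q_def B_def by (simp add: field_simps power2_eq_square power3_eq_cube)
  have "32 * ?\<beta> * (1 / A) \<le> 32 * 200 * range_bound n"
    using B_le A_lower A_pos by (intro mult_mono) auto
  then have nq_le: "n * q \<le> ?\<beta> + 6400 * range_bound n + 216 * n * range_bound n ^ 3"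
    using inverse_powers(2) unfolding nq by simp
  then have nq_rate: "n * q \<le> rate_bound n" using B_le unfolding rate_bound_def by simp
  have "0 \<le> 32 * ?\<beta> * (1 / A)" using B_le(2) A_pos by (intro mult_nonneg_nonneg) auto
  then have nq0: "0 \<le> n * q" unfolding nq using B_le A_pos by (intro add_nonneg_nonneg) auto
  have q: "q \<le> 1 / 2"
  proof -
    have "real n * q \<le> real n * (1 / 2)" using nq_rate small by simp
    then show ?thesis using n by simp
  qed
  have "2 * n * q\<^sup>2 = 2 * (n * q)\<^sup>2 / n" using n by (simp add: power2_eq_square)
  also have "\<dots> \<le> 2 * (rate_bound n)\<^sup>2 / n"
    using nq0 nq_rate by (intro divide_right_mono mult_left_mono power_mono) auto
  finally have q2: "2 * n * q\<^sup>2 \<le> 2 * (rate_bound n)\<^sup>2 / n" .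
  have "6400 * range_bound n + 216 * n * range_bound n ^ 3 + 2 * (rate_bound n)\<^sup>2 / n \<le> exponent_error n"
    unfolding exponent_error_def using error_nonneg by simp
  with nq_le q2 main_exponent have "s * d / n - 1 - 320 * \<epsilon> - exponent_error n \<le> 1 - d / A - n * q - 2 * n * q\<^sup>2"
    by linarith
  then have "exp (s * d / n - 1 - 320 * \<epsilon> - exponent_error n) \<le> exp (1 - d / A - n * q - 2 * n * q\<^sup>2)" by simp
  also have "\<dots> \<le> A ^ n * (\<Prod>i\<in>{1..n}. man_integral n d y i)"
    by (rule prod_man_integral_lower[OF y d A_def _ A_lower(2) q_def q]) (simp_all add: T_def B_def)
  finally show ?thesis .
qed

end

text \<open>Here w is the total mass and x the Chebyshev bound for u; the existential keeps the
  measure out of the asymptotics. The sum X of three normalised squares is at least 1 at every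
  atypical point. With 0 \<le> G \<le> e^2 this gives G \<le> g1 + e^2 X and g2 \<le> G + g2 X at
  typical and atypical points alike, and it remains to integrate. 8193 is 1 for u A plus 8192 for
  T.\<close>

theorem expected_stable_bounds:
  fixes n d :: nat and \<epsilon> s D v x :: real
  assumes n: "n \<ge> 1" and d: "d \<ge> 1" and e: "0 < \<epsilon>" "\<epsilon> \<le> 1 / 2"
    and small: "rate_bound n \<le> n / 2" "range_bound n \<le> 1 / 2"
  defines "s \<equiv> ln (real (n + d) / real d)" and "D \<equiv> real (n + d) / real d"
    and "v \<equiv> 1 / real d - 1 / real (n + d)"
  defines "x \<equiv> 1 / (\<epsilon> * s)\<^sup>2 * (D * (3 * v))"
  shows "\<exists>w\<ge>0. w \<le> D * (exp_mean s / (1 - \<epsilon>)) + x \<and> D * (exp_mean s / (1 + \<epsilon>)) \<le> w + x \<and>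
    expected_stable n (n + d) \<le> exp (s * d / n - 1 + 320 * \<epsilon> + exponent_error n) * w
        + exp 2 * (x + 8193 / (n * \<epsilon>\<^sup>2) * w) \<and>
    exp (s * d / n - 1 - 320 * \<epsilon> - exponent_error n) * (w - (x + 8193 / (n * \<epsilon>\<^sup>2) * w)) \<le> expected_stable n (n + d)"
proof -
  let ?M = "mix_measure n d"
  define G where "G y = (d + (\<Sum>j\<in>{1..n}. y j)) ^ n * (\<Prod>i\<in>{1..n}. man_integral n d y i)" for y :: "nat \<Rightarrow> real"
  define g1 where "g1 = exp (s * d / n - 1 + 320 * \<epsilon> + exponent_error n)"
  define g2 where "g2 = exp (s * d / n - 1 - 320 * \<epsilon> - exponent_error n)"
  define X1 where "X1 z = 1 / (\<epsilon> * s)\<^sup>2 * (fst z - s)\<^sup>2" for z :: "real \<times> (nat \<Rightarrow> real)"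
  define Y2 where "Y2 z = (fst z * (d + (\<Sum>j\<in>{1..n}. snd z j)) / n - 1)\<^sup>2" for z :: "real \<times> (nat \<Rightarrow> real)"
  define Y3 where "Y3 z = ((fst z)\<^sup>2 * (\<Sum>j\<in>{1..n}. (snd z j)\<^sup>2) / n - second_moment (fst z))\<^sup>2" for z :: "real \<times> (nat \<Rightarrow> real)"
  define X where "X z = X1 z + (1 / \<epsilon>\<^sup>2 * Y2 z + 1 / \<epsilon>\<^sup>2 * Y3 z)" for z :: "real \<times> (nat \<Rightarrow> real)"
  define w where "w = enn2real (\<integral>\<^sup>+z. 1 \<partial>?M)"
  have s: "s > 0" using n d by (auto simp: s_def)
  have v: "0 \<le> v" using d by (simp add: v_def frac_le)
  have D: "D \<ge> 0" by (simp add: D_def)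
  have e1: "\<epsilon> < 1" using e by simp
  note tb = mix_total_bounds[OF n d e(1) e1, folded s_def v_def D_def, folded x_def]
  have W: "(\<integral>\<^sup>+z. 1 \<partial>?M) = ennreal w"
    unfolding w_def using tb(1) by (intro ennreal_enn2real[symmetric]) (auto simp: less_top[symmetric] top_unique)
  have w0: "w \<ge> 0" by (simp add: w_def)
  have x0: "x \<ge> 0" unfolding x_def using D v by simp
  have hs: "exp_mean s > 0" using exp_mean_pos[OF s] .
  have w_up: "w \<le> D * (exp_mean s / (1 - \<epsilon>)) + x"
    using tb(1) unfolding W using D hs e x0 by (subst (asm) ennreal_le_iff) auto
  have w_low: "D * (exp_mean s / (1 + \<epsilon>)) \<le> w + x"
    using tb(2) unfolding W using w0 x0 by (simp add: ennreal_plus[symmetric] del: ennreal_plus)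
  have meas: "borel_measurable ?M = borel_measurable (lborel \<Otimes>\<^sub>M unit_cube n)"
    by (rule measurable_cong_sets[OF sets_mix_measure refl])
  have [measurable]: "(\<lambda>z. ennreal (G (snd z))) \<in> borel_measurable ?M"
    unfolding G_def meas by (rule scaled_prod_measurable)
  have [measurable]: "(\<lambda>z. ennreal (Y2 z)) \<in> borel_measurable ?M"
    unfolding Y2_def meas by (rule scaled_gap_measurable)
  have [measurable]: "(\<lambda>z. ennreal (Y3 z)) \<in> borel_measurable ?M"
    unfolding Y3_def meas by (rule second_moment_gap_measurable)
  have [measurable]: "(\<lambda>z. ennreal (X1 z)) \<in> borel_measurable ?M"
    unfolding X1_def meas by measurable
  have pos: "X1 z \<ge> 0" "Y2 z \<ge> 0" "Y3 z \<ge> 0" for z by (auto simp: X1_def Y2_def Y3_def)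
  have X_split: "ennreal (X z) = ennreal (X1 z) + (ennreal (1 / \<epsilon>\<^sup>2) * ennreal (Y2 z) + ennreal (1 / \<epsilon>\<^sup>2) * ennreal (Y3 z))" for z
    unfolding X_def using pos[of z] by (simp add: ennreal_plus ennreal_mult'[symmetric])
  have [measurable]: "(\<lambda>z. ennreal (X z)) \<in> borel_measurable ?M"
    unfolding X_split by measurable
  have X0: "X z \<ge> 0" for z unfolding X_def using pos[of z] by simp
  have I_X: "(\<integral>\<^sup>+z. ennreal (X z) \<partial>?M) \<le> ennreal (x + 8193 / (n * \<epsilon>\<^sup>2) * w)"
  proof -
    have "(\<integral>\<^sup>+z. ennreal (X z) \<partial>?M) = (\<integral>\<^sup>+z. ennreal (X1 z) \<partial>?M)
       + (ennreal (1 / \<epsilon>\<^sup>2) * (\<integral>\<^sup>+z. ennreal (Y2 z) \<partial>?M) + ennreal (1 / \<epsilon>\<^sup>2) * (\<integral>\<^sup>+z. ennreal (Y3 z) \<partial>?M))"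
      unfolding X_split by (simp add: nn_integral_add nn_integral_cmult)
    also have "\<dots> \<le> ennreal x + (ennreal (1 / \<epsilon>\<^sup>2) * (ennreal (1 / n) * ennreal w)
       + ennreal (1 / \<epsilon>\<^sup>2) * (ennreal (8192 / n) * ennreal w))"
    proof (intro add_mono mult_left_mono)
      show "(\<integral>\<^sup>+z. ennreal (X1 z) \<partial>?M) \<le> ennreal x"
        unfolding X1_def x_def D_def v_def s_def by (rule nn_integral_mix_deviation[OF n d]) simp
      show "(\<integral>\<^sup>+z. ennreal (Y2 z) \<partial>?M) \<le> ennreal (1 / n) * ennreal w"
        using nn_integral_mix_scaled_gap[OF n d] unfolding Y2_def W by simp
      show "(\<integral>\<^sup>+z. ennreal (Y3 z) \<partial>?M) \<le> ennreal (8192 / n) * ennreal w"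
        using nn_integral_mix_second_moment[OF n, of d] unfolding Y3_def W by simp
    qed auto
    also have "\<dots> = ennreal (x + (1 / \<epsilon>\<^sup>2 * (1 / n * w) + 1 / \<epsilon>\<^sup>2 * (8192 / n * w)))"
      using w0 x0 by (simp add: ennreal_plus ennreal_mult'[symmetric] del: ennreal_plus) (simp add: ennreal_plus[symmetric] del: ennreal_plus)
    also have "x + (1 / \<epsilon>\<^sup>2 * (1 / n * w) + 1 / \<epsilon>\<^sup>2 * (8192 / n * w)) = x + 8193 / (n * \<epsilon>\<^sup>2) * w"
      using n e by (simp add: field_simps)
    finally show ?thesis .
  qed
  have bad0: "0 \<le> x + 8193 / (n * \<epsilon>\<^sup>2) * w" using x0 w0 by simp
  have AE_pos: "AE z in ?M. fst z > 0"
    unfolding mix_measure_def AE_density[OF mix_weight_measurable]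
    by (rule AE_I2) (auto simp: mix_weight_def split: if_splits)
  have pointwise: "G (snd z) \<le> g1 + exp 2 * X z" "g2 \<le> G (snd z) + g2 * X z" "0 \<le> G (snd z)"
    if z: "z \<in> space ?M" "fst z > 0" for z
  proof -
    let ?u = "fst z" and ?y = "snd z"
    have y: "0 \<le> ?y j \<and> ?y j \<le> 1" if "j \<in> {1..n}" for j
      using z(1) that unit_cube_bounds[of ?y n j] by (auto simp: space_mix_measure mem_Times_iff)
    show G0: "0 \<le> G ?y"
      unfolding G_def using y by (intro mult_nonneg_nonneg zero_le_power add_nonneg_nonneg sum_nonneg prod_nonneg man_integral_nonneg) auto
    have G2: "G ?y \<le> exp 2" unfolding G_def by (rule prod_man_integral_le[OF y d refl refl])
    have "G ?y \<le> g1 + exp 2 * X z \<and> g2 \<le> G ?y + g2 * X z"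
    proof (cases "\<bar>?u - s\<bar> \<le> \<epsilon> * s \<and> \<bar>?u * (d + (\<Sum>j\<in>{1..n}. ?y j)) / n - 1\<bar> \<le> \<epsilon>
        \<and> \<bar>?u\<^sup>2 * (\<Sum>j\<in>{1..n}. (?y j)\<^sup>2) / n - second_moment ?u\<bar> \<le> \<epsilon>")
      case True
      then have t: "\<bar>?u - s\<bar> \<le> \<epsilon> * s" "\<bar>?u * (d + (\<Sum>j\<in>{1..n}. ?y j)) / n - 1\<bar> \<le> \<epsilon>"
        "\<bar>?u\<^sup>2 * (\<Sum>j\<in>{1..n}. (?y j)\<^sup>2) / n - second_moment ?u\<bar> \<le> \<epsilon>" by blast+
      have "G ?y \<le> g1" unfolding G_def g1_def
        by (rule typical_upper[OF y n d meta_eq_to_obj_eq[OF s_def] refl refl small e(2) t])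
      moreover have "g2 \<le> G ?y" unfolding G_def g2_def
        by (rule typical_lower[OF y n d meta_eq_to_obj_eq[OF s_def] refl refl small e(2) t])
      moreover have "0 \<le> exp 2 * X z" "0 \<le> g2 * X z" using X0[of z] by (auto simp: g2_def)
      ultimately show ?thesis by linarith
    next
      case False
      have sq: "1 \<le> 1 / a\<^sup>2 * b\<^sup>2" if "\<not> \<bar>b\<bar> \<le> a" "a > 0" for a b :: real
      proof -
        have "a\<^sup>2 \<le> \<bar>b\<bar>\<^sup>2" using that by (intro power_mono) auto
        then show ?thesis using that by (simp add: field_simps)
      qed
      have "X z \<ge> 1"
      proof -
        have "X1 z \<ge> 1 \<or> 1 / \<epsilon>\<^sup>2 * Y2 z \<ge> 1 \<or> 1 / \<epsilon>\<^sup>2 * Y3 z \<ge> 1"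
          using False sq e s unfolding X1_def Y2_def Y3_def by (metis mult_pos_pos)
        moreover have "0 \<le> 1 / \<epsilon>\<^sup>2 * Y2 z" "0 \<le> 1 / \<epsilon>\<^sup>2 * Y3 z" using pos[of z] by auto
        ultimately show ?thesis unfolding X_def using pos(1)[of z] by linarith
      qed
      then have "exp 2 * 1 \<le> exp 2 * X z" "g2 * 1 \<le> g2 * X z"
        by (intro mult_left_mono; simp add: g2_def)+
      moreover have "g1 \<ge> 0" by (simp add: g1_def)
      ultimately show ?thesis using G2 G0 by linarith
    qed
    then show "G ?y \<le> g1 + exp 2 * X z" "g2 \<le> G ?y + g2 * X z" by auto
  qed
  have E: "ennreal (expected_stable n (n + d)) = (\<integral>\<^sup>+z. ennreal (G (snd z)) \<partial>?M)"
    unfolding G_def by (rule expected_stable_mix[OF n d])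
  have E0: "expected_stable n (n + d) \<ge> 0"
    unfolding expected_stable_def by (intro Bochner_Integration.integral_nonneg) (auto split: prod.splits)
  have "(\<integral>\<^sup>+z. ennreal (G (snd z)) \<partial>?M) \<le> (\<integral>\<^sup>+z. ennreal g1 * 1 + ennreal (exp 2) * ennreal (X z) \<partial>?M)"
  proof (rule nn_integral_mono_AE)
    show "AE z in ?M. ennreal (G (snd z)) \<le> ennreal g1 * 1 + ennreal (exp 2) * ennreal (X z)"
      using AE_pos AE_space
    proof eventually_elim
      case (elim z)
      then show ?case using pointwise(1)[of z] X0[of z]
        by (simp add: g1_def ennreal_mult'[symmetric] ennreal_plus[symmetric] ennreal_leI del: ennreal_plus)
    qed
  qed
  also have "\<dots> = ennreal g1 * (\<integral>\<^sup>+z. 1 \<partial>?M) + ennreal (exp 2) * (\<integral>\<^sup>+z. ennreal (X z) \<partial>?M)"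
    by (simp add: nn_integral_add nn_integral_cmult)
  also have "\<dots> \<le> ennreal g1 * ennreal w + ennreal (exp 2) * ennreal (x + 8193 / (n * \<epsilon>\<^sup>2) * w)"
    unfolding W by (intro add_mono mult_left_mono I_X) auto
  also have "\<dots> = ennreal (g1 * w + exp 2 * (x + 8193 / (n * \<epsilon>\<^sup>2) * w))"
  proof -
    have "0 \<le> g1 * w" "0 \<le> exp 2 * (x + 8193 / (n * \<epsilon>\<^sup>2) * w)" using bad0 w0 by (auto simp: g1_def)
    then show ?thesis using bad0 w0 by (simp only: ennreal_mult''[symmetric] ennreal_plus)
  qed
  finally have up: "expected_stable n (n + d) \<le> g1 * w + exp 2 * (x + 8193 / (n * \<epsilon>\<^sup>2) * w)"
    unfolding E[symmetric] using bad0 w0 by (subst (asm) ennreal_le_iff) (auto simp: g1_def intro!: add_nonneg_nonneg mult_nonneg_nonneg)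
  have "ennreal (g2 * w) = (\<integral>\<^sup>+z. ennreal g2 * 1 \<partial>?M)"
    using w0 by (subst nn_integral_cmult) (auto simp: W[simplified] ennreal_mult'')
  also have "\<dots> \<le> (\<integral>\<^sup>+z. ennreal (G (snd z)) + ennreal g2 * ennreal (X z) \<partial>?M)"
  proof (rule nn_integral_mono_AE)
    show "AE z in ?M. ennreal g2 * 1 \<le> ennreal (G (snd z)) + ennreal g2 * ennreal (X z)"
      using AE_pos AE_space
    proof eventually_elim
      case (elim z)
      then show ?case using pointwise(2,3)[of z] X0[of z]
        by (simp add: g2_def ennreal_mult'[symmetric] ennreal_plus[symmetric] ennreal_leI del: ennreal_plus)
    qed
  qed
  also have "\<dots> = ennreal (expected_stable n (n + d)) + ennreal g2 * (\<integral>\<^sup>+z. ennreal (X z) \<partial>?M)"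
    unfolding E by (simp add: nn_integral_add nn_integral_cmult)
  also have "\<dots> \<le> ennreal (expected_stable n (n + d)) + ennreal g2 * ennreal (x + 8193 / (n * \<epsilon>\<^sup>2) * w)"
    by (intro add_mono mult_left_mono I_X) auto
  also have "\<dots> = ennreal (expected_stable n (n + d) + g2 * (x + 8193 / (n * \<epsilon>\<^sup>2) * w))"
  proof -
    have "0 \<le> g2 * (x + 8193 / (n * \<epsilon>\<^sup>2) * w)" using bad0 by (auto simp: g2_def)
    then show ?thesis using bad0 E0 by (simp only: ennreal_mult''[symmetric] ennreal_plus)
  qed
  finally have "g2 * w \<le> expected_stable n (n + d) + g2 * (x + 8193 / (n * \<epsilon>\<^sup>2) * w)"
    using bad0 E0 by (subst (asm) ennreal_le_iff) (auto simp: g2_def intro!: add_nonneg_nonneg mult_nonneg_nonneg)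
  then have low: "g2 * (w - (x + 8193 / (n * \<epsilon>\<^sup>2) * w)) \<le> expected_stable n (n + d)"
    by (simp add: right_diff_distrib)
  show ?thesis
    using w0 w_up w_low up low unfolding g1_def g2_def by (intro exI[of _ w]) auto
qed

section \<open>Limits uniform in the number of surplus women\<close>

definition deviation_bound :: "nat \<Rightarrow> real" where
  "deviation_bound n = 4 / (ln n)\<^sup>2 + 2 / ln n + (1 / n + 1 / sqrt n) * (1 + ln (1 + sqrt n))"

lemma deviation_bound_tendsto: "deviation_bound \<longlonglongrightarrow> 0"
  unfolding deviation_bound_def[abs_def] by real_asymp

text \<open>Two regimes. For d \<le> sqrt n, s is at least (ln n)/2 and v \<le> 1 suffices. For
  larger d, s \<ge> n/(n+d) gives v/s^2 \<le> 1/n + 1/d, while 1 + s grows at most logarithmically.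
  The factor 1 + s stands for 1/\<open>exp_mean s\<close>.\<close>

lemma deviation_le:
  fixes n d :: nat
  assumes n: "n \<ge> 2" and d: "d \<ge> 1"
  defines "s \<equiv> ln (real (n + d) / real d)" and "v \<equiv> 1 / real d - 1 / real (n + d)"
  shows "v * (1 + s) / s\<^sup>2 \<le> deviation_bound n"
proof -
  have s: "s > 0" using n d by (auto simp: s_def)
  have v: "0 \<le> v" "v \<le> 1"
  proof -
    show "0 \<le> v" using d by (simp add: v_def frac_le)
    have "1 / real d \<le> 1" using d by simp
    moreover have "0 \<le> 1 / real (n + d)" by simp
    ultimately show "v \<le> 1" unfolding v_def by linarith
  qed
  have ln0: "ln (real n) > 0" using n by simp
  have sq0: "sqrt (real n) > 0" using n by simp
  have N: "real (n + d) / real d = 1 + real n / real d" using d by (simp add: field_simps)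
  show ?thesis
  proof (cases "real d \<le> sqrt n")
    case True
    have "sqrt n = n / sqrt n" using n by (simp add: real_div_sqrt)
    also have "\<dots> \<le> n / d" using True d sq0 by (intro divide_left_mono) auto
    also have "\<dots> \<le> real (n + d) / real d" unfolding N by simp
    finally have "ln (sqrt n) \<le> s" unfolding s_def using sq0 d by (subst ln_le_cancel_iff) auto
    then have l: "ln n / 2 \<le> s" using n by (simp add: ln_sqrt)
    have "v * (1 + s) / s\<^sup>2 \<le> 1 * (1 + s) / s\<^sup>2"
      using v s by (intro divide_right_mono mult_right_mono) auto
    also have "\<dots> = (1 / s)\<^sup>2 + 1 / s" using s by (simp add: field_simps power2_eq_square)
    also have "\<dots> \<le> (1 / (ln n / 2))\<^sup>2 + 1 / (ln n / 2)"
      using l ln0 s by (intro add_mono power_mono divide_left_mono mult_pos_pos) auto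
    also have "\<dots> = 4 / (ln n)\<^sup>2 + 2 / ln n" by (simp add: power_divide)
    also have "\<dots> \<le> deviation_bound n"
    proof -
      have "0 \<le> (1 / n + 1 / sqrt n) * (1 + ln (1 + sqrt n))"
        by (intro mult_nonneg_nonneg add_nonneg_nonneg) auto
      then show ?thesis unfolding deviation_bound_def by linarith
    qed
    finally show ?thesis .
  next
    case False
    have "ln (real d / real (n + d)) \<le> real d / real (n + d) - 1" using d by (intro ln_le_minus_one) auto
    also have "\<dots> = - (real n / real (n + d))" using d by (simp add: field_simps)
    finally have l: "real n / real (n + d) \<le> s" unfolding s_def using d by (simp add: ln_div)
    have "v / s\<^sup>2 \<le> v / (real n / real (n + d))\<^sup>2"
      using l v s n by (intro divide_left_mono power_mono mult_pos_pos) auto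
    also have "v / (real n / real (n + d))\<^sup>2 = 1 / d / (real n / real (n + d))"
    proof -
      have "v = 1 / d * (real n / real (n + d))"
        using d unfolding v_def by (simp add: diff_frac_eq)
      then show ?thesis using n by (simp add: power2_eq_square del: of_nat_add)
    qed
    also have "\<dots> = 1 / n + 1 / d"
      using n d by (simp add: add_divide_distrib)
    also have "\<dots> \<le> 1 / n + 1 / sqrt n"
      using False sq0 d by (intro add_left_mono divide_left_mono) auto
    finally have 1: "v / s\<^sup>2 \<le> 1 / n + 1 / sqrt n" .
    have "n / d \<le> n / sqrt n" using False sq0 d by (intro divide_left_mono) auto
    also have "\<dots> = sqrt n" using n by (simp add: real_div_sqrt)
    finally have "s \<le> ln (1 + sqrt n)" unfolding s_def N using d sq0 by (subst ln_le_cancel_iff) (auto intro: add_pos_nonneg)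
    with 1 have "v / s\<^sup>2 * (1 + s) \<le> (1 / n + 1 / sqrt n) * (1 + ln (1 + sqrt n))"
      using v s by (intro mult_mono) auto
    also have "\<dots> \<le> deviation_bound n"
      unfolding deviation_bound_def using ln0 by simp
    finally show ?thesis by simp
  qed
qed

text \<open>The claimed asymptotics as a function of s alone, using n1/(n2 - n1) = e^s - 1.\<close>

definition limit_formula :: "real \<Rightarrow> real" where
  "limit_formula s = (exp s - 1) / s * exp (- ((exp s - 1 - s) / (exp s - 1)))"

text \<open>The quantifier over d stands inside \<open>eventually\<close>, so that n2 may later vary
  freely with n1. Everything is measured in units of S exp (\<kappa> - 1), which equals the limit
  formula. First \<epsilon> is chosen from \<eta>, then n grows, so that all terms with
  1/\<epsilon>^2 vanish.\<close>

lemma expected_stable_uniform: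
  assumes "\<eta> > 0"
  shows "eventually (\<lambda>n. \<forall>d\<ge>1. \<bar>expected_stable n (n + d) / limit_formula (ln (real (n + d) / real d)) - 1\<bar> < \<eta>) sequentially"
proof -
  define U where "U \<epsilon> n = exp (320 * \<epsilon> + exponent_error n) * (1 / (1 - \<epsilon>) + 3 * deviation_bound n / \<epsilon>\<^sup>2)
     + exp 3 * (3 * deviation_bound n / \<epsilon>\<^sup>2 + 8193 / (n * \<epsilon>\<^sup>2) * (1 / (1 - \<epsilon>) + 3 * deviation_bound n / \<epsilon>\<^sup>2))" for \<epsilon> :: real and n :: nat
  define L where "L \<epsilon> n = exp (- 320 * \<epsilon> - exponent_error n) *
     ((1 / (1 + \<epsilon>) - 3 * deviation_bound n / \<epsilon>\<^sup>2) * (1 - 8193 / (n * \<epsilon>\<^sup>2)) - 3 * deviation_bound n / \<epsilon>\<^sup>2)" for \<epsilon> :: real and n :: nat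
  have "((\<lambda>\<epsilon>::real. exp (320 * \<epsilon>) / (1 - \<epsilon>)) \<longlongrightarrow> 1) (at_right 0)" by real_asymp
  then have "eventually (\<lambda>\<epsilon>. exp (320 * \<epsilon>) / (1 - \<epsilon>) < 1 + \<eta>) (at_right 0)"
    using assms by (intro order_tendstoD) auto
  moreover have "((\<lambda>\<epsilon>::real. exp (- 320 * \<epsilon>) / (1 + \<epsilon>)) \<longlongrightarrow> 1) (at_right 0)" by real_asymp
  then have "eventually (\<lambda>\<epsilon>. exp (- 320 * \<epsilon>) / (1 + \<epsilon>) > 1 - \<eta>) (at_right 0)"
    using assms by (intro order_tendstoD) auto
  moreover have "eventually (\<lambda>\<epsilon>::real. 0 < \<epsilon> \<and> \<epsilon> < 1 / 2) (at_right 0)"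
    using eventually_at_right_real[of 0 "1/2::real"] by (auto elim: eventually_mono)
  ultimately have "eventually (\<lambda>\<epsilon>. exp (320 * \<epsilon>) / (1 - \<epsilon>) < 1 + \<eta> \<and> exp (- 320 * \<epsilon>) / (1 + \<epsilon>) > 1 - \<eta> \<and> 0 < \<epsilon> \<and> \<epsilon> < 1 / 2) (at_right 0)"
    by eventually_elim auto
  then obtain \<epsilon> where eU: "exp (320 * \<epsilon>) / (1 - \<epsilon>) < 1 + \<eta>" and eL: "exp (- 320 * \<epsilon>) / (1 + \<epsilon>) > 1 - \<eta>"
    and e: "0 < \<epsilon>" "\<epsilon> < 1 / 2"
    using eventually_happens'[of "at_right (0::real)"] by (auto simp: trivial_limit_at_right_real)
  have inv: "(\<lambda>n. 8193 / (real n * \<epsilon>\<^sup>2)) \<longlonglongrightarrow> 0"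
    using e by real_asymp
  have "U \<epsilon> \<longlonglongrightarrow> exp (320 * \<epsilon> + 0) * (1 / (1 - \<epsilon>) + 3 * 0 / \<epsilon>\<^sup>2)
     + exp 3 * (3 * 0 / \<epsilon>\<^sup>2 + 0 * (1 / (1 - \<epsilon>) + 3 * 0 / \<epsilon>\<^sup>2))"
    unfolding U_def using e by (intro tendsto_intros exponent_error_tendsto deviation_bound_tendsto inv) auto
  then have evU: "eventually (\<lambda>n. U \<epsilon> n < 1 + \<eta>) sequentially"
    using eU by (intro order_tendstoD(2)) auto
  have "L \<epsilon> \<longlonglongrightarrow> exp (- 320 * \<epsilon> - 0) * ((1 / (1 + \<epsilon>) - 3 * 0 / \<epsilon>\<^sup>2) * (1 - 0) - 3 * 0 / \<epsilon>\<^sup>2)"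
    unfolding L_def using e by (intro tendsto_intros exponent_error_tendsto deviation_bound_tendsto inv) auto
  then have evL: "eventually (\<lambda>n. L \<epsilon> n > 1 - \<eta>) sequentially"
    using eL by (intro order_tendstoD(1)) auto
  have evI: "eventually (\<lambda>n. 8193 / (real n * \<epsilon>\<^sup>2) < 1) sequentially"
    using inv by (rule order_tendstoD) simp
  show ?thesis
    using evU evL evI rate_bound_small eventually_ge_at_top[of 2]
  proof (eventually_elim, intro allI impI)
    fix n d :: nat
    assume U: "U \<epsilon> n < 1 + \<eta>" and L: "1 - \<eta> < L \<epsilon> n" and I: "8193 / (real n * \<epsilon>\<^sup>2) < 1"
      and small: "rate_bound n \<le> real n / 2 \<and> range_bound n \<le> 1 / 2" and n: "2 \<le> n" and d: "1 \<le> d"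
    define s where "s = ln (real (n + d) / real d)"
    define D where "D = real (n + d) / real d"
    define v where "v = 1 / real d - 1 / real (n + d)"
    define x where "x = 1 / (\<epsilon> * s)\<^sup>2 * (D * (3 * v))"
    define \<kappa> where "\<kappa> = s * d / n"
    define E where "E = expected_stable n (n + d)"
    define S where "S = D * exp_mean s"
    define \<beta> where "\<beta> = 3 * deviation_bound n / \<epsilon>\<^sup>2"
    define i where "i = 8193 / (real n * \<epsilon>\<^sup>2)"
    have n1: "n \<ge> 1" and e': "\<epsilon> \<le> 1 / 2" using n e by auto
    have s: "s > 0" using n d by (auto simp: s_def)
    have D: "D > 0" using d by (simp add: D_def)
    have v: "v \<ge> 0" using d by (simp add: v_def frac_le)
    have h: "exp_mean s > 0" by (rule exp_mean_pos[OF s])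
    have S: "S > 0" unfolding S_def using D h by simp
    have es: "exp s = real (n + d) / real d" unfolding s_def using d by simp
    then have es1: "exp s - 1 = real n / real d" using d by (simp add: field_simps)
    have \<kappa>: "0 \<le> \<kappa>"
      using s by (simp add: \<kappa>_def)
    obtain w where w: "w \<ge> 0" "w \<le> D * (exp_mean s / (1 - \<epsilon>)) + x" "D * (exp_mean s / (1 + \<epsilon>)) \<le> w + x"
      "E \<le> exp (\<kappa> - 1 + 320 * \<epsilon> + exponent_error n) * w + exp 2 * (x + i * w)"
      "exp (\<kappa> - 1 - 320 * \<epsilon> - exponent_error n) * (w - (x + i * w)) \<le> E"
      using expected_stable_bounds[OF n1 d e(1) e' conjunct1[OF small] conjunct2[OF small],
        folded s_def, folded D_def v_def, folded x_def \<kappa>_def i_def E_def] by (elim exE conjE) (rule that)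
    \<comment> \<open>Mass and Chebyshev error in units of S: the first is 1 up to \<epsilon> and a
      vanishing error, the second is at most \<open>\<beta>\<close>.\<close>
    define \<omega> where "\<omega> = w / S"
    define \<xi> where "\<xi> = x / S"
    have wS: "w = \<omega> * S" "x = \<xi> * S" using S by (auto simp: \<omega>_def \<xi>_def)
    have \<xi>: "0 \<le> \<xi>" "\<xi> \<le> \<beta>"
    proof -
      show "0 \<le> \<xi>" unfolding \<xi>_def x_def using D v S by simp
      have "\<xi> = 3 * v / (\<epsilon>\<^sup>2 * s\<^sup>2) * (1 / exp_mean s)"
        unfolding \<xi>_def x_def S_def using D h by (simp add: power_mult_distrib field_simps)
      also have "1 / exp_mean s \<le> 1 + s"
        using exp_mean_ge[OF s] h s by (simp add: field_simps)
      then have "3 * v / (\<epsilon>\<^sup>2 * s\<^sup>2) * (1 / exp_mean s) \<le> 3 * v / (\<epsilon>\<^sup>2 * s\<^sup>2) * (1 + s)"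
        using v by (intro mult_left_mono) auto
      also have "\<dots> = 3 * (v * (1 + s) / s\<^sup>2) / \<epsilon>\<^sup>2" by (simp add: mult_ac)
      also have "\<dots> \<le> \<beta>"
        unfolding \<beta>_def using deviation_le[OF n d] unfolding s_def[symmetric] v_def[symmetric]
        by (intro divide_right_mono mult_left_mono) auto
      finally show "\<xi> \<le> \<beta>" .
    qed
    have \<omega>0: "\<omega> \<ge> 0" unfolding \<omega>_def using w(1) S by simp
    have "S * \<omega> \<le> S * (1 / (1 - \<epsilon>) + \<xi>)"
      using w(2) unfolding S_def[symmetric] wS by (simp add: algebra_simps S_def)
    then have \<omega>_up: "\<omega> \<le> 1 / (1 - \<epsilon>) + \<beta>" using S \<xi> by simp
    have "S * (1 / (1 + \<epsilon>)) \<le> S * (\<omega> + \<xi>)"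
      using w(3) unfolding S_def[symmetric] wS by (simp add: algebra_simps S_def)
    then have "1 / (1 + \<epsilon>) \<le> \<omega> + \<xi>" using S by (simp only: mult_le_cancel_left_pos)
    then have \<omega>_low: "1 / (1 + \<epsilon>) - \<beta> \<le> \<omega>" using \<xi> by linarith
    have i: "0 \<le> i" "i < 1" using I by (auto simp: i_def)
    define R where "R = E / (S * exp (\<kappa> - 1))"
    have den: "S * exp (\<kappa> - 1) > 0" using S by simp
    have "R \<le> exp (320 * \<epsilon> + exponent_error n) * \<omega> + exp (3 - \<kappa>) * (\<xi> + i * \<omega>)"
    proof -
      have "E \<le> (exp (320 * \<epsilon> + exponent_error n) * \<omega> + exp (3 - \<kappa>) * (\<xi> + i * \<omega>)) * (S * exp (\<kappa> - 1))"
      proof -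
        have e1: "exp (\<kappa> - 1 + 320 * \<epsilon> + exponent_error n) = exp (320 * \<epsilon> + exponent_error n) * exp (\<kappa> - 1)"
          by (simp add: exp_add[symmetric] algebra_simps)
        \<comment> \<open>Since \<kappa> \<ge> 0, dividing the crude bound e^2 by exp (\<kappa> - 1)
          gives at most the e^3 that occurs in \<open>U\<close>.\<close>
        have e2: "exp 2 = exp (3 - \<kappa>) * exp (\<kappa> - 1)" by (simp add: exp_add[symmetric])
        show ?thesis using w(4) unfolding wS e1 e2 by (simp add: algebra_simps)
      qed
      then show ?thesis unfolding R_def using den by (simp add: divide_le_eq)
    qed
    also have "\<dots> \<le> exp (320 * \<epsilon> + exponent_error n) * (1 / (1 - \<epsilon>) + \<beta>) + exp 3 * (\<beta> + i * (1 / (1 - \<epsilon>) + \<beta>))"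
      using \<xi> \<omega>0 \<omega>_up i \<kappa> by (intro add_mono mult_mono) (auto intro!: add_nonneg_nonneg mult_nonneg_nonneg)
    also have "\<dots> = U \<epsilon> n" unfolding U_def \<beta>_def i_def by simp
    finally have R_up: "R < 1 + \<eta>" using U by linarith
    have "L \<epsilon> n = exp (- 320 * \<epsilon> - exponent_error n) * ((1 / (1 + \<epsilon>) - \<beta>) * (1 - i) - \<beta>)"
      unfolding L_def \<beta>_def i_def by simp
    also have "\<dots> \<le> exp (- 320 * \<epsilon> - exponent_error n) * (\<omega> * (1 - i) - \<xi>)"
      using \<omega>_low \<xi> i by (intro mult_left_mono diff_mono mult_right_mono) auto
    also have "\<dots> \<le> R"
    proof -
      have "(exp (- 320 * \<epsilon> - exponent_error n) * (\<omega> * (1 - i) - \<xi>)) * (S * exp (\<kappa> - 1)) \<le> E"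
      proof -
        have e1: "exp (\<kappa> - 1 - 320 * \<epsilon> - exponent_error n) = exp (- 320 * \<epsilon> - exponent_error n) * exp (\<kappa> - 1)"
          by (simp add: exp_add[symmetric] algebra_simps)
        show ?thesis using w(5) unfolding wS e1 by (simp add: algebra_simps)
      qed
      then show ?thesis unfolding R_def using den by (simp add: le_divide_eq)
    qed
    finally have R_low: "1 - \<eta> < R" using L by linarith
    have "limit_formula s = S * exp (\<kappa> - 1)"
    proof -
      have "(exp s - 1) / s = S"
      proof -
        have "D = exp s" by (simp add: D_def es)
        moreover have "exp s * (1 - exp (- s)) = exp s - 1"
          by (simp add: right_diff_distrib exp_minus_inverse)
        ultimately show ?thesis unfolding S_def exp_mean_def by (simp only: times_divide_eq_right)
      qed
      moreover have "- ((exp s - 1 - s) / (exp s - 1)) = \<kappa> - 1"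
        unfolding es1 \<kappa>_def using n d by (simp add: field_simps)
      ultimately show ?thesis by (simp only: limit_formula_def)
    qed
    then have "E / limit_formula s = R" by (simp add: R_def)
    with R_up R_low show "\<bar>expected_stable n (n + d) / limit_formula (ln (real (n + d) / real d)) - 1\<bar> < \<eta>"
      unfolding E_def[symmetric] s_def[symmetric] by auto
  qed
qed

section \<open>From the uniform estimate to sequences of pairs\<close>

lemma limit_formula_eq:
  fixes a b :: nat
  assumes "a < b" "a > 0"
  shows "exp (s_param a b) = b / (real b - real a)" "s_param a b > 0"
    "limit_formula (s_param a b)
      = real a * exp (- ((exp (s_param a b) - 1 - s_param a b) / (exp (s_param a b) - 1))) / ((real b - real a) * s_param a b)"
proof -
  have pos: "real b - real a > 0" using assms by simp
  show e: "exp (s_param a b) = b / (real b - real a)" unfolding s_param_def using assms by simp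
  show "s_param a b > 0" unfolding s_param_def using assms by simp
  have "exp (s_param a b) - 1 = a / (real b - real a)" unfolding e using pos by (simp add: field_simps)
  then have "(exp (s_param a b) - 1) / s_param a b = real a / ((real b - real a) * s_param a b)" by simp
  then show "limit_formula (s_param a b)
      = real a * exp (- ((exp (s_param a b) - 1 - s_param a b) / (exp (s_param a b) - 1))) / ((real b - real a) * s_param a b)"
    unfolding limit_formula_def by (simp only: times_divide_eq_left)
qed

lemma expected_stable_asymp_equiv:
  fixes n1 n2 :: "nat \<Rightarrow> nat"
  assumes less: "\<And>k. n1 k < n2 k" and lim: "filterlim n1 at_top sequentially"
  shows "(\<lambda>k. expected_stable (n1 k) (n2 k)) \<sim>[sequentially] (\<lambda>k. limit_formula (s_param (n1 k) (n2 k)))"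
proof (rule asymp_equivI', rule tendstoI)
  fix \<eta> :: real assume "\<eta> > 0"
  from eventually_compose_filterlim[OF expected_stable_uniform[OF this] lim]
  show "eventually (\<lambda>k. dist (expected_stable (n1 k) (n2 k) / limit_formula (s_param (n1 k) (n2 k))) 1 < \<eta>) sequentially"
  proof eventually_elim
    case (elim k)
    have d: "n2 k - n1 k \<ge> 1" "n1 k + (n2 k - n1 k) = n2 k" "real (n2 k - n1 k) = real (n2 k) - real (n1 k)"
      using less[of k] by auto
    show ?case using elim[rule_format, OF d(1)] unfolding d(2,3) s_param_def dist_real_def .
  qed
qed

text \<open>When n2/n1 tends to 1, s tends to infinity without having to be asymptotic to ln n1: if
  n2 - n1 is about n1/ln n1, then s is about ln ln n1. The limit in this case is therefore given
  with s in the denominator, and the form with ln n1 is shown to hold exactly when s \<sim> ln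
  n1.\<close>

theorem theorem1p3:
  fixes n1 n2 :: "nat \<Rightarrow> nat"
  assumes "\<And>k. n1 k < n2 k"
    and "filterlim n1 at_top sequentially"
  defines "ES \<equiv> \<lambda>k. expected_stable (n1 k) (n2 k)"
    and "s \<equiv> \<lambda>k. s_param (n1 k) (n2 k)"
  shows
    "(ES \<sim>[sequentially]
        (\<lambda>k. real (n1 k) * exp (- ((exp (s k) - 1 - s k) / (exp (s k) - 1)))
               / ((real (n2 k) - real (n1 k)) * s k)))
     \<and>
     ((\<lambda>k. (real (n2 k) - real (n1 k)) / real (n2 k)) \<longlonglongrightarrow> 0 \<longrightarrow>
        (ES \<sim>[sequentially]
           (\<lambda>k. exp (-1) * (real (n1 k) / ((real (n2 k) - real (n1 k)) * s k))))
        \<and>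
        (ES \<sim>[sequentially]
           (\<lambda>k. exp (-1) * (real (n1 k) / ((real (n2 k) - real (n1 k)) * ln (real (n1 k)))))
         \<longleftrightarrow> s \<sim>[sequentially] (\<lambda>k. ln (real (n1 k)))))
     \<and>
     (filterlim (\<lambda>k. real (n2 k) / real (n1 k)) at_top sequentially \<longrightarrow>
        ES \<longlonglongrightarrow> 1)
     \<and>
     (\<forall>c>1. (\<lambda>k. real (n2 k) / real (n1 k)) \<longlonglongrightarrow> c \<longrightarrow>
        ES \<longlonglongrightarrow> exp (-1) * (lam c / ln (lam c)))"
proof (intro conjI impI allI)
  let ?d = "\<lambda>k. real (n2 k) - real (n1 k)"
  have d: "?d k > 0" for k using assms(1)[of k] by simp
  have large: "eventually (\<lambda>k. n1 k \<ge> 2) sequentially"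
    using assms(2) unfolding filterlim_at_top by blast
  have F: "ES \<sim>[sequentially] (\<lambda>k. limit_formula (s k))"
    unfolding ES_def s_def by (rule expected_stable_asymp_equiv[OF assms(1,2)])
  have n2: "real (n2 k) > 0" for k using assms(1)[of k] by simp
  have s_eq: "s k = - ln (?d k / n2 k)" for k
    unfolding s_def s_param_def using d[of k] n2[of k] by (simp add: ln_div)
  show "ES \<sim>[sequentially]
        (\<lambda>k. real (n1 k) * exp (- ((exp (s k) - 1 - s k) / (exp (s k) - 1))) / (?d k * s k))"
    by (rule asymp_equiv_trans[OF F asymp_equiv_refl_ev], use large in eventually_elim)
       (use limit_formula_eq(3)[OF assms(1)] in \<open>simp add: s_def\<close>)
  have near_one: "eventually (\<lambda>k. 1 - inverse (real (n2 k) / real (n1 k)) = ?d k / n2 k) sequentially"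
    using large by eventually_elim (use n2 in \<open>simp add: field_simps\<close>)

  {
    assume "(\<lambda>k. ?d k / n2 k) \<longlonglongrightarrow> 0"
    then have "filterlim (\<lambda>k. ?d k / n2 k) (at_right 0) sequentially"
      using d n2 by (intro tendsto_imp_filterlim_at_right) (auto intro!: always_eventually)
    from filterlim_compose[OF ln_at_0 this] have s_top: "filterlim s at_top sequentially"
      unfolding s_eq[abs_def] by (rule filterlim_compose[OF filterlim_uminus_at_top_at_bot])
    have "((\<lambda>x::real. exp (- ((exp x - 1 - x) / (exp x - 1))) / exp (-1)) \<longlongrightarrow> 1) at_top"
      by real_asymp
    from filterlim_compose[OF this s_top]
    have "(\<lambda>k. exp (- ((exp (s k) - 1 - s k) / (exp (s k) - 1)))) \<sim>[sequentially] (\<lambda>_. exp (-1))"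
      by (rule asymp_equivI')
    then have "(\<lambda>k. (exp (s k) - 1) / s k * exp (- ((exp (s k) - 1 - s k) / (exp (s k) - 1)))) \<sim>[sequentially]
       (\<lambda>k. (exp (s k) - 1) / s k * exp (-1))"
      by (intro asymp_equiv_intros)
    also have "(\<lambda>k. (exp (s k) - 1) / s k * exp (-1)) = (\<lambda>k. exp (-1) * (real (n1 k) / (?d k * s k)))"
    proof
      fix k
      have "exp (s k) - 1 = n1 k / ?d k"
        unfolding s_def s_param_def using d[of k] n2[of k] by (simp add: field_simps)
      then show "(exp (s k) - 1) / s k * exp (-1) = exp (-1) * (real (n1 k) / (?d k * s k))" by simp
    qed
    finally show P: "ES \<sim>[sequentially] (\<lambda>k. exp (-1) * (real (n1 k) / (?d k * s k)))"
      using asymp_equiv_trans[OF F] unfolding limit_formula_def by blast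
    show "ES \<sim>[sequentially] (\<lambda>k. exp (-1) * (real (n1 k) / (?d k * ln (real (n1 k)))))
         \<longleftrightarrow> s \<sim>[sequentially] (\<lambda>k. ln (real (n1 k)))"
    proof
      assume "s \<sim>[sequentially] (\<lambda>k. ln (real (n1 k)))"
      then have "(\<lambda>k. exp (-1) * (real (n1 k) / (?d k * s k))) \<sim>[sequentially]
         (\<lambda>k. exp (-1) * (real (n1 k) / (?d k * ln (real (n1 k)))))"
        by (intro asymp_equiv_intros)
      with P show "ES \<sim>[sequentially] (\<lambda>k. exp (-1) * (real (n1 k) / (?d k * ln (real (n1 k)))))"
        by (rule asymp_equiv_trans)
    next
      assume "ES \<sim>[sequentially] (\<lambda>k. exp (-1) * (real (n1 k) / (?d k * ln (real (n1 k)))))"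
      with asymp_equiv_symI[OF P]
      have PQ: "(\<lambda>k. exp (-1) * (real (n1 k) / (?d k * s k))) \<sim>[sequentially]
         (\<lambda>k. exp (-1) * (real (n1 k) / (?d k * ln (real (n1 k)))))"
        by (rule asymp_equiv_trans)
      \<comment> \<open>Dividing the common numerator by both sides isolates s and ln n1.\<close>
      have "(\<lambda>k. (exp (-1) * (real (n1 k) / ?d k)) / (exp (-1) * (real (n1 k) / (?d k * s k)))) \<sim>[sequentially]
         (\<lambda>k. (exp (-1) * (real (n1 k) / ?d k)) / (exp (-1) * (real (n1 k) / (?d k * ln (real (n1 k))))))"
        by (intro asymp_equiv_divide asymp_equiv_refl PQ)
      also have "?this \<longleftrightarrow> s \<sim>[sequentially] (\<lambda>k. ln (real (n1 k)))"
      proof (rule asymp_equiv_cong)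
        show "eventually (\<lambda>k. (exp (-1) * (real (n1 k) / ?d k)) / (exp (-1) * (real (n1 k) / (?d k * s k))) = s k) sequentially"
          using large by eventually_elim (use d in \<open>auto simp: less_le\<close>)
        show "eventually (\<lambda>k. (exp (-1) * (real (n1 k) / ?d k)) / (exp (-1) * (real (n1 k) / (?d k * ln (real (n1 k))))) = ln (real (n1 k))) sequentially"
          using large by eventually_elim (use d in \<open>auto simp: less_le\<close>)
      qed
      finally show "s \<sim>[sequentially] (\<lambda>k. ln (real (n1 k)))" .
    qed
  }

  {
    assume "filterlim (\<lambda>k. real (n2 k) / real (n1 k)) at_top sequentially"
    then have "(\<lambda>k. 1 - inverse (real (n2 k) / real (n1 k))) \<longlonglongrightarrow> 1 - 0"
      by (intro tendsto_intros tendsto_inverse_0_at_top)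
    then have "(\<lambda>k. ?d k / n2 k) \<longlonglongrightarrow> 1" using near_one by (simp add: tendsto_cong)
    then have "s \<longlonglongrightarrow> - ln 1" unfolding s_eq[abs_def] by (intro tendsto_intros) auto
    then have "filterlim s (at_right 0) sequentially"
      using limit_formula_eq(2)[OF assms(1)] large
      by (intro tendsto_imp_filterlim_at_right) (auto simp: s_def elim: eventually_mono)
    moreover have "(limit_formula \<longlongrightarrow> 1) (at_right 0)"
      unfolding limit_formula_def[abs_def] by real_asymp
    ultimately have "(\<lambda>k. limit_formula (s k)) \<longlonglongrightarrow> 1"
      by (rule filterlim_compose[rotated])
    then show "ES \<longlonglongrightarrow> 1" using tendsto_asymp_equiv_cong[OF F] by blast
  }

  fix c :: real
  assume c: "c > 1" and lim: "(\<lambda>k. real (n2 k) / real (n1 k)) \<longlonglongrightarrow> c"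
  define \<sigma> where "\<sigma> = ln (c / (c - 1))"
  have \<sigma>: "\<sigma> > 0" using c by (simp add: \<sigma>_def)
  have e\<sigma>: "exp \<sigma> - 1 = 1 / (c - 1)" using c by (simp add: \<sigma>_def field_simps)
  have "(\<lambda>k. 1 - inverse (real (n2 k) / real (n1 k))) \<longlonglongrightarrow> 1 - inverse c"
    using c by (intro tendsto_intros lim) auto
  then have "(\<lambda>k. ?d k / n2 k) \<longlonglongrightarrow> 1 - inverse c" using near_one by (simp add: tendsto_cong)
  then have "s \<longlonglongrightarrow> - ln (1 - inverse c)"
    unfolding s_eq[abs_def] using c by (intro tendsto_intros) (auto simp: field_simps)
  also have "- ln (1 - inverse c) = \<sigma>"
  proof -
    have "1 - inverse c = (c - 1) / c" using c by (simp add: field_simps)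
    then show ?thesis using c by (simp add: \<sigma>_def ln_div)
  qed
  finally have s_lim: "s \<longlonglongrightarrow> \<sigma>" .
  have "(\<lambda>k. limit_formula (s k)) \<longlonglongrightarrow> limit_formula \<sigma>"
    unfolding limit_formula_def using \<sigma> by (intro tendsto_intros s_lim) auto
  moreover have "limit_formula \<sigma> = exp (-1) * (lam c / ln (lam c))"
  proof -
    \<comment> \<open>As e^\<sigma> - 1 = 1/(c - 1), the limit of s d/n is (c - 1) \<sigma> = ln
      (\<open>lam c\<close>): it gives the denominator directly and the numerator through the
      exponential.\<close>
    have lam: "lam c = exp ((c - 1) * \<sigma>)" using c by (simp add: lam_def powr_def \<sigma>_def)
    have "- ((exp \<sigma> - 1 - \<sigma>) / (exp \<sigma> - 1)) = - 1 + (c - 1) * \<sigma>"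
      unfolding e\<sigma> using c by (simp add: field_simps)
    then have "limit_formula \<sigma> = 1 / (c - 1) / \<sigma> * exp (- 1 + (c - 1) * \<sigma>)"
      unfolding limit_formula_def e\<sigma> by simp
    also have "\<dots> = exp (-1) * (lam c / ln (lam c))"
      unfolding lam exp_add by simp
    finally show ?thesis .
  qed
  ultimately show "ES \<longlonglongrightarrow> exp (-1) * (lam c / ln (lam c))"
    using tendsto_asymp_equiv_cong[OF F] by simp
qed

end
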